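(* Consider the overlaid primary and secondary networks on the unit square operating under the primary and secondary protocols described in the context. The delay-throughput tradeoff for the secondary network, relating its packet delay $D_s(m)$ to its throughput per S-D pair $\lambda_s(m)$, is $$D_s(m)=\Theta\left(m\lambda_s(m)\right),\quad\text{for }\lambda_s(m)=O\left(\frac{1}{\sqrt{m\log m}}\right).$$
   Context: W.h.p. means with probability tending to 1 as $n\to\infty$ (equivalently $m\to\infty$). $O,\Omega,\Theta$ have their usual asymptotic meaning; $\log$ is the natural logarithm in the cell sizes. Network model. Primary nodes form a Poisson point process of density $n$ on the unit square and secondary nodes a Poisson point process of density $m=n^\beta$, $\beta>1$. Nodes of each network are randomly grouped into one-to-one source-destination (S-D) pairs. The channel power gain at distance $r$ is $g(r)=r^{-\alpha}$, $\alpha>2$, with noise power $N_0$ and unit bandwidth. An active transmitter (TX)/receiver (RX) pair at distance $d$ with transmit power $P$ has rate $\log\left(1+\frac{P g(d)}{N_0+I}\right)$, where $I$ is the total interference at the RX from all other active TXs of both networks (a TX of power $P'$ at distance $r$ contributes $P'g(r)$). Primary protocol. The unit square is divided into square primary cells of area $a_p=\frac{k_1\log n}{n}$, $k_1\ge1$, grouped into clusters of $25$ ($5\times5$) cells. Time is split into TDMA frames of 25 slots, each of constant length $t_p$; in each slot one cell per cluster is active, cells taking turns in round-robin fashion, with the same pattern in all clusters. The data path of an S-D pair is the horizontal line (HDP) followed by the vertical line (VDP) connecting source to destination. In each cell one node is the designated relay node (nodes take turns). When a cell is active, its slot is divided into packet slots, one for each data path passing through or originating from the cell: the relay transmits one packet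 for each path passing through the cell, then each source in the cell transmits one packet. Each packet goes to the relay node of the neighboring cell along the data path, or directly to the destination if that is the next hop (the destination may be in the same or a neighboring cell). Received packets are buffered and sent in the next active slot of the cell. TX power is $P_0a_p^{\alpha/2}$, $P_0$ constant. Secondary protocol. Same construction with square secondary cells of area $a_s=\frac{k_2\log m}{m}$, $k_2=k_1\ge1$, clusters of 25 cells, 25-slot TDMA, horizontal-then-vertical data paths, relay nodes, and TX power $P_1a_s^{\alpha/2}$, $P_1$ constant; one secondary TDMA frame has the duration $t_p$ of one primary slot. Around each primary cell containing an active primary TX there is a preservation region, a square of $M^2$ secondary cells, $M=\lfloor 3\sqrt{a_p/a_s}\rfloor+2$, in which no secondary node may transmit (but may receive). A relay node in a preservation region buffers packets until the region is cleared and its cell is active. Fluid model: the packet size scales proportionally to the throughput (arbitrarily small as the density grows), so that each packet arriving at a cell is sent at the next transmission opportunity of that cell. Throughput. For a network with $n_t$ nodes, the throughput per S-D pair $\lambda(n_t)$ is the average data rate that each source can transmit to its destination w.h.p. in multi-hop fashion under the given scheduling scheme, i.e. $p\left(\min_{1\le i\le n_t/2}\liminf_{t\to\infty}\frac1tM_i(t)\ge\lambda(n_t)\right)\to1$ as $n_t\to\infty$, where $M_i(t)$ is the number of bits S-D pair $i$ transmitted in $t$ time slots. For the secondary network it is written $\lambda_s(m)$. Delay. The delay $D_i(j)$ of packet $j$ of S-D pair $i$ is the time from departure from the source to arrival at the destination; $D_i=\limsup_{k\to\infty}\frac1k\sum_{j=1}^kD_i(j)$; and the packet delay is $D(n_t)=\frac{2}{n_t}\sum_{i=1}^{n_t/2}E[D_i]$.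 For the secondary network it is written $D_s(m)$.
   Formalization: The expected delay is conditioned on every primary and secondary cell containing a node (otherwise some packets never arrive); the throughput is the achieved rate of maximal order; the primary cell area is at most 1/25, so that a 5x5 cluster fits. *)

theory Defs
  imports "HOL-Probability.Probability" "HOL-Library.Landau_Symbols" "HOL-Library.Infinite_Set"
begin

section \<open>Nodes and source-destination pairs\<close>

type_synonym point = "real \<times> real"
type_synonym cell = "int \<times> int"

text \<open>A configuration \<open>(N, X)\<close> has the nodes \<open>0, \<dots>, N - 1\<close>, node \<open>i\<close> being at \<open>X i\<close>.\<close>

type_synonym config = "nat \<times> (nat \<Rightarrow> point)"

text \<open>The Poisson point process of density \<open>d\<close> on the unit square: a Poisson number of independent,
  uniformly distributed points.  The labels are independent of the positions and exchangeable, so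
  pairing node \<open>2 * i\<close> (source) with node \<open>2 * i + 1\<close> (destination) is a uniformly random pairing
  of the points. If the number of nodes is odd, the last one belongs to no pair.\<close>

definition node_process :: "real \<Rightarrow> config measure" where
  "node_process d = measure_pmf (poisson_pmf d) \<Otimes>\<^sub>M
     (\<Pi>\<^sub>M i\<in>UNIV. uniform_measure lborel ({0..<1} \<times> {0..<1}))"

definition num_pairs :: "config \<Rightarrow> nat" where
  "num_pairs w = fst w div 2"

definition src :: "config \<Rightarrow> nat \<Rightarrow> point" where
  "src w i = snd w (2 * i)"

definition dst :: "config \<Rightarrow> nat \<Rightarrow> point" where
  "dst w i = snd w (2 * i + 1)"


section \<open>Cells, data paths and TDMA, common to both networks\<close>

text \<open>\<open>q\<close> is the number of cells along each side of the unit square.\<close>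

definition grid :: "nat \<Rightarrow> cell set" where
  "grid q = {0..<int q} \<times> {0..<int q}"

definition cell_of :: "nat \<Rightarrow> point \<Rightarrow> cell" where
  "cell_of q z = (\<lfloor>real q * fst z\<rfloor>, \<lfloor>real q * snd z\<rfloor>)"

definition nodes_in :: "nat \<Rightarrow> config \<Rightarrow> cell \<Rightarrow> nat list" where
  "nodes_in q w c = sorted_list_of_set {i. i < fst w \<and> cell_of q (snd w i) = c}"

text \<open>The \<open>k\<close>-th cell on the way from one cell to another: first along the row of the source, then
  along the column of the destination.\<close>

fun route :: "cell \<Rightarrow> cell \<Rightarrow> nat \<Rightarrow> cell" where
  "route (x, y) (x', y') k =
     (if int k \<le> \<bar>x' - x\<bar> then (x + sgn (x' - x) * int k, y)
      else (x', y + sgn (y' - y) * (int k - \<bar>x' - x\<bar>)))"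

fun cell_dist :: "cell \<Rightarrow> cell \<Rightarrow> nat" where
  "cell_dist (x, y) (x', y') = nat (\<bar>x' - x\<bar> + \<bar>y' - y\<bar>)"

definition path :: "nat \<Rightarrow> config \<Rightarrow> nat \<Rightarrow> nat \<Rightarrow> cell" where
  "path q w i k = route (cell_of q (src w i)) (cell_of q (dst w i)) k"

text \<open>The number of transmissions of each packet of pair \<open>i\<close>. The last one is received by the
  destination itself, so the cell of the destination does not relay; if source and destination
  share a cell, there is one direct transmission.\<close>

definition hops :: "nat \<Rightarrow> config \<Rightarrow> nat \<Rightarrow> nat" where
  "hops q w i = max 1 (cell_dist (cell_of q (src w i)) (cell_of q (dst w i)))"

definition passing :: "nat \<Rightarrow> config \<Rightarrow> cell \<Rightarrow> nat set" where
  "passing q w c = {i. i < num_pairs w \<and> (\<exists>k. 0 < k \<and> k < hops q w i \<and> path q w i k = c)}"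

definition originating :: "nat \<Rightarrow> config \<Rightarrow> cell \<Rightarrow> nat set" where
  "originating q w c = {i. i < num_pairs w \<and> cell_of q (src w i) = c}"

text \<open>The packet slots of a cell in their order within each of its active slots.\<close>

definition packet_slots :: "nat \<Rightarrow> config \<Rightarrow> cell \<Rightarrow> nat list" where
  "packet_slots q w c =
     sorted_list_of_set (passing q w c) @ sorted_list_of_set (originating q w c)"

definition slot_index :: "nat \<Rightarrow> config \<Rightarrow> cell \<Rightarrow> nat \<Rightarrow> nat" where
  "slot_index q w c i =
     (LEAST k. k < length (packet_slots q w c) \<and> packet_slots q w c ! k = i)"

text \<open>Round robin through the 5 x 5 clusters, row by row; slots are numbered consecutively.\<close>

definition tdma_active :: "cell \<Rightarrow> nat \<Rightarrow> bool" where
  "tdma_active c v \<longleftrightarrow> int (v mod 25) = 5 * (snd c mod 5) + fst c mod 5"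

text \<open>From here on, \<open>may c v\<close> tells whether cell \<open>c\<close> is allowed to transmit in slot \<open>v\<close>, and \<open>s\<close> is
  the length of a slot.

  The nodes of a cell take turns as its relay. A turn begins after a slot in which the cell may
  transmit and ends with the next such slot, so the node that receives a packet also forwards it.\<close>

definition relay :: "nat \<Rightarrow> config \<Rightarrow> (cell \<Rightarrow> nat \<Rightarrow> bool) \<Rightarrow> cell \<Rightarrow> nat \<Rightarrow> point" where
  "relay q w may c v =
     snd w (nodes_in q w c ! (card {u. u < v \<and> may c u} mod length (nodes_in q w c)))"

definition transmitting :: "nat \<Rightarrow> config \<Rightarrow> (cell \<Rightarrow> nat \<Rightarrow> bool) \<Rightarrow> cell \<Rightarrow> nat \<Rightarrow> bool" where
  "transmitting q w may c v \<longleftrightarrow>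
     c \<in> grid q \<and> may c v \<and> packet_slots q w c \<noteq> [] \<and> nodes_in q w c \<noteq> []"

text \<open>The position of the transmitter of cell \<open>c\<close> at time \<open>t\<close>.\<close>

definition transmitter ::
  "nat \<Rightarrow> config \<Rightarrow> (cell \<Rightarrow> nat \<Rightarrow> bool) \<Rightarrow> real \<Rightarrow> cell \<Rightarrow> real \<Rightarrow> point" where
  "transmitter q w may s c t =
     (let k = nat \<lfloor>frac (t / s) * real (length (packet_slots q w c))\<rfloor>;
          i = packet_slots q w c ! k
      in if i \<in> originating q w c then src w i else relay q w may c (nat \<lfloor>t / s\<rfloor>))"

text \<open>The receiver of the \<open>k\<close>-th transmission (from 0) of pair \<open>i\<close>, if it takes place in slot \<open>v\<close>.\<close>

definition receiver ::
  "nat \<Rightarrow> config \<Rightarrow> (cell \<Rightarrow> nat \<Rightarrow> bool) \<Rightarrow> nat \<Rightarrow> nat \<Rightarrow> nat \<Rightarrow> point" where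
  "receiver q w may i k v =
     (if Suc k < hops q w i then relay q w may (path q w i (Suc k)) v else dst w i)"

text \<open>The slot of the \<open>k\<close>-th transmission of packet \<open>j\<close> of pair \<open>i\<close>. Each source sends one new packet
  whenever its cell may transmit. In the fluid model, every packet that has arrived at a cell leaves
  it the next time the cell may transmit; packets of the same pair that have accumulated while the
  cell was silent share the packet slot of this pair.\<close>

primrec hop_slot ::
  "nat \<Rightarrow> config \<Rightarrow> (cell \<Rightarrow> nat \<Rightarrow> bool) \<Rightarrow> nat \<Rightarrow> nat \<Rightarrow> nat \<Rightarrow> nat" where
  "hop_slot q w may i j 0 = enumerate {v. may (path q w i 0) v} j"
| "hop_slot q w may i j (Suc k) =
     (LEAST v. hop_slot q w may i j k < v \<and> may (path q w i (Suc k)) v)"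

text \<open>The time of the beginning (\<open>e = 0\<close>) or end (\<open>e = 1\<close>) of the packet slot of pair \<open>i\<close> in
  slot \<open>v\<close> of cell \<open>c\<close>.\<close>

definition packet_time :: "nat \<Rightarrow> config \<Rightarrow> real \<Rightarrow> cell \<Rightarrow> nat \<Rightarrow> nat \<Rightarrow> nat \<Rightarrow> real" where
  "packet_time q w s c i v e =
     s * (real v + real (slot_index q w c i + e) / real (length (packet_slots q w c)))"

definition packet_delay ::
  "nat \<Rightarrow> config \<Rightarrow> (cell \<Rightarrow> nat \<Rightarrow> bool) \<Rightarrow> real \<Rightarrow> nat \<Rightarrow> nat \<Rightarrow> real" where
  "packet_delay q w may s i j =
     (let h = hops q w i - 1
      in packet_time q w s (path q w i h) i (hop_slot q w may i j h) 1
         - packet_time q w s (path q w i 0) i (hop_slot q w may i j 0) 0)"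

definition pair_delay ::
  "nat \<Rightarrow> config \<Rightarrow> (cell \<Rightarrow> nat \<Rightarrow> bool) \<Rightarrow> real \<Rightarrow> nat \<Rightarrow> ereal" where
  "pair_delay q w may s i =
     limsup (\<lambda>k. ereal ((\<Sum>j<k. packet_delay q w may s i j) / real k))"


section \<open>The overlaid networks\<close>

text \<open>\<open>slot_len\<close> is the primary slot length. \<open>cell_factor\<close> is the factor \<open>k\<^sub>1 = k\<^sub>2\<close> in the cell areas;
  it may depend on the primary density, which is what moves the system along the tradeoff curve.\<close>

record overlay =
  path_loss :: real
  noise :: real
  density_exp :: real
  primary_pow :: real
  secondary_pow :: real
  slot_len :: real
  cell_factor :: "real \<Rightarrow> real"

text \<open>All quantities are indexed by the secondary density \<open>m = n powr density_exp\<close>.\<close>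

definition primary_density :: "overlay \<Rightarrow> real \<Rightarrow> real" where
  "primary_density Q m = m powr (1 / density_exp Q)"

text \<open>A whole number of cells has to fit along each side of the unit square. The nominal areas
  \<open>k\<^sub>1 * ln n / n\<close> and \<open>k\<^sub>2 * ln m / m\<close> are therefore enlarged to the next areas of the
  form \<open>1 / q\<^sup>2\<close>.\<close>

definition primary_cells :: "overlay \<Rightarrow> real \<Rightarrow> nat" where
  "primary_cells Q m =
     (let n = primary_density Q m in nat \<lfloor>1 / sqrt (cell_factor Q n * ln n / n)\<rfloor>)"

definition secondary_cells :: "overlay \<Rightarrow> real \<Rightarrow> nat" where
  "secondary_cells Q m =
     nat \<lfloor>1 / sqrt (cell_factor Q (primary_density Q m) * ln m / m)\<rfloor>"

definition primary_area :: "overlay \<Rightarrow> real \<Rightarrow> real" where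
  "primary_area Q m = 1 / (real (primary_cells Q m))\<^sup>2"

definition secondary_area :: "overlay \<Rightarrow> real \<Rightarrow> real" where
  "secondary_area Q m = 1 / (real (secondary_cells Q m))\<^sup>2"

definition preservation_width :: "overlay \<Rightarrow> real \<Rightarrow> int" where
  "preservation_width Q m = \<lfloor>3 * sqrt (primary_area Q m / secondary_area Q m)\<rfloor> + 2"

text \<open>The preservation region of the primary cell \<open>p\<close>. Its lower left corner is the secondary cell
  with the lower left corner of the 3 x 3 block of primary cells around \<open>p\<close>; its width makes it cover
  this block. It may stick out of the unit square.\<close>

definition preservation_region :: "overlay \<Rightarrow> real \<Rightarrow> cell \<Rightarrow> cell set" where
  "preservation_region Q m p =
     (let r = sqrt (primary_area Q m / secondary_area Q m);
          a = \<lfloor>r * of_int (fst p - 1)\<rfloor>; b = \<lfloor>r * of_int (snd p - 1)\<rfloor>; M = preservation_width Q m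
      in {a..<a + M} \<times> {b..<b + M})"

text \<open>The secondary TDMA frame \<open>v div 25\<close> of the secondary slot \<open>v\<close> coincides with the primary slot of
  the same number.\<close>

definition secondary_may :: "overlay \<Rightarrow> real \<Rightarrow> config \<Rightarrow> cell \<Rightarrow> nat \<Rightarrow> bool" where
  "secondary_may Q m wp c v \<longleftrightarrow> tdma_active c v \<and>
     (\<forall>p. transmitting (primary_cells Q m) wp tdma_active p (v div 25)
          \<longrightarrow> c \<notin> preservation_region Q m p)"

definition secondary_slot_len :: "overlay \<Rightarrow> real" where
  "secondary_slot_len Q = slot_len Q / 25"

definition gain :: "overlay \<Rightarrow> real \<Rightarrow> real" where
  "gain Q r = r powr (- path_loss Q)"

definition primary_tx_power :: "overlay \<Rightarrow> real \<Rightarrow> real" where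
  "primary_tx_power Q m = primary_pow Q * primary_area Q m powr (path_loss Q / 2)"

definition secondary_tx_power :: "overlay \<Rightarrow> real \<Rightarrow> real" where
  "secondary_tx_power Q m = secondary_pow Q * secondary_area Q m powr (path_loss Q / 2)"

text \<open>In the following, \<open>wp\<close> and \<open>ws\<close> are the configurations of the primary and secondary nodes.\<close>

definition secondary_transmitter ::
  "overlay \<Rightarrow> real \<Rightarrow> config \<Rightarrow> config \<Rightarrow> cell \<Rightarrow> real \<Rightarrow> point" where
  "secondary_transmitter Q m wp ws c t =
     transmitter (secondary_cells Q m) ws (secondary_may Q m wp) (secondary_slot_len Q) c t"

text \<open>Interference at the point \<open>z\<close> and time \<open>t\<close> with a reception from the secondary cell \<open>c\<close>.\<close>

definition interference ::
  "overlay \<Rightarrow> real \<Rightarrow> config \<Rightarrow> config \<Rightarrow> cell \<Rightarrow> point \<Rightarrow> real \<Rightarrow> real" where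
  "interference Q m wp ws c z t =
     (\<Sum>p \<in> {p \<in> grid (primary_cells Q m).
              transmitting (primary_cells Q m) wp tdma_active p (nat \<lfloor>t / slot_len Q\<rfloor>)}.
        primary_tx_power Q m *
        gain Q (dist (transmitter (primary_cells Q m) wp tdma_active (slot_len Q) p t) z)) +
     (\<Sum>c' \<in> {c' \<in> grid (secondary_cells Q m). c' \<noteq> c \<and>
              transmitting (secondary_cells Q m) ws (secondary_may Q m wp) c'
                (nat \<lfloor>t / secondary_slot_len Q\<rfloor>)}.
        secondary_tx_power Q m * gain Q (dist (secondary_transmitter Q m wp ws c' t) z))"

definition secondary_rate ::
  "overlay \<Rightarrow> real \<Rightarrow> config \<Rightarrow> config \<Rightarrow> cell \<Rightarrow> point \<Rightarrow> real \<Rightarrow> real" where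
  "secondary_rate Q m wp ws c z t =
     ln (1 + secondary_tx_power Q m * gain Q (dist (secondary_transmitter Q m wp ws c t) z)
             / (noise Q + interference Q m wp ws c z t))"

text \<open>The number of bits that the packet slot of the \<open>k\<close>-th transmission of pair \<open>i\<close> can carry in
  slot \<open>v\<close>.\<close>

definition slot_capacity ::
  "overlay \<Rightarrow> real \<Rightarrow> config \<Rightarrow> config \<Rightarrow> nat \<Rightarrow> nat \<Rightarrow> nat \<Rightarrow> real" where
  "slot_capacity Q m wp ws i k v =
     (let q = secondary_cells Q m; s = secondary_slot_len Q; c = path q ws i k;
          z = receiver q ws (secondary_may Q m wp) i k v
      in integral {packet_time q ws s c i v 0 .. packet_time q ws s c i v 1}
           (secondary_rate Q m wp ws c z))"

text \<open>With packets of \<open>l\<close> bits, a transmission succeeds if its packet slot can carry all the packets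
  of the pair that are sent in it.\<close>

definition success ::
  "overlay \<Rightarrow> real \<Rightarrow> config \<Rightarrow> config \<Rightarrow> real \<Rightarrow> nat \<Rightarrow> nat \<Rightarrow> nat \<Rightarrow> bool" where
  "success Q m wp ws l i k v \<longleftrightarrow>
     (let q = secondary_cells Q m
      in nodes_in q ws (path q ws i k) \<noteq> [] \<and>
         l * real (card {j. hop_slot q ws (secondary_may Q m wp) i j k = v})
           \<le> slot_capacity Q m wp ws i k v)"

text \<open>The bits of pair \<open>i\<close> that have reached the destination after \<open>t\<close> secondary slots.\<close>

definition delivered_bits ::
  "overlay \<Rightarrow> real \<Rightarrow> config \<Rightarrow> config \<Rightarrow> real \<Rightarrow> nat \<Rightarrow> nat \<Rightarrow> real" where
  "delivered_bits Q m wp ws l i t =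
     (let q = secondary_cells Q m; may = secondary_may Q m wp
      in l * real (card {j. hop_slot q ws may i j (hops q ws i - 1) < t \<and>
                            (\<forall>k < hops q ws i. success Q m wp ws l i k (hop_slot q ws may i j k))}))"

definition overlay_measure :: "overlay \<Rightarrow> real \<Rightarrow> (config \<times> config) measure" where
  "overlay_measure Q m = node_process (primary_density Q m) \<Otimes>\<^sub>M node_process m"


section \<open>Throughput and delay of the secondary network\<close>

text \<open>With probability tending to 1; for measurable sets \<open>E m\<close> this says that the probability
  of \<open>E m\<close> tends to 1.\<close>

definition whp :: "(real \<Rightarrow> 'a measure) \<Rightarrow> (real \<Rightarrow> 'a set) \<Rightarrow> bool" where
  "whp M E \<longleftrightarrow> (\<exists>A. (\<forall>m. A m \<in> sets (M m) \<and> A m \<subseteq> E m) \<and>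
                   ((\<lambda>m. measure (M m) (A m)) \<longlongrightarrow> 1) at_top)"

text \<open>The rate \<open>lam m\<close> is achieved by the protocol with some choice \<open>l m\<close> of the packet size.\<close>

definition achieves :: "overlay \<Rightarrow> (real \<Rightarrow> real) \<Rightarrow> bool" where
  "achieves Q lam \<longleftrightarrow> (\<forall>m. 0 \<le> lam m) \<and>
     (\<exists>l. (\<forall>m. 0 < l m) \<and>
       whp (overlay_measure Q)
         (\<lambda>m. {(wp, ws). \<forall>i < num_pairs ws.
            ereal (lam m) \<le> liminf (\<lambda>t. ereal (delivered_bits Q m wp ws (l m) i t / real t))}))"

text \<open>If a rate is achieved, so is every smaller one. The throughput of the protocol is the largest
  achieved rate; it is determined up to a constant factor.\<close>

definition secondary_throughput :: "overlay \<Rightarrow> (real \<Rightarrow> real) \<Rightarrow> bool" where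
  "secondary_throughput Q lam \<longleftrightarrow>
     achieves Q lam \<and> (\<forall>lam'. achieves Q lam' \<longrightarrow> lam' \<in> O(lam))"

text \<open>The protocols presuppose a relay in every cell. This event has probability tending to 1, but not
  equal to 1; outside of it some packets never arrive. The expected delay is taken under this
  condition.\<close>

definition all_cells_occupied :: "overlay \<Rightarrow> real \<Rightarrow> (config \<times> config) set" where
  "all_cells_occupied Q m = {(wp, ws) \<in> space (overlay_measure Q m).
     (\<forall>c \<in> grid (primary_cells Q m). nodes_in (primary_cells Q m) wp c \<noteq> []) \<and>
     (\<forall>c \<in> grid (secondary_cells Q m). nodes_in (secondary_cells Q m) ws c \<noteq> [])}"

text \<open>The number of pairs is random, hence the average over the pairs is inside the expectation.\<close>

definition secondary_delay :: "overlay \<Rightarrow> real \<Rightarrow> real" where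
  "secondary_delay Q m = enn2real
     (\<integral>\<^sup>+ (wp, ws).
        (\<Sum>i < num_pairs ws.
           e2ennreal (pair_delay (secondary_cells Q m) ws (secondary_may Q m wp)
             (secondary_slot_len Q) i)) / of_nat (num_pairs ws)
      \<partial>uniform_measure (overlay_measure Q m) (all_cells_occupied Q m))"

end

theory Submission
  imports Defs "HOL-Real_Asymp.Real_Asymp"
begin

text \<open>
  Let \<open>q\<close> be the number of secondary cells along a side of the unit square. Then the throughput is of
  order \<open>q / m\<close> and the delay is of order \<open>q\<close>.

  A secondary cell may transmit at least once in every 625 secondary slots (25 primary slots), because
  the preservation regions never cover it for a whole primary frame. Hence the delay of a pair is its
  number of hops up to a constant factor, and this number is of order \<open>q\<close> for a positive fraction of the
  pairs. TDMA and the preservation regions keep the interference bounded, so every packet slot is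
  served at a rate bounded below; since the paths through a cell start in its row or end in its column,
  no cell has more than a constant times \<open>m / q\<close> packet slots, which gives a throughput of order \<open>q / m\<close>.
  Conversely, the middle cell of the lowest row has at least a constant times \<open>m / q\<close> packet slots, and
  it contains a source at distance at least half a cell from its receivers, whose rate is therefore
  bounded above.
\<close>

section \<open>Cell numbers\<close>

text \<open>The cell factor is an arbitrary function with values at least 1, so \<open>q\<close> has
  no closed form. Both orders are expressed in \<open>q\<close>, using only that \<open>q\<close>
  tends to infinity, that \<open>q^2 * ln m\<close> is at most \<open>m\<close>, and that the
  secondary cell number is at least four times the primary one. The obstacle is that the secondary
  schedule depends on the random primary configuration. It is removed by a statement about every
  primary configuration: access has period 625 and never fails for a whole period. Primary
  randomness then matters only for the conditioning in the delay. A silent cell accumulates packets,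
  but at most 625 of one pair share a slot, which costs a constant. Conversely, a single successful
  packet already bounds the packet size and hence the rate; its sender must be kept away from the
  receiver because the gain is unbounded near distance 0. Apart from null sets, what is used about
  the secondary nodes concerns empty cells and numbers of pairs with source in one rectangle and
  destination in another; generating functions and union bounds control both.\<close>

lemma cells_bounds:
  fixes x :: real
  assumes "0 < x"
  shows "(real (nat \<lfloor>1 / sqrt x\<rfloor>))\<^sup>2 * x \<le> 1" and "1 / sqrt x - 1 < real (nat \<lfloor>1 / sqrt x\<rfloor>)"
    and "real (nat \<lfloor>1 / sqrt x\<rfloor>) \<le> 1 / sqrt x"
proof -
  have "0 \<le> 1 / sqrt x" using assms by simp
  then show le: "real (nat \<lfloor>1 / sqrt x\<rfloor>) \<le> 1 / sqrt x" and "1 / sqrt x - 1 < real (nat \<lfloor>1 / sqrt x\<rfloor>)"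
    by linarith+
  have "(real (nat \<lfloor>1 / sqrt x\<rfloor>))\<^sup>2 * x \<le> (1 / sqrt x)\<^sup>2 * x"
    using le assms by (intro mult_right_mono power_mono) auto
  then show "(real (nat \<lfloor>1 / sqrt x\<rfloor>))\<^sup>2 * x \<le> 1"
    using assms by (simp add: power_divide)
qed

text \<open>The bound \<open>1 / 25\<close> makes the nominal side of a primary cell at most 1/5, so
  that rounding the number of cells down to an integer changes it only by a bounded factor.\<close>

locale overlay_params =
  fixes Q :: overlay
  assumes path_loss: "path_loss Q > 2" and noise: "noise Q > 0" and density_exp: "density_exp Q > 1"
    and primary_pow: "primary_pow Q > 0" and secondary_pow: "secondary_pow Q > 0"
    and slot_len: "slot_len Q > 0"
    and cell_factor: "\<And>n. cell_factor Q n \<ge> 1"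
    and cell_area: "\<forall>\<^sub>F n in at_top. cell_factor Q n * ln n / n \<le> 1 / 25"
begin

lemma primary_density_at_top: "filterlim (primary_density Q) at_top at_top"
  unfolding primary_density_def using density_exp by real_asymp

text \<open>The quotient of the nominal primary and secondary cell areas: the common cell factor
  cancels, and \<open>ln n\<close> is \<open>ln m / density_exp Q\<close>.\<close>

definition area_ratio :: "real \<Rightarrow> real" where
  "area_ratio m = m powr (1 - 1 / density_exp Q) / density_exp Q"

lemma area_ratio_at_top: "filterlim area_ratio at_top at_top"
proof -
  have "0 < 1 - 1 / density_exp Q" using density_exp by simp
  then show ?thesis
    unfolding area_ratio_def using density_exp by real_asymp
qed

lemma nominal_areas:
  fixes m :: real
  defines "n \<equiv> primary_density Q m"
  assumes "1 < m"
  shows "1 < n" "0 < ln n" "cell_factor Q n * ln n / n = area_ratio m * (cell_factor Q n * ln m / m)"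
    "0 < cell_factor Q n * ln n / n" "0 < cell_factor Q n * ln m / m"
proof -
  have ln_n: "ln n = ln m / density_exp Q"
    using assms by (simp add: primary_density_def ln_powr)
  show "1 < n" using assms density_exp by (simp add: primary_density_def)
  then show l: "0 < ln n" by simp
  have "m powr (1 - 1 / density_exp Q) = m / n"
    using assms by (simp add: powr_diff primary_density_def)
  then show "cell_factor Q n * ln n / n = area_ratio m * (cell_factor Q n * ln m / m)"
    using assms(2) \<open>1 < n\<close> density_exp by (simp add: area_ratio_def ln_n)
  have "0 < cell_factor Q n" using cell_factor[of n] by simp
  then show "0 < cell_factor Q n * ln n / n" "0 < cell_factor Q n * ln m / m"
    using assms \<open>1 < n\<close> l by simp_all
qed

lemma eventually_cell_area:
  "\<forall>\<^sub>F m in at_top. cell_factor Q (primary_density Q m) * ln (primary_density Q m) / primary_density Q m \<le> 1 / 25"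
  using cell_area primary_density_at_top by (rule eventually_compose_filterlim)

text \<open>The cell factor may grow, so the growth of the secondary cell number is derived from the
  primary cells: their nominal area is at most 1/25, and the secondary area is smaller by the factor
  \<open>area_ratio m\<close>.\<close>

lemma secondary_cells_ge:
  assumes "1 < m" "0 < area_ratio m"
    "cell_factor Q (primary_density Q m) * ln (primary_density Q m) / primary_density Q m \<le> 1 / 25"
  shows "5 * sqrt (area_ratio m) - 1 \<le> real (secondary_cells Q m)"
proof -
  note n = nominal_areas[OF assms(1)]
  let ?n = "primary_density Q m"
  have "area_ratio m * (cell_factor Q ?n * ln m / m) \<le> 1 / 25"
    using assms(3) n(3) by simp
  then have "sqrt (area_ratio m) * sqrt (cell_factor Q ?n * ln m / m) \<le> sqrt (1 / 25)"
    by (subst real_sqrt_mult[symmetric]) (rule real_sqrt_le_mono)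
  also have "sqrt (1 / 25) = (1 / 5 :: real)" by (intro real_sqrt_unique) (auto simp: power2_eq_square)
  finally have "5 * sqrt (area_ratio m) \<le> 1 / sqrt (cell_factor Q ?n * ln m / m)"
    using n(5) by (simp add: pos_le_divide_eq)
  then show ?thesis
    using cells_bounds(2)[OF n(5)] by (simp add: secondary_cells_def)
qed

lemma secondary_cells_at_top: "filterlim (\<lambda>m. real (secondary_cells Q m)) at_top at_top"
proof (rule filterlim_at_top_mono)
  show "filterlim (\<lambda>m. 5 * sqrt (area_ratio m) - 1) at_top at_top"
    by (rule filterlim_compose[OF _ area_ratio_at_top]) real_asymp
  show "\<forall>\<^sub>F m in at_top. 5 * sqrt (area_ratio m) - 1 \<le> real (secondary_cells Q m)"
    using eventually_gt_at_top[of "1::real"] eventually_cell_area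
      filterlim_at_top_dense[THEN iffD1, OF area_ratio_at_top, rule_format, of 0]
    by eventually_elim (rule secondary_cells_ge)
qed

text \<open>A cell factor of at least 1 and rounding to larger cells both increase the area, so the
  mean number of nodes per cell is at least \<open>ln m\<close>. This is what makes empty cells
  unlikely.\<close>

lemma secondary_cells_density:
  assumes "1 < m"
  shows "ln m * (real (secondary_cells Q m))\<^sup>2 \<le> m"
proof -
  let ?n = "primary_density Q m"
  note n = nominal_areas[OF assms]
  have "(real (secondary_cells Q m))\<^sup>2 * (1 * ln m / m) \<le> (real (secondary_cells Q m))\<^sup>2 * (cell_factor Q ?n * ln m / m)"
    using assms cell_factor[of ?n] by (intro mult_left_mono divide_right_mono mult_right_mono) auto
  also have "\<dots> \<le> 1"
    using cells_bounds(1)[OF n(5)] by (simp add: secondary_cells_def)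
  finally show ?thesis using assms by (simp add: field_simps)
qed

lemma primary_cells_density:
  assumes "1 < m"
  shows "ln (primary_density Q m) * (real (primary_cells Q m))\<^sup>2 \<le> primary_density Q m"
proof -
  let ?n = "primary_density Q m"
  note n = nominal_areas[OF assms]
  have "(real (primary_cells Q m))\<^sup>2 * (1 * ln ?n / ?n) \<le> (real (primary_cells Q m))\<^sup>2 * (cell_factor Q ?n * ln ?n / ?n)"
    using n(1,2) cell_factor[of ?n] by (intro mult_left_mono divide_right_mono mult_right_mono) auto
  also have "\<dots> \<le> 1"
    using cells_bounds(1)[OF n(4)] by (simp add: primary_cells_def Let_def)
  finally show ?thesis using n(1) by (simp add: field_simps)
qed

text \<open>An area ratio of 25 gives a side ratio of 5 before rounding; the secondary number loses
  less than 1 by rounding, which is at most the primary number. The remaining ratio 4 is what the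
  geometry of the preservation regions uses.\<close>

lemma eventually_cells:
  "\<forall>\<^sub>F m in at_top. 0 < primary_cells Q m \<and> 4 * primary_cells Q m \<le> secondary_cells Q m"
proof -
  have "\<forall>\<^sub>F m in at_top. 25 \<le> area_ratio m"
    using area_ratio_at_top by (simp add: filterlim_at_top)
  with eventually_gt_at_top[of "1::real"] eventually_cell_area show ?thesis
  proof eventually_elim
    case (elim m)
    let ?n = "primary_density Q m"
    let ?xp = "cell_factor Q ?n * ln ?n / ?n" and ?xs = "cell_factor Q ?n * ln m / m"
    note n = nominal_areas[OF elim(1)]
    have p: "1 / sqrt ?xp - 1 < real (primary_cells Q m)" "real (primary_cells Q m) \<le> 1 / sqrt ?xp"
      using cells_bounds(2,3)[OF n(4)] by (simp_all add: primary_cells_def Let_def)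
    have s: "1 / sqrt ?xs - 1 < real (secondary_cells Q m)"
      using cells_bounds(2)[OF n(5)] by (simp add: secondary_cells_def)
    have "sqrt ?xp \<le> sqrt (1 / 25)" using elim(2) by (rule real_sqrt_le_mono)
    also have "sqrt (1 / 25) = (1 / 5 :: real)" by (intro real_sqrt_unique) (auto simp: power2_eq_square)
    finally have "5 \<le> 1 / sqrt ?xp" using n(4) by (simp add: pos_le_divide_eq)
    then have p0: "1 \<le> real (primary_cells Q m)" using p(1) by linarith
    have "25 * ?xs \<le> ?xp" unfolding n(3) using elim(3) n(5) by (intro mult_right_mono) auto
    then have "sqrt (25 * ?xs) \<le> sqrt ?xp" by (rule real_sqrt_le_mono)
    also have "sqrt (25 * ?xs) = 5 * sqrt ?xs"
      by (subst real_sqrt_mult) (simp add: real_sqrt_unique power2_eq_square)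
    finally have "5 * (1 / sqrt ?xp) \<le> 1 / sqrt ?xs"
      using n(4,5) by (simp add: field_simps)
    then have "4 * real (primary_cells Q m) \<le> real (secondary_cells Q m)"
      using p s p0 by linarith
    then show ?case using p0 by linarith
  qed
qed

end

text \<open>The expression is the expected number of empty cells. With at least \<open>ln d\<close>
  nodes per cell on average, a cell is empty with probability at most \<open>1 / d\<close>, and
  there are at most \<open>d / ln d\<close> cells, so the logarithm is all that is left to force
  convergence.\<close>

lemma tendsto_empty_cells:
  fixes q :: "'a \<Rightarrow> nat" and d :: "'a \<Rightarrow> real"
  assumes d: "filterlim d at_top F" and q: "\<forall>\<^sub>F x in F. 0 < q x \<and> ln (d x) * (real (q x))\<^sup>2 \<le> d x"
  shows "((\<lambda>x. (real (q x))\<^sup>2 * exp (- d x / (real (q x))\<^sup>2)) \<longlongrightarrow> 0) F"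
proof (rule tendsto_sandwich[where f = "\<lambda>_. 0" and h = "\<lambda>x. 1 / ln (d x)"])
  have d1: "\<forall>\<^sub>F x in F. exp 1 < d x" using d by (simp add: filterlim_at_top_dense)
  show "\<forall>\<^sub>F x in F. (real (q x))\<^sup>2 * exp (- d x / (real (q x))\<^sup>2) \<le> 1 / ln (d x)"
    using d1 q
  proof eventually_elim
    case (elim x)
    have dx: "0 < d x" "1 < ln (d x)"
      using elim(1) exp_gt_zero[of 1] by (linarith, metis elim(1) exp_gt_zero less_trans ln_exp ln_less_cancel_iff)
    define y where "y = d x / (real (q x))\<^sup>2"
    have q2: "0 < (real (q x))\<^sup>2" using elim(2) by simp
    have y: "ln (d x) \<le> y" using elim(2) q2 by (simp add: y_def pos_le_divide_eq)
    have "exp (- y) \<le> exp (- ln (d x))" using y by simp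
    also have "\<dots> = 1 / d x" using dx by (simp add: exp_minus field_simps)
    finally have "(real (q x))\<^sup>2 * exp (- y) \<le> (real (q x))\<^sup>2 * (1 / d x)"
      by (intro mult_left_mono) auto
    also have "(real (q x))\<^sup>2 * (1 / d x) \<le> 1 / ln (d x)"
    proof -
      have "(real (q x))\<^sup>2 * ln (d x) \<le> 1 * d x" using elim(2) by (simp add: mult.commute)
      then have "(real (q x))\<^sup>2 * ln (d x) / d x \<le> 1" using dx(1) pos_divide_le_eq by blast
      moreover have "0 < ln (d x)" using dx(2) by linarith
      ultimately show ?thesis by (simp add: pos_le_divide_eq)
    qed
    finally show ?case by (simp add: y_def)
  qed
  show "((\<lambda>x. 1 / ln (d x)) \<longlongrightarrow> 0) F"
    by (intro tendsto_divide_0[OF tendsto_const] filterlim_at_top_imp_at_infinity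
        filterlim_compose[OF ln_at_top d])
qed auto

section \<open>The node process\<close>

abbreviation unit_square :: "point set" where
  "unit_square \<equiv> {0..<1} \<times> {0..<1}"

abbreviation uniform_point :: "point measure" where
  "uniform_point \<equiv> uniform_measure lborel unit_square"

abbreviation uniform_points :: "(nat \<Rightarrow> point) measure" where
  "uniform_points \<equiv> \<Pi>\<^sub>M i\<in>UNIV. uniform_point"

lemma emeasure_lborel_rectangle:
  fixes a b c d :: real
  assumes "a \<le> b" "c \<le> d"
  shows "emeasure lborel ({a..<b} \<times> {c..<d}) = ennreal ((b - a) * (d - c))"
proof -
  have "emeasure (lborel \<Otimes>\<^sub>M lborel) ({a..<b} \<times> {c..<d}) = ennreal (b - a) * ennreal (d - c)"
    using assms by (subst lborel.emeasure_pair_measure_Times) auto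
  then show ?thesis
    using assms by (simp add: lborel_prod ennreal_mult')
qed

lemma rectangle_borel [measurable, simp]:
  fixes a b c d :: real
  shows "{a..<b} \<times> {c..<d} \<in> sets borel"
proof -
  have "{a..<b} \<times> {c..<d} \<in> sets (borel \<Otimes>\<^sub>M borel)"
    by (intro pair_measureI) auto
  then show ?thesis unfolding borel_prod .
qed

lemma prob_space_uniform_point: "prob_space uniform_point"
  by (rule prob_space_uniform_measure) (simp_all add: emeasure_lborel_rectangle)

lemma sets_uniform_point [measurable_cong, simp]: "sets uniform_point = sets borel"
  by simp

lemma prob_rectangle:
  assumes "0 \<le> a" "a \<le> b" "b \<le> 1" "0 \<le> c" "c \<le> d" "d \<le> 1"
  shows "measure uniform_point ({a..<b} \<times> {c..<d}) = (b - a) * (d - c)"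
proof -
  have "unit_square \<inter> {a..<b} \<times> {c..<d} = {a..<b} \<times> {c..<d}"
    using assms by auto
  then have "emeasure uniform_point ({a..<b} \<times> {c..<d}) = ennreal ((b - a) * (d - c))"
    using assms
    by (subst emeasure_uniform_measure) (auto simp: emeasure_lborel_rectangle divide_ennreal_def)
  then show ?thesis using assms by (simp add: measure_def)
qed

interpretation uniform_point: prob_space uniform_point
  by (rule prob_space_uniform_point)

interpretation uniform_points: product_prob_space "\<lambda>_::nat. uniform_point" UNIV
  by unfold_locales

lemma space_uniform_points [simp]: "space uniform_points = UNIV"
  by (auto simp: space_PiM PiE_def extensional_def)

lemma indep_vars_coordinates:
  "prob_space.indep_vars uniform_points (\<lambda>_. uniform_point) (\<lambda>i X. X i) (UNIV :: nat set)"
proof -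
  have 1: "distr uniform_points uniform_point (\<lambda>X. X i) = uniform_point" for i :: nat
    using uniform_points.PiM_component[of i] by simp
  have 2: "distr uniform_points uniform_points (\<lambda>x. \<lambda>i\<in>UNIV. x i) = uniform_points"
    by (subst distr_cong[OF refl refl, where g = "\<lambda>x. x"]) (simp_all add: distr_id restrict_def)
  show ?thesis
    by (subst uniform_points.P.indep_vars_iff_distr_eq_PiM') (simp_all only: 1 2, simp_all)
qed

text \<open>The generating function of a binomial distribution. Different pairs use disjoint blocks
  \<open>{2 * i, 2 * i + 1}\<close> of coordinates and are therefore independent, so the integral of
  the product splits into equal factors.\<close>

lemma nn_integral_power_card_pairs:
  assumes [measurable]: "A \<in> sets borel" "B \<in> sets borel"
    and "0 \<le> th" and p: "p = measure uniform_point A * measure uniform_point B"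
  shows "(\<integral>\<^sup>+ X. ennreal (th ^ card {i. i < k \<and> X (2 * i) \<in> A \<and> X (2 * i + 1) \<in> B})
            \<partial>uniform_points) = ennreal ((1 + p * (th - 1)) ^ k)"
proof -
  define Y where "Y i X = (if X (2 * i) \<in> A \<and> X (2 * i + 1) \<in> B then ennreal th else 1)"
    for i :: nat and X :: "nat \<Rightarrow> point"
  have p01: "0 \<le> p" "p \<le> 1"
    unfolding p by (simp_all add: mult_le_one)
  have card: "ennreal (th ^ card {i. i < k \<and> X (2 * i) \<in> A \<and> X (2 * i + 1) \<in> B}) = (\<Prod>i<k. Y i X)"
    for X
  proof -
    have "(\<Prod>i<k. Y i X) =
      (\<Prod>i\<in>{..<k} \<inter> {i. X (2 * i) \<in> A \<and> X (2 * i + 1) \<in> B}. ennreal th)"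
      unfolding Y_def by (subst prod.If_cases) auto
    also have "{..<k} \<inter> {i. X (2 * i) \<in> A \<and> X (2 * i + 1) \<in> B} =
        {i. i < k \<and> X (2 * i) \<in> A \<and> X (2 * i + 1) \<in> B}"
      by auto
    finally show ?thesis using assms by (simp add: ennreal_power)
  qed
  have [measurable]: "Measurable.pred (PiM {2 * i, 2 * i + 1} (\<lambda>_. uniform_point))
          (\<lambda>x. x (2 * i) \<in> A \<and> x (2 * i + 1) \<in> B)" for i :: nat
    by measurable
  have "uniform_points.P.indep_vars (\<lambda>j. PiM {2 * j, 2 * j + 1} (\<lambda>_. uniform_point))
     (\<lambda>j X. \<lambda>i\<in>{2 * j, 2 * j + 1}. X i) {..<k}"
    by (rule uniform_points.P.indep_vars_restrict[OF indep_vars_coordinates])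
       (auto simp: disjoint_family_on_def)
  then have "uniform_points.P.indep_vars (\<lambda>_. borel)
     (\<lambda>j X. if (\<lambda>i\<in>{2 * j, 2 * j + 1}. X i) (2 * j) \<in> A \<and> (\<lambda>i\<in>{2 * j, 2 * j + 1}. X i) (2 * j + 1) \<in> B
        then ennreal th else 1) {..<k}"
    by (rule uniform_points.P.indep_vars_compose2) measurable
  then have indep: "uniform_points.P.indep_vars (\<lambda>_. borel) Y {..<k}"
    by (simp add: Y_def[abs_def])
  have single: "(\<integral>\<^sup>+ X. Y i X \<partial>uniform_points) = ennreal (1 + p * (th - 1))" for i
  proof -
    define E where "E = {X \<in> space uniform_points. \<forall>j\<in>{2 * i, 2 * i + 1}. X j \<in> (if j = 2 * i then A else B)}"
    have E': "E = {X \<in> space uniform_points. X (2 * i) \<in> A \<and> X (2 * i + 1) \<in> B}"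
      unfolding E_def by auto
    have [measurable]: "E \<in> sets uniform_points"
      unfolding E' by measurable
    have "emeasure uniform_points E = ennreal p"
      unfolding E_def p
      by (subst uniform_points.emeasure_PiM_Collect)
         (auto simp: uniform_point.emeasure_eq_measure ennreal_mult)
    then have pE: "uniform_points.P.prob E = p"
      using p01 by (simp add: measure_def)
    have "(\<integral>\<^sup>+ X. Y i X \<partial>uniform_points) =
        (\<integral>\<^sup>+ X. ennreal th * indicator E X + 1 * indicator (- E) X \<partial>uniform_points)"
      by (rule nn_integral_cong) (auto simp: Y_def E_def indicator_def)
    also have "\<dots> = ennreal th * emeasure uniform_points E + emeasure uniform_points (- E)"
      by (subst nn_integral_add)
         (simp_all add: nn_integral_cmult_indicator Compl_eq_Diff_UNIV
            flip: space_uniform_points)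
    also have "emeasure uniform_points (- E) = ennreal (1 - p)"
      using uniform_points.P.prob_compl[of E] pE
      by (simp add: uniform_points.P.emeasure_eq_measure Compl_eq_Diff_UNIV)
    also have "ennreal th * emeasure uniform_points E + ennreal (1 - p) = ennreal (th * p + (1 - p))"
      using assms(3) p01 \<open>emeasure uniform_points E = ennreal p\<close>
      by (subst ennreal_plus) (simp_all add: ennreal_mult)
    finally show ?thesis by (simp add: algebra_simps)
  qed
  have "0 \<le> 1 + p * (th - 1)"
    using p01 assms(3) mult_left_mono[of "-1" "th - 1" p] by auto
  then show ?thesis
    unfolding card using uniform_points.P.indep_vars_nn_integral[OF _ indep]
    by (simp add: single ennreal_power)
qed

text \<open>The probability generating function of the Poisson distribution. It turns each bound for
  a fixed number of nodes into one for the point process.\<close>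

lemma nn_integral_poisson_power:
  assumes "0 < d" "0 \<le> x"
  shows "(\<integral>\<^sup>+ n. ennreal (x ^ n) \<partial>measure_pmf (poisson_pmf d)) = ennreal (exp (d * (x - 1)))"
proof -
  have "(\<lambda>n. (d * x) ^ n /\<^sub>R fact n) sums exp (d * x)"
    by (rule exp_converges)
  then have "(\<lambda>n. exp (- d) * ((d * x) ^ n /\<^sub>R fact n)) sums (exp (- d) * exp (d * x))"
    by (rule sums_mult)
  moreover have "exp (- d) * exp (d * x) = exp (d * (x - 1))"
    by (simp add: algebra_simps flip: exp_add)
  ultimately have s: "(\<lambda>n. exp (- d) * ((d * x) ^ n /\<^sub>R fact n)) sums exp (d * (x - 1))"
    by simp
  have "(\<integral>\<^sup>+ n. ennreal (x ^ n) \<partial>measure_pmf (poisson_pmf d)) =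
      (\<Sum>n. ennreal (exp (- d) * ((d * x) ^ n /\<^sub>R fact n)))"
    using assms
    by (simp add: nn_integral_measure_pmf nn_integral_count_space_nat poisson_pmf.rep_eq
         flip: ennreal_mult) (simp add: field_simps power_mult_distrib)
  also have "\<dots> = ennreal (exp (d * (x - 1)))"
    using assms s by (intro suminf_ennreal_eq) auto
  finally show ?thesis .
qed

lemma sets_node_process:
  "sets (node_process d) = sets (count_space UNIV \<Otimes>\<^sub>M uniform_points)"
  unfolding node_process_def by (rule sets_pair_measure_cong) auto

lemma space_node_process [simp]: "space (node_process d) = UNIV"
  using sets_eq_imp_space_eq[OF sets_node_process, of d] by (simp add: space_pair_measure)

text \<open>The number of nodes has only countably many values, so measurability can be checked in
  the positions for each fixed number separately.\<close>

lemma measurable_node_process: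
  assumes "\<And>N. (\<lambda>X. f (N, X)) \<in> uniform_points \<rightarrow>\<^sub>M K"
  shows "f \<in> node_process d \<rightarrow>\<^sub>M K"
  unfolding measurable_cong_sets[OF sets_node_process refl]
  using assms by (intro measurable_pair_measure_countable1) auto

lemma sets_node_processI:
  assumes "\<And>N. Measurable.pred uniform_points (\<lambda>X. P (N, X))"
  shows "{w. P w} \<in> sets (node_process d)"
proof -
  have "Measurable.pred (node_process d) P"
    using assms by (rule measurable_node_process)
  then have "{w \<in> space (node_process d). P w} \<in> sets (node_process d)"
    by measurable
  then show ?thesis by simp
qed

lemma prob_space_node_process: "prob_space (node_process d)"
proof -
  interpret pair_prob_space "measure_pmf (poisson_pmf d)" uniform_points ..
  show ?thesis unfolding node_process_def by unfold_locales
qed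

lemma nn_integral_node_process:
  assumes "f \<in> borel_measurable (node_process d)"
  shows "(\<integral>\<^sup>+ w. f w \<partial>node_process d) =
    (\<integral>\<^sup>+ N. (\<integral>\<^sup>+ X. f (N, X) \<partial>uniform_points) \<partial>measure_pmf (poisson_pmf d))"
  using assms unfolding node_process_def
  by (subst uniform_points.P.nn_integral_fst) simp_all

lemma sets_all_avoid:
  assumes [measurable]: "C \<in> sets borel"
  shows "{w. \<forall>i < fst w. snd w i \<notin> C} \<in> sets (node_process d)"
proof (rule sets_node_processI)
  show "Measurable.pred uniform_points (\<lambda>X. \<forall>i < fst (N, X). snd (N, X) i \<notin> C)" for N
    unfolding fst_conv snd_conv by measurable
qed

text \<open>The void probability of the Poisson process: for \<open>N\<close> nodes it is the
  \<open>N\<close>-th power of the probability that one node avoids \<open>C\<close>, and the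
  generating function averages over \<open>N\<close>.\<close>

lemma prob_all_avoid:
  assumes "0 < d" and [measurable]: "C \<in> sets borel"
  shows "measure (node_process d) {w. \<forall>i < fst w. snd w i \<notin> C} = exp (- d * measure uniform_point C)"
proof -
  interpret prob_space "node_process d" by (rule prob_space_node_process)
  let ?E = "{w :: config. \<forall>i < fst w. snd w i \<notin> C}"
  have E: "?E \<in> sets (node_process d)"
    using assms(2) by (rule sets_all_avoid)
  have inner: "(\<integral>\<^sup>+ X. indicator ?E (N, X) \<partial>uniform_points) = ennreal ((1 - measure uniform_point C) ^ N)" for N
  proof -
    have "(\<integral>\<^sup>+ X. indicator ?E (N, X) \<partial>uniform_points) =
      (\<integral>\<^sup>+ X. indicator {X \<in> space uniform_points. \<forall>i\<in>{..<N}. X i \<in> - C} X \<partial>uniform_points)"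
      by (rule nn_integral_cong) (auto simp: indicator_def)
    also have "\<dots> = emeasure uniform_points {X \<in> space uniform_points. \<forall>i\<in>{..<N}. X i \<in> - C}"
      by (rule nn_integral_indicator) measurable
    also have "\<dots> = (\<Prod>i<N. emeasure uniform_point (- C))"
      by (rule uniform_points.emeasure_PiM_Collect) auto
    also have "emeasure uniform_point (- C) = ennreal (1 - measure uniform_point C)"
      using uniform_point.prob_compl[of C] 
      by (simp add: uniform_point.emeasure_eq_measure Compl_eq_Diff_UNIV)
    finally show ?thesis by (simp add: ennreal_power)
  qed
  have "emeasure (node_process d) ?E = (\<integral>\<^sup>+ w. indicator ?E w \<partial>node_process d)"
    using E by simp
  also have "\<dots> = (\<integral>\<^sup>+ N. (\<integral>\<^sup>+ X. indicator ?E (N, X) \<partial>uniform_points) \<partial>measure_pmf (poisson_pmf d))"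
    by (rule nn_integral_node_process[OF borel_measurable_indicator[OF E]])
  also have "\<dots> = (\<integral>\<^sup>+ N. ennreal ((1 - measure uniform_point C) ^ N) \<partial>measure_pmf (poisson_pmf d))"
    by (simp only: inner)
  also have "\<dots> =
      ennreal (exp (- d * measure uniform_point C))"
    using assms by (subst nn_integral_poisson_power) auto
  finally show ?thesis by (simp add: measure_def)
qed

section \<open>Numbers of pairs between two regions and their exponential tail bounds\<close>

definition count_pairs :: "point set \<Rightarrow> point set \<Rightarrow> config \<Rightarrow> nat" where
  "count_pairs A B w = card {i. i < num_pairs w \<and> src w i \<in> A \<and> dst w i \<in> B}"

lemma measurable_count_pairs:
  assumes [measurable]: "A \<in> sets borel" "B \<in> sets borel"
  shows "count_pairs A B \<in> node_process d \<rightarrow>\<^sub>M count_space UNIV"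
proof (rule measurable_node_process)
  fix N :: nat
  have "count_pairs A B (N, X) = (\<Sum>i<N div 2. if X (2 * i) \<in> A \<and> X (2 * i + 1) \<in> B then 1 else 0)" for X
  proof -
    have "{i. i < N div 2 \<and> X (2 * i) \<in> A \<and> X (2 * i + 1) \<in> B} =
      {i \<in> {..<N div 2}. X (2 * i) \<in> A \<and> X (2 * i + 1) \<in> B}" by auto
    then show ?thesis
      unfolding count_pairs_def num_pairs_def src_def dst_def fst_conv snd_conv
      by (subst sum.inter_filter[symmetric]) simp_all
  qed
  then show "(\<lambda>X. count_pairs A B (N, X)) \<in> uniform_points \<rightarrow>\<^sub>M count_space UNIV"
    by simp
qed

lemma nn_integral_power_count_pairs:
  assumes m: "A \<in> sets borel" "B \<in> sets borel"
    and "0 \<le> th" and p: "p = measure uniform_point A * measure uniform_point B"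
  shows "(\<integral>\<^sup>+ w. ennreal (th ^ count_pairs A B w) \<partial>node_process d) =
     (\<integral>\<^sup>+ N. ennreal ((1 + p * (th - 1)) ^ (N div 2)) \<partial>measure_pmf (poisson_pmf d))"
proof -
  have "(\<lambda>w. ennreal (th ^ count_pairs A B w)) \<in> borel_measurable (node_process d)"
    by (rule measurable_compose[OF measurable_count_pairs[OF m]]) simp
  from nn_integral_node_process[OF this] show ?thesis
    unfolding count_pairs_def num_pairs_def src_def dst_def fst_conv snd_conv
      nn_integral_power_card_pairs[OF m assms(3) p] .
qed

lemma sets_count_pairs:
  assumes "A \<in> sets borel" "B \<in> sets borel"
  shows "{w. Q (count_pairs A B w)} \<in> sets (node_process d)"
proof -
  have "count_pairs A B -` {n. Q n} \<inter> space (node_process d) \<in> sets (node_process d)"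
    by (rule measurable_sets[OF measurable_count_pairs[OF assms]]) simp
  then show ?thesis by (simp add: vimage_def)
qed

text \<open>The Chernoff bound with base \<open>exp 1\<close>, where \<open>exp 1 - 1\<close> is
  estimated by 2. As the base of the power is at least 1, the exponent \<open>N div 2\<close> may be
  raised to \<open>N\<close>; the bound stays exponential.\<close>

lemma prob_count_pairs_ge:
  assumes m: "A \<in> sets borel" "B \<in> sets borel" and "0 < d"
    and p: "p = measure uniform_point A * measure uniform_point B"
  shows "measure (node_process d) {w. a \<le> real (count_pairs A B w)} \<le> exp (2 * d * p - a)"
proof -
  interpret prob_space "node_process d" by (rule prob_space_node_process)
  let ?E = "{w. a \<le> real (count_pairs A B w)}"
  have p0: "0 \<le> p" unfolding p by simp
  have e: "exp 1 \<le> (3::real)" by (rule exp_le)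
  have "emeasure (node_process d) ?E = (\<integral>\<^sup>+ w. indicator ?E w \<partial>node_process d)"
    using sets_count_pairs[OF m] by simp
  also have "\<dots> \<le> (\<integral>\<^sup>+ w. ennreal (exp (- a)) * ennreal (exp 1 ^ count_pairs A B w) \<partial>node_process d)"
    by (intro nn_integral_mono)
       (auto simp: indicator_def simp flip: ennreal_mult exp_of_nat_mult exp_add)
  also have "\<dots> = ennreal (exp (- a)) * (\<integral>\<^sup>+ w. ennreal (exp 1 ^ count_pairs A B w) \<partial>node_process d)"
    by (rule nn_integral_cmult, rule measurable_compose[OF measurable_count_pairs[OF m]]) simp
  also have "(\<integral>\<^sup>+ w. ennreal (exp 1 ^ count_pairs A B w) \<partial>node_process d) =
      (\<integral>\<^sup>+ N. ennreal ((1 + p * (exp 1 - 1)) ^ (N div 2)) \<partial>measure_pmf (poisson_pmf d))"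
    by (rule nn_integral_power_count_pairs[OF m _ p]) simp
  also have "ennreal (exp (- a)) * \<dots> \<le> 
      ennreal (exp (- a)) * (\<integral>\<^sup>+ N. ennreal ((1 + 2 * p) ^ N) \<partial>measure_pmf (poisson_pmf d))"
  proof (intro mult_left_mono nn_integral_mono ennreal_leI)
    fix N
    have "(1 + p * (exp 1 - 1)) ^ (N div 2) \<le> (1 + 2 * p) ^ (N div 2)"
      using p0 e mult_left_mono[of "exp 1 - 1" 2 p] by (intro power_mono) (auto simp: mult.commute)
    also have "\<dots> \<le> (1 + 2 * p) ^ N" using p0 by (intro power_increasing) auto
    finally show "(1 + p * (exp 1 - 1)) ^ (N div 2) \<le> (1 + 2 * p) ^ N" .
  qed simp
  also have "(\<integral>\<^sup>+ N. ennreal ((1 + 2 * p) ^ N) \<partial>measure_pmf (poisson_pmf d)) = ennreal (exp (2 * d * p))"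
    using p0 \<open>0 < d\<close> by (subst nn_integral_poisson_power) (auto simp: algebra_simps)
  also have "ennreal (exp (- a)) * ennreal (exp (2 * d * p)) = ennreal (exp (2 * d * p - a))"
    by (simp add: algebra_simps flip: ennreal_mult exp_add)
  finally have "emeasure (node_process d) ?E \<le> ennreal (exp (2 * d * p - a))" .
  then show ?thesis by (simp add: emeasure_eq_measure)
qed

text \<open>The Chernoff bound with base \<open>exp (-1)\<close>. Now the base \<open>y\<close> is
  at most 1, so \<open>N div 2\<close> cannot be raised to \<open>N\<close>; the power is rewritten
  with \<open>sqrt y\<close> instead. For odd \<open>N\<close> one factor \<open>sqrt y\<close> is
  missing, and since it is at least \<open>exp (-1/2)\<close> this costs the summand 1/2 in the
  exponent. The quarter comes from \<open>sqrt y \<le> 1 - p / 4\<close>.\<close>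

lemma prob_count_pairs_le:
  assumes m: "A \<in> sets borel" "B \<in> sets borel" and "0 < d"
    and p: "p = measure uniform_point A * measure uniform_point B"
  shows "measure (node_process d) {w. real (count_pairs A B w) \<le> a} \<le> exp (a + 1 / 2 - d * p / 4)"
proof -
  interpret prob_space "node_process d" by (rule prob_space_node_process)
  let ?E = "{w. real (count_pairs A B w) \<le> a}"
  have p01: "0 \<le> p" "p \<le> 1" unfolding p by (simp_all add: mult_le_one)
  define y where "y = 1 + p * (exp (-1) - 1 :: real)"
  have e: "exp (-1 :: real) \<le> 1 / 2"
    using exp_ge_add_one_self[of "1::real"] by (simp add: exp_minus field_simps)
  have y1: "y \<le> 1 - p / 2"
    using mult_left_mono[of "exp (-1) - 1" "-(1/2)" p] e p01 by (simp add: y_def)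
  have "exp (-1) \<le> y"
    using mult_right_mono[of p 1 "1 - exp (-1)"] p01 e by (simp add: y_def algebra_simps)
  then have sy: "exp (-1/2) \<le> sqrt y"
    by (intro real_le_rsqrt) (simp flip: exp_of_nat_mult)
  have y0: "0 < y" using \<open>exp (-1) \<le> y\<close> by (meson exp_gt_zero less_le_trans)
  have sy1: "sqrt y \<le> 1 - p / 4"
  proof (intro real_le_lsqrt)
    have "y \<le> 1 - p / 2 + (p / 4)\<^sup>2"
      using y1 by (simp add: add_increasing2)
    then show "y \<le> (1 - p / 4)\<^sup>2" by (simp add: power2_eq_square algebra_simps)
  qed (use p01 y0 in auto)
  have "emeasure (node_process d) ?E = (\<integral>\<^sup>+ w. indicator ?E w \<partial>node_process d)"
    using sets_count_pairs[OF m] by simp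
  also have "\<dots> \<le> (\<integral>\<^sup>+ w. ennreal (exp a) * ennreal (exp (-1) ^ count_pairs A B w) \<partial>node_process d)"
    by (intro nn_integral_mono)
       (auto simp: indicator_def simp flip: ennreal_mult exp_of_nat_mult exp_add)
  also have "\<dots> = ennreal (exp a) * (\<integral>\<^sup>+ w. ennreal (exp (-1) ^ count_pairs A B w) \<partial>node_process d)"
    by (rule nn_integral_cmult, rule measurable_compose[OF measurable_count_pairs[OF m]]) simp
  also have "(\<integral>\<^sup>+ w. ennreal (exp (-1) ^ count_pairs A B w) \<partial>node_process d) =
      (\<integral>\<^sup>+ N. ennreal (y ^ (N div 2)) \<partial>measure_pmf (poisson_pmf d))"
    unfolding y_def by (rule nn_integral_power_count_pairs[OF m _ p]) simp
  also have "ennreal (exp a) * \<dots> \<le>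
      ennreal (exp a) * (\<integral>\<^sup>+ N. ennreal (exp (1/2)) * ennreal (sqrt y ^ N) \<partial>measure_pmf (poisson_pmf d))"
  proof (intro mult_left_mono nn_integral_mono)
    fix N :: nat
    have "y ^ (N div 2) = sqrt y ^ (2 * (N div 2))"
      using y0 by (simp add: power_mult)
    also have "\<dots> \<le> exp (1/2) * sqrt y ^ N"
    proof (cases "even N")
      case True
      then show ?thesis using y0 by (auto intro: mult_right_mono[of 1, simplified])
    next
      case False
      then have "N = 2 * (N div 2) + 1" by presburger
      then have N: "sqrt y ^ N = sqrt y * sqrt y ^ (2 * (N div 2))"
        by (metis power_Suc Suc_eq_plus1)
      have "1 \<le> exp (1/2) * sqrt y"
        using mult_left_mono[OF sy, of "exp (1/2)"] by (simp flip: exp_add)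
      then show ?thesis
        unfolding N using y0 mult_right_mono[of 1 "exp (1/2) * sqrt y" "sqrt y ^ (2 * (N div 2))"]
        by (simp add: mult.assoc)
    qed
    finally show "ennreal (y ^ (N div 2)) \<le> ennreal (exp (1/2)) * ennreal (sqrt y ^ N)"
      by (simp add: ennreal_leI flip: ennreal_mult')
  qed simp
  also have "(\<integral>\<^sup>+ N. ennreal (exp (1/2)) * ennreal (sqrt y ^ N) \<partial>measure_pmf (poisson_pmf d)) =
      ennreal (exp (1/2)) * ennreal (exp (d * (sqrt y - 1)))"
    using y0 \<open>0 < d\<close> by (subst nn_integral_cmult) (auto simp: nn_integral_poisson_power)
  also have "ennreal (exp a) * (ennreal (exp (1/2)) * ennreal (exp (d * (sqrt y - 1)))) =
      ennreal (exp (a + 1 / 2 + d * (sqrt y - 1)))"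
    by (simp add: algebra_simps flip: ennreal_mult exp_add)
  finally have "emeasure (node_process d) ?E \<le> ennreal (exp (a + 1 / 2 + d * (sqrt y - 1)))" .
  then have "measure (node_process d) ?E \<le> exp (a + 1 / 2 + d * (sqrt y - 1))"
    by (simp add: emeasure_eq_measure)
  also have "\<dots> \<le> exp (a + 1 / 2 - d * p / 4)"
    using mult_left_mono[OF sy1, of d] \<open>0 < d\<close> by (simp add: algebra_simps)
  finally show ?thesis .
qed

section \<open>Almost sure properties of the positions\<close>

lemma AE_pair_snd:
  assumes "sigma_finite_measure M2" "AE y in M2. P y"
  shows "AE w in M1 \<Otimes>\<^sub>M M2. P (snd w)"
proof -
  interpret sigma_finite_measure M2 by fact
  from assms(2) obtain N where N: "{y \<in> space M2. \<not> P y} \<subseteq> N" "N \<in> null_sets M2"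
    unfolding eventually_ae_filter by auto
  have "space M1 \<times> N \<in> null_sets (M1 \<Otimes>\<^sub>M M2)"
    using N(2) by (intro times_in_null_sets2) auto
  then show ?thesis
    unfolding eventually_ae_filter using N(1)
    by (intro bexI[of _ "space M1 \<times> N"]) (auto simp: space_pair_measure)
qed

lemma AE_node_processI:
  assumes "AE X in uniform_points. P X"
  shows "AE w in node_process d. P (snd w)"
  unfolding node_process_def
  using uniform_points.P.sigma_finite_measure_axioms assms by (rule AE_pair_snd)

lemma AE_nodes_in_unit_square: "AE w in node_process d. \<forall>i. snd w i \<in> unit_square"
proof -
  have "AE x in uniform_point. x \<in> unit_square"
    by (rule AE_uniform_measureI) auto
  then have "AE X in uniform_points. X i \<in> unit_square" for i :: nat
    by (intro uniform_points.AE_component) auto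
  then have "AE X in uniform_points. \<forall>i. X i \<in> unit_square"
    by (simp only: AE_all_countable) simp
  then show ?thesis by (rule AE_node_processI)
qed

text \<open>The joint distribution of two positions is a product, and the slices of the diagonal are
  single points, hence null. The lemma is applied to a source and its destination:
  \<open>0 powr (- a)\<close> is 0, so coinciding nodes would have rate 0.\<close>

lemma AE_nodes_distinct:
  fixes i j :: nat
  assumes "i \<noteq> j"
  shows "AE w in node_process d. snd w i \<noteq> snd w j"
proof -
  have "uniform_points.P.indep_var uniform_point (\<lambda>X. X i) uniform_point (\<lambda>X. X j)"
    using uniform_points.P.indep_var_compose[OF
      uniform_points.P.indep_var_restrict[OF indep_vars_coordinates, of "{i}" "{j}"],
      of "\<lambda>x. x i" uniform_point "\<lambda>x. x j" uniform_point] assms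
    by (simp add: comp_def)
  then have d: "uniform_point \<Otimes>\<^sub>M uniform_point =
      distr uniform_points (uniform_point \<Otimes>\<^sub>M uniform_point) (\<lambda>X. (X i, X j))"
    unfolding uniform_points.P.indep_var_distribution_eq
    using uniform_points.PiM_component[of i] uniform_points.PiM_component[of j] by simp
  have D: "{z :: point \<times> point. fst z = snd z} \<in> sets (uniform_point \<Otimes>\<^sub>M uniform_point)"
  proof -
    have "{z :: point \<times> point. fst z = snd z} \<in> sets (borel \<Otimes>\<^sub>M borel)"
      unfolding borel_prod by (intro borel_closed closed_Collect_eq continuous_intros)
    then show ?thesis by (simp cong: sets_pair_measure_cong)
  qed
  have "emeasure uniform_point (Pair x -` {z. fst z = snd z}) = 0" for x
  proof -
    have "emeasure lborel (unit_square \<inter> {x}) = 0"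
      using emeasure_mono[of "unit_square \<inter> {x}" "{x}" lborel] by simp
    moreover have "Pair x -` {z. fst z = snd z} = {x}" by auto
    ultimately show ?thesis by (simp add: emeasure_uniform_measure)
  qed
  then have "(\<integral>\<^sup>+ x. emeasure uniform_point (Pair x -` {z. fst z = snd z}) \<partial>uniform_point) = 0"
    by (simp only:) simp
  then have "emeasure (uniform_point \<Otimes>\<^sub>M uniform_point) {z. fst z = snd z} = 0"
    unfolding uniform_point.emeasure_pair_measure_alt[OF D] .
  then have "{z. fst z = snd z} \<in> null_sets (distr uniform_points (uniform_point \<Otimes>\<^sub>M uniform_point) (\<lambda>X. (X i, X j)))"
    unfolding d[symmetric] by (rule null_setsI) (rule D)
  then have "AE X in uniform_points. (X i, X j) \<notin> {z. fst z = snd z}"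
    by (rule AE_distrD[OF _ AE_not_in, rotated])
       (intro measurable_Pair measurable_component_singleton UNIV_I)
  then have "AE X in uniform_points. X i \<noteq> X j" by simp
  then show ?thesis by (rule AE_node_processI)
qed

section \<open>Packet schedules\<close>

text \<open>The times of all transmissions depend on the primary network only through
  \<open>may\<close>. The locale isolates the two properties that the counting of packets and slots
  uses, for an arbitrary period.\<close>

locale periodic_access =
  fixes may :: "cell \<Rightarrow> nat \<Rightarrow> bool" and T :: nat
  assumes T_pos: "0 < T"
    and periodic: "may c (v + T) \<longleftrightarrow> may c v"
    and access: "\<exists>v. may c v"
begin

definition next_slot :: "cell \<Rightarrow> nat \<Rightarrow> nat" where
  "next_slot c u = (LEAST v. u < v \<and> may c v)"

lemma periodic_mult: "may c (v + k * T) \<longleftrightarrow> may c v"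
proof (induction k)
  case (Suc k)
  then show ?case using periodic[of c "v + k * T"] by (simp add: algebra_simps)
qed simp

lemma access_within: "\<exists>v. u < v \<and> v \<le> u + T \<and> may c v"
proof -
  obtain w where w: "may c w" using access by blast
  define r where "r = w mod T"
  have r: "may c r" "r < T"
    using periodic_mult[of c r "w div T"] w T_pos by (simp_all add: r_def)
  define a where "a = u mod T"
  define k where "k = u div T"
  have u: "u = a + k * T" "a < T" using T_pos by (simp_all add: a_def k_def)
  show ?thesis
  proof (cases "a < r")
    case True
    then show ?thesis
      using u r periodic_mult[of c r k] by (intro exI[of _ "r + k * T"]) auto
  next
    case False
    then show ?thesis
      using u r periodic_mult[of c r "Suc k"] by (intro exI[of _ "r + Suc k * T"]) auto
  qed
qed

lemma next_slot_props: "u < next_slot c u" "may c (next_slot c u)" "next_slot c u \<le> u + T"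
proof -
  obtain v where v: "u < v" "v \<le> u + T" "may c v" using access_within by blast
  have "u < next_slot c u \<and> may c (next_slot c u)"
    unfolding next_slot_def by (rule LeastI[of _ v]) (use v in blast)
  then show "u < next_slot c u" "may c (next_slot c u)" by auto
  have "next_slot c u \<le> v"
    unfolding next_slot_def by (rule Least_le) (use v in blast)
  then show "next_slot c u \<le> u + T" using v by simp
qed

lemma next_slot_le: "u < v \<Longrightarrow> may c v \<Longrightarrow> next_slot c u \<le> v"
  unfolding next_slot_def by (rule Least_le) blast

lemma next_slot_mono: "u \<le> u' \<Longrightarrow> next_slot c u \<le> next_slot c u'"
  using next_slot_props[where c = c] by (intro next_slot_le) (auto intro: le_less_trans)

text \<open>Going back one period from the later slot gives an accessible slot after
  \<open>u\<close>. Together with monotonicity this keeps packets that departed a full period apart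
  in different slots on every hop.\<close>

lemma next_slot_shift: "next_slot c u + T \<le> next_slot c (u + T)"
proof -
  let ?w = "next_slot c (u + T)"
  have w: "u + T < ?w" "may c ?w" using next_slot_props by auto
  then have "may c (?w - T)" using periodic[of c "?w - T"] by simp
  then have "next_slot c u \<le> ?w - T" using w by (intro next_slot_le) auto
  then show ?thesis using w by simp
qed

text \<open>The recursion of \<open>hop_slot\<close> started in an arbitrary slot \<open>u\<close>
  instead of the \<open>j\<close>-th departure, so that monotonicity and shifts in the starting slot
  can be proved by induction on the hops.\<close>

primrec arrival :: "nat \<Rightarrow> config \<Rightarrow> nat \<Rightarrow> nat \<Rightarrow> nat \<Rightarrow> nat" where
  "arrival q w i u 0 = u"
| "arrival q w i u (Suc k) = next_slot (path q w i (Suc k)) (arrival q w i u k)"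

lemma arrival_lower: "u + k \<le> arrival q w i u k"
proof (induction k)
  case (Suc k)
  then show ?case
    using next_slot_props(1)[of "arrival q w i u k" "path q w i (Suc k)"] by simp
qed simp

lemma arrival_upper: "arrival q w i u k \<le> u + k * T"
proof (induction k)
  case (Suc k)
  then show ?case
    using next_slot_props(3)[of "path q w i (Suc k)" "arrival q w i u k"] by simp
qed simp

lemma arrival_mono: "u \<le> u' \<Longrightarrow> arrival q w i u k \<le> arrival q w i u' k"
  by (induction k) (auto intro: next_slot_mono)

lemma arrival_shift: "arrival q w i u k + T \<le> arrival q w i (u + T) k"
proof (induction k)
  case (Suc k)
  have "arrival q w i u (Suc k) + T \<le> next_slot (path q w i (Suc k)) (arrival q w i u k + T)"
    using next_slot_shift by simp
  also have "\<dots> \<le> arrival q w i (u + T) (Suc k)"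
    using Suc by (auto intro: next_slot_mono)
  finally show ?case .
qed simp

lemma infinite_access: "infinite {v. may c v}"
  unfolding infinite_nat_iff_unbounded using access_within by blast

definition departure :: "nat \<Rightarrow> config \<Rightarrow> nat \<Rightarrow> nat \<Rightarrow> nat" where
  "departure q w i j = enumerate {v. may (path q w i 0) v} j"

lemma hop_slot_eq: "hop_slot q w may i j k = arrival q w i (departure q w i j) k"
  by (induction k) (simp_all add: departure_def next_slot_def)

lemma hop_slot_may: "may (path q w i k) (hop_slot q w may i j k)"
proof (cases k)
  case 0
  then show ?thesis using enumerate_in_set[OF infinite_access] by simp
next
  case (Suc k')
  then show ?thesis using next_slot_props(2) by (simp add: hop_slot_eq del: hop_slot.simps)
qed

lemma departure_strict_mono: "strict_mono (departure q w i)"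
  unfolding departure_def strict_mono_def using enumerate_mono[OF _ infinite_access] by blast

lemma departure_ge: "j \<le> departure q w i j"
  using departure_strict_mono by (rule strict_mono_imp_increasing)

lemma hop_slot_bounds:
  "hop_slot q w may i j 0 + k \<le> hop_slot q w may i j k"
  "hop_slot q w may i j k \<le> hop_slot q w may i j 0 + k * T"
  using arrival_lower arrival_upper by (simp_all add: hop_slot_eq del: hop_slot.simps)

lemma hop_slot_ge: "j \<le> hop_slot q w may i j k"
  using hop_slot_bounds(1)[of q w i j k] departure_ge[of j q w i]
  by (simp add: hop_slot_eq del: hop_slot.simps)

lemma finite_hop_slot_less: "finite {j. hop_slot q w may i j k < t \<and> P j}"
  by (rule finite_subset[of _ "{..<t}"]) (auto intro: le_less_trans[OF hop_slot_ge])

lemma finite_hop_slot_eq: "finite {j. hop_slot q w may i j k = v}"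
  by (rule finite_subset[of _ "{..v}"]) (use hop_slot_ge[of _ q w i k] in auto)

text \<open>Departure slots are strictly increasing, so packet \<open>j\<close> is nowhere
  transmitted before slot \<open>j\<close>: a pair sends at most one packet per slot on average. The
  predicate \<open>P\<close> leaves room for the success of all hops.\<close>

lemma card_hop_slot_less: "card {j. hop_slot q w may i j k < t \<and> P j} \<le> t"
proof -
  have "{j. hop_slot q w may i j k < t \<and> P j} \<subseteq> {..<t}"
    by (auto intro: le_less_trans[OF hop_slot_ge])
  from card_mono[OF _ this] show ?thesis by simp
qed

text \<open>The slot of a transmission is a monotone function of the slot of departure and moves by at least a
  period when the departure does, so packets of one pair that share a slot departed within one period.\<close>

lemma card_hop_slot_eq: "card {j. hop_slot q w may i j k = v} \<le> T"
proof (cases "{j. hop_slot q w may i j k = v} = {}")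
  case False
  let ?J = "{j. hop_slot q w may i j k = v}"
  define j0 where "j0 = Min ?J"
  have j0: "hop_slot q w may i j0 k = v" "\<And>j. j \<in> ?J \<Longrightarrow> j0 \<le> j"
    using Min_in[OF finite_hop_slot_eq False] Min_le[OF finite_hop_slot_eq[of q w i k v]]
    unfolding j0_def by blast+
  have "departure q w i ` ?J \<subseteq> {departure q w i j0..<departure q w i j0 + T}"
  proof clarify
    fix j assume j: "v = hop_slot q w may i j k"
    then have "departure q w i j0 \<le> departure q w i j"
      using j0(2) strict_mono_less_eq[OF departure_strict_mono] by auto
    moreover have "\<not> departure q w i j0 + T \<le> departure q w i j"
    proof
      assume "departure q w i j0 + T \<le> departure q w i j"
      from arrival_mono[OF this, of q w i k] arrival_shift[of q w i "departure q w i j0" k]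
      have "v + T \<le> v" using j j0(1) by (simp add: hop_slot_eq)
      then show False using T_pos by simp
    qed
    ultimately show "departure q w i j \<in> {departure q w i j0..<departure q w i j0 + T}"
      by simp
  qed
  from card_mono[OF _ this] have "card (departure q w i ` ?J) \<le> T" by simp
  then show ?thesis
    by (subst (asm) card_image)
       (auto intro: inj_on_subset[OF strict_mono_imp_inj_on[OF departure_strict_mono]])
qed simp

lemma departure_upper: "departure q w i j \<le> Suc j * T"
proof (induction j)
  case 0
  obtain v where v: "may (path q w i 0) v" using access by blast
  then have "may (path q w i 0) (v mod T)"
    using periodic_mult[of "path q w i 0" "v mod T" "v div T"] by simp
  then have "departure q w i 0 \<le> v mod T"
    unfolding departure_def enumerate_0 by (intro Least_le) simp
  also have "v mod T \<le> T" using T_pos by (simp add: less_imp_le)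
  finally show ?case by simp
next
  case (Suc j)
  let ?S = "{v. may (path q w i 0) v}"
  obtain v where v: "departure q w i j < v" "v \<le> departure q w i j + T" "may (path q w i 0) v"
    using access_within by blast
  have "departure q w i (Suc j) \<le> v"
    unfolding departure_def
    by (subst enumerate_Suc''[OF infinite_access])
       (use v in \<open>auto intro: Least_le simp: departure_def\<close>)
  then show ?case using v Suc by simp
qed

text \<open>Packet \<open>j\<close> departs by slot \<open>Suc j * T\<close>, and each of the
  \<open>k\<close> further hops takes at most one period. Of the 2 subtracted, one is due to
  \<open>Suc j\<close> and one to rounding down to an integer.\<close>

lemma card_hop_slot_ge:
  "real (card {j. hop_slot q w may i j k < t}) \<ge> real t / real T - real k - 2"
proof -
  have "{j. Suc j * T + k * T < t} \<subseteq> {j. hop_slot q w may i j k < t}"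
  proof clarify
    fix j assume "Suc j * T + k * T < t"
    then show "hop_slot q w may i j k < t"
      using arrival_upper[of q w i "departure q w i j" k] departure_upper[of q w i j]
      by (simp add: hop_slot_eq)
  qed
  moreover have "{..<nat \<lfloor>real t / real T - real k - 1\<rfloor>} \<subseteq> {j. Suc j * T + k * T < t}"
  proof clarify
    fix j assume "j < nat \<lfloor>real t / real T - real k - 1\<rfloor>"
    then have "real j + 1 \<le> real t / real T - real k - 1" by linarith
    then have "(real j + 2 + real k) * real T \<le> real t"
      using T_pos by (simp add: field_simps)
    then have "(j + 2 + k) * T \<le> t"
      unfolding of_nat_le_iff[where 'a = real, symmetric] by (simp add: algebra_simps)
    then show "Suc j * T + k * T < t" using T_pos by (simp add: algebra_simps)
  qed
  ultimately have "card {..<nat \<lfloor>real t / real T - real k - 1\<rfloor>} \<le> card {j. hop_slot q w may i j k < t}"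
    using finite_hop_slot_less[where P = "\<lambda>_. True"] by (intro card_mono) auto
  then show ?thesis by simp linarith
qed

end

section \<open>Delay of a pair\<close>

lemma finite_passing [simp]: "finite (passing q w c)"
  unfolding passing_def by simp

lemma finite_originating [simp]: "finite (originating q w c)"
  unfolding originating_def by simp

lemma set_packet_slots [simp]: "set (packet_slots q w c) = passing q w c \<union> originating q w c"
  by (simp add: packet_slots_def)

lemma hops_pos: "0 < hops q w i"
  by (simp add: hops_def)

lemma in_packet_slots:
  assumes "i < num_pairs w" "k < hops q w i"
  shows "i \<in> set (packet_slots q w (path q w i k))"
proof (cases "k = 0")
  case True
  have "path q w i 0 = cell_of q (src w i)"
    by (cases "cell_of q (src w i)"; cases "cell_of q (dst w i)") (simp add: path_def)
  then show ?thesis using True assms by (simp add: originating_def)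
next
  case False
  then show ?thesis using assms by (auto simp: passing_def)
qed

lemma slot_index_props:
  assumes "i \<in> set (packet_slots q w c)"
  shows "slot_index q w c i < length (packet_slots q w c)"
    and "packet_slots q w c ! slot_index q w c i = i"
proof -
  obtain k where "k < length (packet_slots q w c) \<and> packet_slots q w c ! k = i"
    using assms by (auto simp: in_set_conv_nth simp del: set_packet_slots)
  from LeastI[of "\<lambda>k. k < length (packet_slots q w c) \<and> packet_slots q w c ! k = i", OF this]
  show "slot_index q w c i < length (packet_slots q w c)"
    "packet_slots q w c ! slot_index q w c i = i"
    unfolding slot_index_def by auto
qed

lemma packet_time_bounds:
  assumes "i \<in> set (packet_slots q w c)" "e \<le> 1" "0 \<le> s"
  shows "s * real v \<le> packet_time q w s c i v e" "packet_time q w s c i v e \<le> s * (real v + 1)"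
proof -
  have "real (slot_index q w c i + e) / real (length (packet_slots q w c)) \<le> 1"
    using slot_index_props(1)[OF assms(1)] assms(2) by (simp add: divide_le_eq_1)
  then show "s * real v \<le> packet_time q w s c i v e" "packet_time q w s c i v e \<le> s * (real v + 1)"
    using assms(3) unfolding packet_time_def by (auto intro!: mult_left_mono)
qed

text \<open>Between the first and the last transmission lie \<open>hops - 1\<close> waits of at
  least one slot and at most \<open>T\<close> slots. The positions inside the first and the last
  slot shift the difference by at most one slot, which yields \<open>hops - 2\<close> below and is
  absorbed by \<open>T \<ge> 1\<close> above.\<close>

lemma (in periodic_access) packet_delay_bounds:
  assumes "i < num_pairs w" "0 \<le> s"
  shows "s * (real (hops q w i) - 2) \<le> packet_delay q w may s i j"
    and "packet_delay q w may s i j \<le> s * (real (hops q w i) * real T)"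
proof -
  define h where "h = hops q w i - 1"
  have h: "h < hops q w i" "real (hops q w i) = real h + 1"
    using hops_pos[of q w i] by (auto simp: h_def)
  note in0 = in_packet_slots[OF assms(1) hops_pos] and inh = in_packet_slots[OF assms(1) h(1)]
  have v: "real (hop_slot q w may i j 0) + real h \<le> real (hop_slot q w may i j h)"
    "real (hop_slot q w may i j h) \<le> real (hop_slot q w may i j 0) + real h * real T"
    using hop_slot_bounds[of q w i j h] by (simp_all flip: of_nat_add of_nat_mult)
  have T1: "1 \<le> real T" using T_pos by simp
  have "packet_delay q w may s i j \<ge> s * real (hop_slot q w may i j h) - s * (real (hop_slot q w may i j 0) + 1)"
    unfolding packet_delay_def Let_def h_def[symmetric]
    by (intro diff_mono packet_time_bounds[OF inh _ assms(2)] packet_time_bounds[OF in0 _ assms(2)]) auto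
  moreover have "s * (real (hops q w i) - 2) \<le> s * (real (hop_slot q w may i j h) - (real (hop_slot q w may i j 0) + 1))"
    using v(1) h(2) assms(2) by (intro mult_left_mono) auto
  ultimately show "s * (real (hops q w i) - 2) \<le> packet_delay q w may s i j"
    by (simp add: algebra_simps)
  have "packet_delay q w may s i j \<le> s * (real (hop_slot q w may i j h) + 1) - s * real (hop_slot q w may i j 0)"
    unfolding packet_delay_def Let_def h_def[symmetric]
    by (intro diff_mono packet_time_bounds[OF inh _ assms(2)] packet_time_bounds[OF in0 _ assms(2)]) auto
  moreover have "s * (real (hop_slot q w may i j h) + 1 - real (hop_slot q w may i j 0)) \<le> s * (real (hops q w i) * real T)"
    using v(2) h(2) assms(2) T1 by (intro mult_left_mono) (auto simp: algebra_simps)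
  ultimately show "packet_delay q w may s i j \<le> s * (real (hops q w i) * real T)"
    by (simp add: algebra_simps)
qed

lemma (in periodic_access) pair_delay_bounds:
  assumes "i < num_pairs w" "0 \<le> s"
  shows "ereal (s * (real (hops q w i) - 2)) \<le> pair_delay q w may s i"
    and "pair_delay q w may s i \<le> ereal (s * (real (hops q w i) * real T))"
proof -
  let ?a = "\<lambda>k. (\<Sum>j<k. packet_delay q w may s i j) / real k"
  have B: "s * (real (hops q w i) - 2) \<le> ?a k \<and> ?a k \<le> s * (real (hops q w i) * real T)" if "0 < k" for k
    using sum_mono[of "{..<k}" "\<lambda>_. s * (real (hops q w i) - 2)" "packet_delay q w may s i"]
      sum_mono[of "{..<k}" "packet_delay q w may s i" "\<lambda>_. s * (real (hops q w i) * real T)"]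
      packet_delay_bounds[OF assms] that by (simp add: field_simps)
  have ev: "\<forall>\<^sub>F k in sequentially. ereal (s * (real (hops q w i) - 2)) \<le> ereal (?a k) \<and>
      ereal (?a k) \<le> ereal (s * (real (hops q w i) * real T))"
    by (rule eventually_mono[OF eventually_gt_at_top[of "0::nat"]]) (use B in auto)
  show "pair_delay q w may s i \<le> ereal (s * (real (hops q w i) * real T))"
    unfolding pair_delay_def by (rule Limsup_bounded, rule eventually_mono[OF ev], blast)
  have "ereal (s * (real (hops q w i) - 2)) \<le> liminf (\<lambda>k. ereal (?a k))"
    by (rule Liminf_bounded, rule eventually_mono[OF ev], blast)
  also have "\<dots> \<le> pair_delay q w may s i"
    unfolding pair_delay_def by (rule Liminf_le_Limsup) simp
  finally show "ereal (s * (real (hops q w i) - 2)) \<le> pair_delay q w may s i" .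
qed

section \<open>Routes\<close>

lemma route_0 [simp]: "route c c' 0 = c"
  by (cases c; cases c') simp

lemma route_cell_dist [simp]: "route c c' (cell_dist c c') = c'"
proof (cases c; cases c')
  fix x y x' y' assume "c = (x, y)" "c' = (x', y')"
  then show ?thesis
    by (cases "y' = y") (auto simp: sgn_if)
qed

lemma route_row_or_column: "snd (route c c' k) = snd c \<or> fst (route c c' k) = fst c'"
  by (cases c; cases c') simp

lemma route_step:
  assumes "k < cell_dist c c'"
  shows "\<bar>fst (route c c' (Suc k)) - fst (route c c' k)\<bar> +
    \<bar>snd (route c c' (Suc k)) - snd (route c c' k)\<bar> = 1"
proof (cases c; cases c')
  fix x y x' y' assume "c = (x, y)" "c' = (x', y')"
  then show ?thesis
    using assms by (auto simp: sgn_if algebra_simps split: if_splits)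
qed

lemma route_in_grid:
  assumes "c \<in> grid q" "c' \<in> grid q" "k \<le> cell_dist c c'"
  shows "route c c' k \<in> grid q"
proof (cases c; cases c')
  fix x y x' y' assume "c = (x, y)" "c' = (x', y')"
  then show ?thesis
    using assms by (auto simp: grid_def sgn_if)
qed

lemma path_0: "path q w i 0 = cell_of q (src w i)"
  by (simp add: path_def)

lemma cell_of_in_grid:
  assumes "0 < q" "z \<in> unit_square"
  shows "cell_of q z \<in> grid q"
proof -
  have "real q * a < real q" if "a < 1" for a
    using mult_strict_left_mono[OF that, of "real q"] assms(1) by simp
  then have "\<lfloor>real q * a\<rfloor> < int q" if "a < 1" for a
    using that by (simp add: floor_less_iff)
  then show ?thesis
    using assms by (auto simp: cell_of_def grid_def)
qed

lemma hops_le: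
  assumes "0 < q" "src w i \<in> unit_square" "dst w i \<in> unit_square"
  shows "hops q w i \<le> 2 * q"
  using cell_of_in_grid[OF assms(1,2)] cell_of_in_grid[OF assms(1,3)] assms(1)
  by (cases "cell_of q (src w i)"; cases "cell_of q (dst w i)") (auto simp: hops_def grid_def)

lemma path_in_grid:
  assumes "0 < q" "src w i \<in> unit_square" "dst w i \<in> unit_square" "k < hops q w i"
  shows "path q w i k \<in> grid q"
  unfolding path_def using assms
  by (intro route_in_grid cell_of_in_grid) (auto simp: hops_def)

section \<open>Cells and distances\<close>

lemma cell_of_eq_iff:
  assumes "0 < q"
  shows "cell_of q z = (x, y) \<longleftrightarrow>
    z \<in> {of_int x / real q..<(of_int x + 1) / real q} \<times> {of_int y / real q..<(of_int y + 1) / real q}"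
  using assms by (cases z) (auto simp: cell_of_def floor_eq_iff field_simps)

lemma abs_floor_diff: "\<bar>of_int \<lfloor>a\<rfloor> - of_int \<lfloor>b\<rfloor>\<bar> \<le> \<bar>a - b\<bar> + (1 :: real)"
  by linarith

lemma dist_component_le:
  fixes u z :: point
  shows "\<bar>fst u - fst z\<bar> \<le> dist u z" "\<bar>snd u - snd z\<bar> \<le> dist u z"
  using dist_fst_le[of u z] dist_snd_le[of u z] by (simp_all add: dist_real_def)

text \<open>The maximum distance of two cells in the grid, cut off below at 1, so that its negative
  powers are at most 1 and are monotone without an exception for equal cells.\<close>

definition cell_gap :: "cell \<Rightarrow> cell \<Rightarrow> real" where
  "cell_gap c c' = max 1 (of_int (max \<bar>fst c - fst c'\<bar> \<bar>snd c - snd c'\<bar>))"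

text \<open>\<open>real q * dist u z\<close> is the distance in units of cell sides; taking floors
  of the coordinates changes their difference by at most 1.\<close>

lemma cell_gap_le_dist:
  fixes u z :: point
  shows "of_int (max \<bar>fst (cell_of q u) - fst (cell_of q z)\<bar> \<bar>snd (cell_of q u) - snd (cell_of q z)\<bar>) - 1
    \<le> real q * dist u z"
proof -
  have 1: "\<bar>of_int (fst (cell_of q u)) - of_int (fst (cell_of q z))\<bar> \<le> real q * dist u z + 1"
  proof -
    have "\<bar>real q * fst u - real q * fst z\<bar> = real q * \<bar>fst u - fst z\<bar>"
      by (simp add: abs_mult flip: right_diff_distrib)
    also have "\<dots> \<le> real q * dist u z"
      by (intro mult_left_mono dist_component_le) auto
    finally show ?thesis
      using abs_floor_diff[of "real q * fst u" "real q * fst z"] by (simp add: cell_of_def)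
  qed
  have 2: "\<bar>of_int (snd (cell_of q u)) - of_int (snd (cell_of q z))\<bar> \<le> real q * dist u z + 1"
  proof -
    have "\<bar>real q * snd u - real q * snd z\<bar> = real q * \<bar>snd u - snd z\<bar>"
      by (simp add: abs_mult flip: right_diff_distrib)
    also have "\<dots> \<le> real q * dist u z"
      by (intro mult_left_mono dist_component_le) auto
    finally show ?thesis
      using abs_floor_diff[of "real q * snd u" "real q * snd z"] by (simp add: cell_of_def)
  qed
  show ?thesis using 1 2 by (auto simp: max_def)
qed

text \<open>The slot number \<open>5 * y + x\<close> determines both residues, so two cells active
  together differ in each coordinate by a multiple of 5, and in one of them by a nonzero
  one.\<close>

lemma same_tdma_slot:
  assumes "tdma_active c v" "tdma_active c' v" "c \<noteq> c'"
  shows "5 \<le> max \<bar>fst c - fst c'\<bar> \<bar>snd c - snd c'\<bar>"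
proof -
  have "5 * (snd c mod 5) + fst c mod 5 = 5 * (snd c' mod 5) + fst c' mod 5"
    using assms by (simp add: tdma_active_def)
  moreover have "0 \<le> fst c mod 5" "fst c mod 5 < 5" "0 \<le> fst c' mod 5" "fst c' mod 5 < 5"
    by simp_all
  ultimately have "snd c mod 5 = snd c' mod 5"
    by linarith
  moreover from this have "fst c mod 5 = fst c' mod 5"
    using \<open>5 * (snd c mod 5) + fst c mod 5 = 5 * (snd c' mod 5) + fst c' mod 5\<close> by simp
  ultimately
  have "5 dvd snd c - snd c'" "5 dvd fst c - fst c'"
    by (simp_all add: mod_eq_dvd_iff)
  moreover have "fst c - fst c' \<noteq> 0 \<or> snd c - snd c' \<noteq> 0"
    using assms(3) by (auto simp: prod_eq_iff)
  ultimately show ?thesis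
    using dvd_imp_le_int[of "fst c - fst c'" 5] dvd_imp_le_int[of "snd c - snd c'" 5] by auto
qed

section \<open>Interference\<close>

text \<open>Both half-lines are compared with the convergent series of \<open>k powr (- a)\<close>;
  the term at 0 is counted as 1.\<close>

lemma sum_int_powr_bounded:
  fixes a :: real
  assumes "1 < a"
  obtains G where "0 \<le> G" "\<And>S :: int set. finite S \<Longrightarrow> (\<Sum>x\<in>S. max 1 \<bar>of_int x\<bar> powr (- a)) \<le> G"
proof -
  define h where "h k = max 1 (real k) powr (- a)" for k
  have "summable h \<longleftrightarrow> summable (\<lambda>k. real k powr (- a))"
    by (rule summable_cong, rule eventually_mono[OF eventually_gt_at_top[of 0]]) (simp add: h_def max_def)
  then have h: "summable h" using assms by (simp add: summable_real_powr_iff)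
  have h0: "0 \<le> h k" for k by (simp add: h_def)
  have "(\<Sum>x\<in>S. max 1 \<bar>of_int x\<bar> powr (- a)) \<le> 2 * suminf h" if S: "finite S" for S :: "int set"
  proof -
    define n where "n = Max (insert 0 ((\<lambda>x. nat \<bar>x\<bar>) ` S))"
    have n: "nat \<bar>x\<bar> \<le> n" if "x \<in> S" for x unfolding n_def using S that by auto
    have "S \<subseteq> int ` {..n} \<union> (\<lambda>k. - int k) ` {..n}"
    proof
      fix x assume "x \<in> S"
      from n[OF this] show "x \<in> int ` {..n} \<union> (\<lambda>k. - int k) ` {..n}"
        by (cases "0 \<le> x") (auto simp: image_iff intro: bexI[of _ "nat \<bar>x\<bar>"])
    qed
    then have "(\<Sum>x\<in>S. max 1 \<bar>of_int x\<bar> powr (- a)) \<le>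
        (\<Sum>x\<in>int ` {..n} \<union> (\<lambda>k. - int k) ` {..n}. max 1 \<bar>of_int x\<bar> powr (- a))"
      by (intro sum_mono2) auto
    also have "\<dots> \<le> (\<Sum>x\<in>int ` {..n}. max 1 \<bar>of_int x\<bar> powr (- a)) +
        (\<Sum>x\<in>(\<lambda>k. - int k) ` {..n}. max 1 \<bar>of_int x\<bar> powr (- a))"
      by (subst sum.union_inter[symmetric]) (auto intro!: sum_nonneg)
    also have "\<dots> = sum h {..n} + sum h {..n}"
      by (subst (1 2) sum.reindex) (auto simp: inj_on_def h_def)
    also have "\<dots> \<le> 2 * suminf h"
      using sum_le_suminf[OF h, of "{..n}"] h0 by simp
    finally show ?thesis .
  qed
  moreover have "0 \<le> 2 * suminf h" using suminf_nonneg[OF h h0] by simp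
  ultimately show ?thesis by (rule that[rotated])
qed

text \<open>The maximum of two coordinates to the power \<open>- a\<close> is at most the product of
  the coordinates to the power \<open>- a / 2\<close> each. The planar sum is thus bounded by a
  product of two one-dimensional sums, which converge because \<open>a / 2\<close> exceeds 1: this
  is the use of a path loss exponent above 2.\<close>

lemma sum_cell_gap_bounded:
  fixes a :: real
  assumes "2 < a"
  obtains B where "0 \<le> B" "\<And>S c. finite S \<Longrightarrow> (\<Sum>p\<in>S. cell_gap p c powr (- a)) \<le> B"
proof -
  have "1 < a / 2" using assms by simp
  then obtain G where G: "0 \<le> G"
    "\<And>S :: int set. finite S \<Longrightarrow> (\<Sum>x\<in>S. max 1 \<bar>of_int x\<bar> powr (- (a / 2))) \<le> G"
    by (rule sum_int_powr_bounded) blast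
  define g where "g x = max 1 \<bar>real_of_int x\<bar> powr (- (a / 2))" for x
  have g0: "0 \<le> g x" for x by (simp add: g_def)
  have gS: "sum g A \<le> G" if "finite A" for A
    using G(2)[OF that] by (simp add: g_def[abs_def])
  have "(\<Sum>p\<in>S. cell_gap p c powr (- a)) \<le> G * G" if S: "finite S" for S c
  proof -
    have "(\<Sum>p\<in>S. cell_gap p c powr (- a)) \<le> (\<Sum>p\<in>S. g (fst p - fst c) * g (snd p - snd c))"
    proof (rule sum_mono)
      fix p
      have "cell_gap p c powr (- a) = cell_gap p c powr (- (a / 2)) * cell_gap p c powr (- (a / 2))"
        by (simp flip: powr_add)
      also have "\<dots> \<le> g (fst p - fst c) * g (snd p - snd c)"
        unfolding g_def cell_gap_def using assms
        by (intro mult_mono powr_mono2') (auto simp: max_def)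
      finally show "cell_gap p c powr (- a) \<le> g (fst p - fst c) * g (snd p - snd c)" .
    qed
    also have "\<dots> = (\<Sum>d\<in>(\<lambda>p. (fst p - fst c, snd p - snd c)) ` S. g (fst d) * g (snd d))"
      by (subst sum.reindex) (auto simp: inj_on_def prod_eq_iff)
    also have "\<dots> \<le> (\<Sum>d\<in>(\<lambda>p. fst p - fst c) ` S \<times> (\<lambda>p. snd p - snd c) ` S. g (fst d) * g (snd d))"
      using S by (intro sum_mono2) (auto simp: g_def)
    also have "\<dots> = (\<Sum>x\<in>(\<lambda>p. fst p - fst c) ` S. g x) * (\<Sum>y\<in>(\<lambda>p. snd p - snd c) ` S. g y)"
      by (simp add: sum_product sum.cartesian_product case_prod_beta)
    also have "\<dots> \<le> G * G"
      by (intro mult_mono gS sum_nonneg finite_imageI S G(1) g0)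
    finally show ?thesis .
  qed
  moreover have "0 \<le> G * G" using G(1) by simp
  ultimately show ?thesis by (rule that[rotated])
qed

text \<open>The transmit power is proportional to the cell side to the power \<open>a\<close>, so
  the received power depends only on the distance in cell sides. The factor 6 is generous: the
  separations established below would allow 3 for primary and 5/3 for secondary
  transmitters.\<close>

lemma received_power_le:
  fixes q :: nat
  assumes "0 < q" "0 \<le> P" "0 \<le> a" "cell_gap c c' \<le> 6 * (real q * d)"
  shows "P * (1 / (real q)\<^sup>2) powr (a / 2) * d powr (- a) \<le> P * 6 powr a * cell_gap c c' powr (- a)"
proof -
  have gap: "1 \<le> cell_gap c c'" by (simp add: cell_gap_def)
  then have d: "0 < d" using assms by (smt (verit) mult_nonneg_nonpos of_nat_0_le_iff)
  have q: "(1 / (real q)\<^sup>2) powr (a / 2) = real q powr (- a)"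
  proof -
    have "(1 / (real q)\<^sup>2) powr (a / 2) = (real q powr (- 2)) powr (a / 2)"
      using assms(1) by (simp add: powr_minus_divide)
    then show ?thesis by (simp add: powr_powr)
  qed
  have "(1 / (real q)\<^sup>2) powr (a / 2) * d powr (- a) = (real q * d) powr (- a)"
    unfolding q using d by (simp add: powr_mult)
  also have "\<dots> \<le> (cell_gap c c' / 6) powr (- a)"
    using assms gap by (intro powr_mono2') auto
  also have "\<dots> = 6 powr a * cell_gap c c' powr (- a)"
    using gap by (simp add: powr_divide powr_minus field_simps)
  finally show ?thesis
    using mult_left_mono[OF _ assms(2)] by (simp add: mult.assoc)
qed

lemma set_nodes_in [simp]: "set (nodes_in q w c) = {i. i < fst w \<and> cell_of q (snd w i) = c}"
  unfolding nodes_in_def by (rule set_sorted_list_of_set) simp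

lemma cell_of_relay:
  assumes "nodes_in q w c \<noteq> []"
  shows "cell_of q (relay q w may c v) = c"
proof -
  have "nodes_in q w c ! (card {u. u < v \<and> may c u} mod length (nodes_in q w c)) \<in> set (nodes_in q w c)"
    using assms by (intro nth_mem) simp
  then show ?thesis by (simp add: relay_def)
qed

lemma cell_of_transmitter:
  assumes "transmitting q w may c v"
  shows "cell_of q (transmitter q w may s c t) = c"
proof -
  have "packet_slots q w c \<noteq> []" "nodes_in q w c \<noteq> []"
    using assms by (auto simp: transmitting_def)
  then show ?thesis
    by (auto simp: transmitter_def Let_def cell_of_relay originating_def)
qed

section \<open>Both networks together: preservation regions, interference and access\<close>

context overlay_params
begin

definition admissible :: "real \<Rightarrow> bool" where
  "admissible m \<longleftrightarrow> 0 < primary_cells Q m \<and> 4 * primary_cells Q m \<le> secondary_cells Q m"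

lemma admissible_pos: "admissible m \<Longrightarrow> 0 < primary_cells Q m" "admissible m \<Longrightarrow> 0 < secondary_cells Q m"
  by (auto simp: admissible_def)

lemma sqrt_area_ratio:
  assumes "admissible m"
  shows "sqrt (primary_area Q m / secondary_area Q m) = real (secondary_cells Q m) / real (primary_cells Q m)"
  using admissible_pos[OF assms]
  by (simp add: primary_area_def secondary_area_def real_sqrt_divide)

text \<open>The region covers the 3 x 3 block around \<open>p\<close>, so a cell outside it is at
  least one primary side away from \<open>p\<close> in some coordinate. A receiver in an adjacent
  cell loses one secondary side, which is at most a quarter of a primary side; of the remaining 3/4
  only 1/2 is kept.\<close>

lemma outside_preservation_region:
  assumes "admissible m" "c \<notin> preservation_region Q m p"
    "cell_of (primary_cells Q m) u = p"
    "\<bar>fst (cell_of (secondary_cells Q m) z) - fst c\<bar> \<le> 1"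
    "\<bar>snd (cell_of (secondary_cells Q m) z) - snd c\<bar> \<le> 1"
  shows "1 / 2 \<le> real (primary_cells Q m) * dist u z"
proof -
  define qp where "qp = real (primary_cells Q m)"
  define qs where "qs = real (secondary_cells Q m)"
  have q: "0 < qp" "4 * qp \<le> qs" using assms(1) by (auto simp: admissible_def qp_def qs_def)
  have r: "sqrt (primary_area Q m / secondary_area Q m) = qs / qp"
    using sqrt_area_ratio[OF assms(1)] by (simp add: qp_def qs_def)
  \<comment> \<open>One coordinate at a time: a cell outside the square lies outside its range in at
    least one coordinate, and a difference in that coordinate suffices.\<close>
  have key: "1 / 2 \<le> qp * \<bar>u' - z'\<bar>"
    if out: "\<not> (\<lfloor>qs / qp * of_int (P - 1)\<rfloor> \<le> C \<and> C < \<lfloor>qs / qp * of_int (P - 1)\<rfloor> + (\<lfloor>3 * (qs / qp)\<rfloor> + 2))"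
      and u: "\<lfloor>qp * u'\<rfloor> = P" and z: "\<bar>\<lfloor>qs * z'\<rfloor> - C\<bar> \<le> 1" for P C :: int and u' z' :: real
  proof -
    have u2: "of_int P \<le> qp * u'" "qp * u' < of_int P + 1" using u by linarith+
    have zq: "qp * z' = (qs * z') * (qp / qs)" using q by simp
    have pos: "0 < qp / qs" using q by simp
    have small: "qp / qs \<le> 1 / 4" using q by (simp add: field_simps)
    define X where "X = qs / qp * (of_int P - 1)"
    have X: "qs / qp * of_int (P - 1) = X" by (simp add: X_def)
    define Y where "Y = 3 * (qs / qp)"
    have XY: "X * (qp / qs) = of_int P - 1" "Y * (qp / qs) = 3"
      using q by (simp_all add: X_def Y_def)
    show ?thesis
    proof (cases "C < \<lfloor>qs / qp * of_int (P - 1)\<rfloor>")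
      case True
      then have "of_int C + 1 \<le> X" unfolding X by linarith
      moreover have "qs * z' < of_int C + 2" using z by linarith
      ultimately have "qs * z' \<le> X + 1" by linarith
      from mult_right_mono[OF this, of "qp / qs"] pos have "qp * z' \<le> of_int P - 1 + qp / qs"
        unfolding zq distrib_right XY by simp
      then have "1 / 2 \<le> qp * u' - qp * z'" using u2 small by linarith
      also have "\<dots> \<le> qp * \<bar>u' - z'\<bar>" using q by (simp flip: right_diff_distrib)
      finally show ?thesis .
    next
      case False
      \<comment> \<open>The summand 2 in the width of the region compensates exactly for the two
        floors.\<close>
      then have "\<lfloor>X\<rfloor> + (\<lfloor>Y\<rfloor> + 2) \<le> C" using out unfolding X Y_def[symmetric] by linarith
      then have "X + Y \<le> of_int C" by linarith
      moreover have "of_int C - 1 \<le> qs * z'" using z by linarith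
      ultimately have "X + Y - 1 \<le> qs * z'" by linarith
      from mult_right_mono[OF this, of "qp / qs"] pos have "of_int P + 2 - qp / qs \<le> qp * z'"
        unfolding zq left_diff_distrib distrib_right XY by simp
      then have "1 / 2 \<le> qp * z' - qp * u'" using u2 small by linarith
      also have "\<dots> \<le> qp * \<bar>u' - z'\<bar>" using q by (simp flip: right_diff_distrib)
      finally show ?thesis .
    qed
  qed
  have uf: "\<lfloor>qp * fst u\<rfloor> = fst p" "\<lfloor>qp * snd u\<rfloor> = snd p"
    using assms(3) by (auto simp: cell_of_def qp_def)
  have zf: "\<bar>\<lfloor>qs * fst z\<rfloor> - fst c\<bar> \<le> 1" "\<bar>\<lfloor>qs * snd z\<rfloor> - snd c\<bar> \<le> 1"
    using assms(4,5) by (auto simp: cell_of_def qs_def)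
  from assms(2) have "\<not> (\<lfloor>qs / qp * of_int (fst p - 1)\<rfloor> \<le> fst c \<and> fst c < \<lfloor>qs / qp * of_int (fst p - 1)\<rfloor> + (\<lfloor>3 * (qs / qp)\<rfloor> + 2)) \<or>
     \<not> (\<lfloor>qs / qp * of_int (snd p - 1)\<rfloor> \<le> snd c \<and> snd c < \<lfloor>qs / qp * of_int (snd p - 1)\<rfloor> + (\<lfloor>3 * (qs / qp)\<rfloor> + 2))"
    unfolding preservation_region_def preservation_width_def Let_def r by (cases c) auto
  then have "1 / 2 \<le> qp * \<bar>fst u - fst z\<bar> \<or> 1 / 2 \<le> qp * \<bar>snd u - snd z\<bar>"
    using key[OF _ uf(1) zf(1)] key[OF _ uf(2) zf(2)] by blast
  moreover have "qp * \<bar>fst u - fst z\<bar> \<le> qp * dist u z" "qp * \<bar>snd u - snd z\<bar> \<le> qp * dist u z"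
    using q by (intro mult_left_mono dist_component_le; simp)+
  ultimately show ?thesis unfolding qp_def by linarith
qed

text \<open>The interference determines active primary cells from the time, but secondary access
  determines them from the number of the secondary slot; this identifies the two.\<close>

lemma secondary_slot_div:
  assumes "0 \<le> t"
  shows "nat \<lfloor>t / secondary_slot_len Q\<rfloor> div 25 = nat \<lfloor>t / slot_len Q\<rfloor>"
proof -
  have "\<lfloor>t / slot_len Q\<rfloor> = \<lfloor>t / secondary_slot_len Q / of_int 25\<rfloor>"
    using slot_len by (simp add: secondary_slot_len_def field_simps)
  also have "\<dots> = \<lfloor>t / secondary_slot_len Q\<rfloor> div 25"
    by (rule floor_divide_real_eq_div) simp
  finally show ?thesis
    using assms slot_len by (simp add: nat_div_distrib secondary_slot_len_def)
qed

lemma interference_nonneg: "0 \<le> interference Q m wp ws c z t"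
  unfolding interference_def primary_tx_power_def secondary_tx_power_def gain_def
  using primary_pow secondary_pow by (intro add_nonneg_nonneg sum_nonneg mult_nonneg_nonneg) auto

text \<open>Preservation regions keep active primary transmitters half a primary side away from the
  receiver, and TDMA keeps the other secondary transmitters three secondary sides away. In the units
  of its own network each sum is then dominated by the convergent sum over cell gaps, uniformly in
  \<open>m\<close> and both configurations.\<close>

lemma interference_bounded:
  obtains B where "0 \<le> B"
    "\<And>m wp ws c z t. \<lbrakk>admissible m; 0 \<le> t; secondary_may Q m wp c (nat \<lfloor>t / secondary_slot_len Q\<rfloor>);
      \<bar>fst (cell_of (secondary_cells Q m) z) - fst c\<bar> \<le> 1;
      \<bar>snd (cell_of (secondary_cells Q m) z) - snd c\<bar> \<le> 1\<rbrakk>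
      \<Longrightarrow> interference Q m wp ws c z t \<le> B"
proof -
  let ?a = "path_loss Q"
  obtain B where B: "0 \<le> B" "\<And>S c. finite S \<Longrightarrow> (\<Sum>p\<in>S. cell_gap p c powr (- ?a)) \<le> B"
    using sum_cell_gap_bounded[OF path_loss] by blast
  have fin: "finite {p \<in> grid q. R p}" for q R by (simp add: grid_def)
  show thesis
  proof (rule that[of "primary_pow Q * 6 powr ?a * B + secondary_pow Q * 6 powr ?a * B"])
    show "0 \<le> primary_pow Q * 6 powr ?a * B + secondary_pow Q * 6 powr ?a * B"
      using B(1) primary_pow secondary_pow by simp
    fix m wp ws c z t
    assume A: "admissible m" "0 \<le> t"
      and may: "secondary_may Q m wp c (nat \<lfloor>t / secondary_slot_len Q\<rfloor>)"
      and z: "\<bar>fst (cell_of (secondary_cells Q m) z) - fst c\<bar> \<le> 1"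
      "\<bar>snd (cell_of (secondary_cells Q m) z) - snd c\<bar> \<le> 1"
    note q = admissible_pos[OF A(1)]
    define Sp where "Sp = {p \<in> grid (primary_cells Q m).
              transmitting (primary_cells Q m) wp tdma_active p (nat \<lfloor>t / slot_len Q\<rfloor>)}"
    define Ss where "Ss = {c' \<in> grid (secondary_cells Q m). c' \<noteq> c \<and>
              transmitting (secondary_cells Q m) ws (secondary_may Q m wp) c'
                (nat \<lfloor>t / secondary_slot_len Q\<rfloor>)}"
    have "(\<Sum>p\<in>Sp. primary_tx_power Q m *
        gain Q (dist (transmitter (primary_cells Q m) wp tdma_active (slot_len Q) p t) z)) \<le>
      (\<Sum>p\<in>Sp. primary_pow Q * 6 powr ?a * cell_gap p (cell_of (primary_cells Q m) z) powr (- ?a))"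
    proof (rule sum_mono)
      fix p assume p: "p \<in> Sp"
      let ?u = "transmitter (primary_cells Q m) wp tdma_active (slot_len Q) p t"
      have u: "cell_of (primary_cells Q m) ?u = p"
        using p by (auto simp: Sp_def intro: cell_of_transmitter)
      have "c \<notin> preservation_region Q m p"
        using may p unfolding secondary_may_def secondary_slot_div[OF A(2)] Sp_def by blast
      from outside_preservation_region[OF A(1) this u z]
      have "1 / 2 \<le> real (primary_cells Q m) * dist ?u z" .
      moreover have "of_int (max \<bar>fst p - fst (cell_of (primary_cells Q m) z)\<bar> \<bar>snd p - snd (cell_of (primary_cells Q m) z)\<bar>) - 1
          \<le> real (primary_cells Q m) * dist ?u z"
        using cell_gap_le_dist[of "primary_cells Q m" ?u z] u by simp
      ultimately have "cell_gap p (cell_of (primary_cells Q m) z) \<le> 6 * (real (primary_cells Q m) * dist ?u z)"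
        unfolding cell_gap_def by (simp add: max_def split: if_splits)
      from received_power_le[OF q(1) _ _ this] show "primary_tx_power Q m * gain Q (dist ?u z) \<le>
          primary_pow Q * 6 powr ?a * cell_gap p (cell_of (primary_cells Q m) z) powr (- ?a)"
        using primary_pow path_loss by (simp add: primary_tx_power_def primary_area_def gain_def)
    qed
    also have "\<dots> \<le> primary_pow Q * 6 powr ?a * B"
      unfolding sum_distrib_left[symmetric]
      using primary_pow by (intro mult_left_mono B(2)) (auto simp: Sp_def fin)
    finally have primary: "(\<Sum>p\<in>Sp. primary_tx_power Q m *
        gain Q (dist (transmitter (primary_cells Q m) wp tdma_active (slot_len Q) p t) z))
        \<le> primary_pow Q * 6 powr ?a * B" .
    have "(\<Sum>c'\<in>Ss. secondary_tx_power Q m * gain Q (dist (secondary_transmitter Q m wp ws c' t) z)) \<le>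
      (\<Sum>c'\<in>Ss. secondary_pow Q * 6 powr ?a * cell_gap c' c powr (- ?a))"
    proof (rule sum_mono)
      fix c' assume c': "c' \<in> Ss"
      let ?u = "secondary_transmitter Q m wp ws c' t"
      have u: "cell_of (secondary_cells Q m) ?u = c'"
        using c' unfolding secondary_transmitter_def by (auto simp: Ss_def intro: cell_of_transmitter)
      have "tdma_active c' (nat \<lfloor>t / secondary_slot_len Q\<rfloor>)" "tdma_active c (nat \<lfloor>t / secondary_slot_len Q\<rfloor>)"
        using c' may by (auto simp: Ss_def transmitting_def secondary_may_def)
      then have gap: "5 \<le> max \<bar>fst c' - fst c\<bar> \<bar>snd c' - snd c\<bar>"
        using c' by (intro same_tdma_slot) (auto simp: Ss_def)
      have "max \<bar>fst c' - fst c\<bar> \<bar>snd c' - snd c\<bar> \<le>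
          max \<bar>fst c' - fst (cell_of (secondary_cells Q m) z)\<bar> \<bar>snd c' - snd (cell_of (secondary_cells Q m) z)\<bar> + 1"
        using z by linarith
      \<comment> \<open>From the gap of at least 5, one is lost because the receiver may be in a
        neighbouring cell and one in passing from cells to points.\<close>
      then have "of_int (max \<bar>fst c' - fst c\<bar> \<bar>snd c' - snd c\<bar>) - 2 \<le> real (secondary_cells Q m) * dist ?u z"
        using cell_gap_le_dist[of "secondary_cells Q m" ?u z] u by simp linarith
      moreover have "(5::real) \<le> of_int (max \<bar>fst c' - fst c\<bar> \<bar>snd c' - snd c\<bar>)"
        using gap by linarith
      ultimately have "cell_gap c' c \<le> 6 * (real (secondary_cells Q m) * dist ?u z)"
        unfolding cell_gap_def by linarith
      from received_power_le[OF q(2) _ _ this] show "secondary_tx_power Q m * gain Q (dist ?u z) \<le>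
          secondary_pow Q * 6 powr ?a * cell_gap c' c powr (- ?a)"
        using secondary_pow path_loss by (simp add: secondary_tx_power_def secondary_area_def gain_def)
    qed
    also have "\<dots> \<le> secondary_pow Q * 6 powr ?a * B"
      unfolding sum_distrib_left[symmetric]
      using secondary_pow by (intro mult_left_mono B(2)) (auto simp: Ss_def fin)
    finally have secondary: "(\<Sum>c'\<in>Ss. secondary_tx_power Q m * gain Q (dist (secondary_transmitter Q m wp ws c' t) z))
        \<le> secondary_pow Q * 6 powr ?a * B" .
    show "interference Q m wp ws c z t \<le> primary_pow Q * 6 powr ?a * B + secondary_pow Q * 6 powr ?a * B"
      unfolding interference_def Sp_def[symmetric] Ss_def[symmetric]
      using primary secondary by (rule add_mono)
  qed
qed

text \<open>The preservation regions that contain a given secondary cell belong to primary cells in at most four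
  consecutive columns, so one of the five residues modulo 5 of active columns leaves the cell free.\<close>

lemma secondary_may_periodic_access:
  assumes "admissible m"
  shows "periodic_access (secondary_may Q m wp) 625"
proof
  show "secondary_may Q m wp c (v + 625) \<longleftrightarrow> secondary_may Q m wp c v" for c v
  proof -
    \<comment> \<open>The frame number enters the primary activity only modulo 25, so 25 frames of
      25 secondary slots form a period.\<close>
    have "(v + 625) mod 25 = v mod 25"
      using mod_mult_self1[of v 25 25] by simp
    moreover have "(v + 625) div 25 = v div 25 + 25" "(v div 25 + 25) mod 25 = v div 25 mod 25"
      using div_mult_self1[of 25 v 25] by simp_all
    ultimately show ?thesis
      by (simp only: secondary_may_def transmitting_def tdma_active_def)
  qed
  show "\<exists>v. secondary_may Q m wp c v" for c
  proof -
    define r where "r = sqrt (primary_area Q m / secondary_area Q m)"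
    have r: "4 \<le> r"
      using assms by (simp add: r_def sqrt_area_ratio admissible_def pos_le_divide_eq)
    \<comment> \<open>The two inequalities for the region force \<open>fst p\<close> strictly
      between \<open>g - 5\<close> and \<open>g\<close>, hence not congruent to \<open>g\<close>
      modulo 5. Primary slots numbered below 5 belong to row residue 0, so exactly columns congruent
      to \<open>g\<close> can be active in slot \<open>V\<close>.\<close>
    define g where "g = \<lceil>(of_int (fst c) + 1) / r\<rceil> + 1"
    define V where "V = nat (g mod 5)"
    define W where "W = nat (5 * (snd c mod 5) + fst c mod 5)"
    have W: "W < 25" "int W = 5 * (snd c mod 5) + fst c mod 5"
      unfolding W_def by (simp_all add: nat_less_iff)
    have V: "V < 25" "int V = g mod 5" unfolding V_def by simp_all
    have "c \<notin> preservation_region Q m p"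
      if "transmitting (primary_cells Q m) wp tdma_active p V" for p
    proof
      assume in_region: "c \<in> preservation_region Q m p"
      have "g mod 5 = 5 * (snd p mod 5) + fst p mod 5"
        using that V by (simp add: transmitting_def tdma_active_def)
      moreover from this have "snd p mod 5 = 0"
        using pos_mod_bound[of 5 g] pos_mod_sign[of 5 "fst p"] pos_mod_sign[of 5 "snd p"] by linarith
      ultimately have "fst p mod 5 = g mod 5" by simp
      then have "5 dvd g - fst p" by (subst dvd_diff_commute) (simp add: mod_eq_dvd_iff)
      have c: "\<lfloor>r * of_int (fst p - 1)\<rfloor> \<le> fst c"
        "fst c < \<lfloor>r * of_int (fst p - 1)\<rfloor> + (\<lfloor>3 * r\<rfloor> + 2)"
        using in_region
        by (auto simp: preservation_region_def preservation_width_def Let_def r_def)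
      define X where "X = r * (of_int (fst p) - 1)"
      have X: "r * of_int (fst p - 1) = X" by (simp add: X_def)
      from c(1) have "r * (of_int (fst p) - 1) < of_int (fst c) + 1"
        unfolding X X_def[symmetric] by linarith
      then have "of_int (fst p) - 1 < (of_int (fst c) + 1) / r"
        using r by (simp add: pos_less_divide_eq mult.commute)
      then have "fst p < g" unfolding g_def by linarith
      from c(2) have "of_int (fst c) < r * (of_int (fst p) - 1) + 3 * r + 2"
        unfolding X X_def[symmetric] by linarith
      then have "(of_int (fst c) + 1) / r < (r * (of_int (fst p) - 1) + 3 * r + 3) / r"
        using r by (intro divide_strict_right_mono) auto
      also have "\<dots> = of_int (fst p) + 2 + 3 / r"
        using r by (simp add: field_simps)
      also have "3 / r \<le> 1" using r by simp
      finally have "g < fst p + 5" unfolding g_def by linarith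
      with \<open>fst p < g\<close> \<open>5 dvd g - fst p\<close> show False
        using zdvd_not_zless[of "g - fst p" 5] by simp
    qed
    \<comment> \<open>Frame \<open>V\<close>, and in it the position \<open>W\<close> that the round
      robin assigns to \<open>c\<close>.\<close>
    then have "secondary_may Q m wp c (25 * V + W)"
      using W by (simp add: secondary_may_def tdma_active_def)
    then show ?thesis ..
  qed
qed simp

end

section \<open>Rate and capacity of a packet slot\<close>

lemma slot_integral_bounds:
  fixes f :: "real \<Rightarrow> real"
  assumes f: "f \<in> borel_measurable borel" and "a \<le> b"
    and bounds: "\<And>t. a \<le> t \<Longrightarrow> t < b \<Longrightarrow> lo \<le> f t \<and> f t \<le> hi"
  shows "lo * (b - a) \<le> integral {a..b} f" "integral {a..b} f \<le> hi * (b - a)"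
proof -
  \<comment> \<open>At the right end point the next packet slot has already begun and nothing is
    known about \<open>f\<close>; changing this single value leaves the integral unchanged.\<close>
  define g where "g t = (if t = b then lo else f t)" for t
  have g: "g \<in> borel_measurable borel" unfolding g_def using f by measurable
  have eq: "integral {a..b} f = integral {a..b} g"
    by (rule integral_spike[of "{b}"]) (auto simp: g_def)
  have gl: "lo \<le> g t" if "t \<in> {a..b}" for t
    using bounds[of t] that by (auto simp: g_def)
  have gh: "g t \<le> max lo hi" if "t \<in> {a..b}" for t
    using bounds[of t] that by (auto simp: g_def max_def)
  have int: "g integrable_on {a..b}"
  proof (rule measurable_bounded_by_integrable_imp_integrable_real)
    show "g \<in> borel_measurable (lebesgue_on {a..b})"
      using g by (intro measurable_restrict_space1) (simp add: measurable_completion)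
    show "(\<lambda>_. max \<bar>lo\<bar> \<bar>max lo hi\<bar>) integrable_on {a..b}" by (rule integrable_const_ivl)
    show "\<bar>g t\<bar> \<le> max \<bar>lo\<bar> \<bar>max lo hi\<bar>" if "t \<in> {a..b}" for t
      using gl[OF that] gh[OF that] by linarith
  qed simp
  have "integral {a..b} (\<lambda>_. lo) \<le> integral {a..b} g"
    using int gl by (intro integral_le) auto
  then show "lo * (b - a) \<le> integral {a..b} f"
    unfolding eq using \<open>a \<le> b\<close> by (simp add: mult.commute)
  show "integral {a..b} f \<le> hi * (b - a)"
  proof (cases "a = b")
    case False
    then have "lo \<le> hi" using bounds[of a] \<open>a \<le> b\<close> by auto
    then have "integral {a..b} g \<le> integral {a..b} (\<lambda>_. hi)"
      using int gh by (intro integral_le) (auto simp: max_def)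
    then show ?thesis unfolding eq using \<open>a \<le> b\<close> by (simp add: mult.commute)
  qed simp
qed

text \<open>Transmitters change with time only through the slot number and the index of the packet
  slot, both of which are measurable with countably many values.\<close>

lemma measurable_slot_function:
  fixes F :: "nat \<Rightarrow> nat \<Rightarrow> real" and s :: real
  shows "(\<lambda>t. F (nat \<lfloor>t / s\<rfloor>) (nat \<lfloor>frac (t / s) * real L\<rfloor>)) \<in> borel_measurable borel"
proof -
  have 1: "(\<lambda>t. nat \<lfloor>t / s\<rfloor>) \<in> borel \<rightarrow>\<^sub>M count_space UNIV"
    by (rule measurable_compose[where g = nat]) measurable
  have 2: "(\<lambda>t. nat \<lfloor>frac (t / s) * real L\<rfloor>) \<in> borel \<rightarrow>\<^sub>M count_space UNIV"
    unfolding frac_def by (rule measurable_compose[where g = nat]) measurable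
  have "(\<lambda>t. F n (nat \<lfloor>frac (t / s) * real L\<rfloor>)) \<in> borel_measurable borel" for n
    by (rule measurable_compose[OF 2]) simp
  from measurable_compose_countable[OF this 1] show ?thesis by simp
qed

text \<open>The transmitter of \<open>c\<close> during the packet slot of pair \<open>i\<close> in
  slot \<open>v\<close>; unlike \<open>transmitter\<close> it is free of the continuous
  time.\<close>

definition slot_transmitter :: "nat \<Rightarrow> config \<Rightarrow> (cell \<Rightarrow> nat \<Rightarrow> bool) \<Rightarrow> cell \<Rightarrow> nat \<Rightarrow> nat \<Rightarrow> point" where
  "slot_transmitter q w may c i v = (if i \<in> originating q w c then src w i else relay q w may c v)"

lemma transmitter_eq:
  "transmitter q w may s c t = slot_transmitter q w may c
     (packet_slots q w c ! nat \<lfloor>frac (t / s) * real (length (packet_slots q w c))\<rfloor>) (nat \<lfloor>t / s\<rfloor>)"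
  by (simp add: transmitter_def slot_transmitter_def Let_def)

text \<open>Inverts \<open>packet_time\<close>: inside the half-open interval the floors in
  \<open>transmitter\<close> recover the slot \<open>v\<close> and the index of pair
  \<open>i\<close>.\<close>

lemma packet_slot_interval:
  assumes "0 < s" "i \<in> set (packet_slots q w c)"
    "packet_time q w s c i v 0 \<le> t" "t < packet_time q w s c i v 1"
  shows "nat \<lfloor>t / s\<rfloor> = v" "0 \<le> t" "transmitter q w may s c t = slot_transmitter q w may c i v"
proof -
  define L where "L = length (packet_slots q w c)"
  define k where "k = slot_index q w c i"
  have k: "k < L" "packet_slots q w c ! k = i"
    using slot_index_props[OF assms(2)] by (simp_all add: L_def k_def)
  have L: "0 < real L" using k by simp
  have lo: "real v + real k / real L \<le> t / s"
    using assms(1,3) by (simp add: packet_time_def pos_le_divide_eq mult.commute flip: L_def k_def)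
  have hi: "t / s < real v + (real k + 1) / real L"
    using assms(1,4) by (simp add: packet_time_def pos_divide_less_eq mult.commute add.commute flip: L_def k_def)
  have "(real k + 1) / real L \<le> 1" "0 \<le> real k / real L" using k L by (simp_all add: divide_le_eq_1)
  then have fl: "\<lfloor>t / s\<rfloor> = int v" using lo hi by linarith
  then show 1: "nat \<lfloor>t / s\<rfloor> = v" by simp
  have "0 \<le> t / s" using lo \<open>0 \<le> real k / real L\<close> by linarith
  then show "0 \<le> t" using assms(1) by (simp add: zero_le_divide_iff)
  have fr: "frac (t / s) = t / s - real v" using fl by (simp add: frac_def)
  have "real k \<le> frac (t / s) * real L" "frac (t / s) * real L < real k + 1"
    using lo hi L by (simp_all add: fr field_simps)
  then have "\<lfloor>frac (t / s) * real L\<rfloor> = int k" by linarith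
  then show "transmitter q w may s c t = slot_transmitter q w may c i v"
    by (simp add: transmitter_eq 1 k flip: L_def)
qed

lemma packet_time_diff:
  "packet_time q w s c i v 1 - packet_time q w s c i v 0 = s / real (length (packet_slots q w c))"
  by (simp add: packet_time_def algebra_simps add_divide_distrib)

lemma cell_of_slot_transmitter:
  assumes "nodes_in q w c \<noteq> []"
  shows "cell_of q (slot_transmitter q w may c i v) = c"
  using cell_of_relay[OF assms] by (auto simp: slot_transmitter_def originating_def)

lemma dist_le_of_cells:
  fixes u z :: point
  assumes "0 < q" "\<bar>fst (cell_of q u) - fst (cell_of q z)\<bar> \<le> 1" "\<bar>snd (cell_of q u) - snd (cell_of q z)\<bar> \<le> 1"
  shows "real q * dist u z \<le> 4"
proof -
  have "\<bar>real q * fst u - real q * fst z\<bar> \<le> 2" "\<bar>real q * snd u - real q * snd z\<bar> \<le> 2"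
    using assms(2,3) unfolding cell_of_def fst_conv snd_conv by linarith+
  then have "real q * \<bar>fst u - fst z\<bar> \<le> 2" "real q * \<bar>snd u - snd z\<bar> \<le> 2"
    by (simp_all add: abs_mult flip: right_diff_distrib)
  moreover have "dist u z \<le> \<bar>fst u - fst z\<bar> + \<bar>snd u - snd z\<bar>"
    using sqrt_sum_squares_le_sum_abs[of "fst u - fst z" "snd u - snd z"]
    by (simp add: dist_prod_def dist_real_def)
  then have "real q * dist u z \<le> real q * (\<bar>fst u - fst z\<bar> + \<bar>snd u - snd z\<bar>)"
    by (intro mult_left_mono) auto
  ultimately show ?thesis by (simp add: distrib_left)
qed

lemma cell_of_receiver:
  assumes "k < cell_dist (cell_of q (src w i)) (cell_of q (dst w i))"
    and "Suc k < hops q w i \<Longrightarrow> nodes_in q w (path q w i (Suc k)) \<noteq> []"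
  shows "cell_of q (receiver q w may i k v) = path q w i (Suc k)"
proof (cases "Suc k < hops q w i")
  case True
  then show ?thesis using assms(2) by (simp add: receiver_def cell_of_relay)
next
  case False
  then have "Suc k = cell_dist (cell_of q (src w i)) (cell_of q (dst w i))"
    using assms(1) by (simp add: hops_def)
  then show ?thesis
    using False route_cell_dist[of "cell_of q (src w i)" "cell_of q (dst w i)"]
    by (simp add: receiver_def path_def)
qed

text \<open>Every hop of a path between different cells moves to an adjacent cell, so transmitter
  and receiver share a cell only in the direct transmission from source to destination. This third
  claim is what excludes distance 0.\<close>

lemma receiver_cell:
  assumes "k < hops q w i" "Suc k < hops q w i \<Longrightarrow> nodes_in q w (path q w i (Suc k)) \<noteq> []"
  shows "\<bar>fst (cell_of q (receiver q w may i k v)) - fst (path q w i k)\<bar> \<le> 1"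
    and "\<bar>snd (cell_of q (receiver q w may i k v)) - snd (path q w i k)\<bar> \<le> 1"
    and "cell_of q (receiver q w may i k v) = path q w i k \<Longrightarrow>
      cell_of q (src w i) = path q w i k \<and> receiver q w may i k v = dst w i"
proof -
  let ?c = "cell_of q (src w i)" and ?c' = "cell_of q (dst w i)"
  let ?z = "cell_of q (receiver q w may i k v)"
  consider "?z = path q w i (Suc k)" "k < cell_dist ?c ?c'"
    | "?z = path q w i k" "path q w i k = ?c" "receiver q w may i k v = dst w i"
  proof (cases "k < cell_dist ?c ?c'")
    case True
    then show ?thesis using cell_of_receiver[OF True assms(2)] by (rule that(1)[rotated])
  next
    case False
    then have 0: "k = 0" "cell_dist ?c ?c' = 0" using assms(1) by (auto simp: hops_def)
    then have "?c' = ?c" using route_cell_dist[of ?c ?c'] by simp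
    then show ?thesis using 0 by (intro that(2)) (simp_all add: receiver_def path_0 hops_def)
  qed
  then have "\<bar>fst ?z - fst (path q w i k)\<bar> \<le> 1 \<and> \<bar>snd ?z - snd (path q w i k)\<bar> \<le> 1 \<and>
    (?z = path q w i k \<longrightarrow> ?c = path q w i k \<and> receiver q w may i k v = dst w i)"
  proof cases
    case 1
    then show ?thesis
    proof -
      have "\<bar>fst ?z - fst (path q w i k)\<bar> + \<bar>snd ?z - snd (path q w i k)\<bar> = 1"
        using route_step[OF 1(2)] unfolding path_def 1(1) .
      then show ?thesis by auto
    qed
  qed simp
  then show "\<bar>fst ?z - fst (path q w i k)\<bar> \<le> 1" "\<bar>snd ?z - snd (path q w i k)\<bar> \<le> 1"
    "?z = path q w i k \<Longrightarrow> ?c = path q w i k \<and> receiver q w may i k v = dst w i"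
    by auto
qed

lemma slot_transmitter_neq_receiver:
  assumes "i < num_pairs w" "k < hops q w i" "Suc k < hops q w i \<Longrightarrow> nodes_in q w (path q w i (Suc k)) \<noteq> []"
    "nodes_in q w (path q w i k) \<noteq> []" "src w i \<noteq> dst w i"
  shows "slot_transmitter q w may (path q w i k) i v \<noteq> receiver q w may i k v"
proof
  assume eq: "slot_transmitter q w may (path q w i k) i v = receiver q w may i k v"
  then have "cell_of q (receiver q w may i k v) = path q w i k"
    using cell_of_slot_transmitter[OF assms(4), of may i v] by simp
  from receiver_cell(3)[OF assms(2,3) this]
  have "cell_of q (src w i) = path q w i k" "receiver q w may i k v = dst w i" by auto
  then show False
    using eq assms(1,5) by (simp add: slot_transmitter_def originating_def)
qed

context overlay_params
begin

abbreviation sslot :: real where "sslot \<equiv> secondary_slot_len Q"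

lemma sslot_pos: "0 < sslot"
  using slot_len by (simp add: secondary_slot_len_def)

lemma measurable_transmitter_gain:
  "(\<lambda>t. gain Q (dist (transmitter q w may s c t) z)) \<in> borel_measurable borel"
  unfolding transmitter_eq by (rule measurable_slot_function)

text \<open>The index sets of the sums in \<open>interference\<close> vary with the slot; written
  with a condition inside each summand, the sums range over fixed finite grids.\<close>

lemma measurable_at_slot:
  fixes s :: real
  assumes "g \<in> borel_measurable borel"
  shows "(\<lambda>t. if R (nat \<lfloor>t / s\<rfloor>) then g t else (0::real)) \<in> borel_measurable borel"
proof -
  have "(\<lambda>t. g t * (if R (nat \<lfloor>t / s\<rfloor>) then 1 else 0)) \<in> borel_measurable borel"
    using measurable_slot_function[of "\<lambda>n _. if R n then 1 else 0" s 0]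
    by (intro borel_measurable_times assms)
  moreover have "g t * (if R (nat \<lfloor>t / s\<rfloor>) then 1 else 0) = (if R (nat \<lfloor>t / s\<rfloor>) then g t else 0)" for t
    by simp
  ultimately show ?thesis by simp
qed

lemma measurable_interference: "interference Q m wp ws c z \<in> borel_measurable borel"
proof -
  have fin: "finite (grid q)" for q by (simp add: grid_def)
  have eq: "interference Q m wp ws c z = (\<lambda>t.
    (\<Sum>p \<in> grid (primary_cells Q m).
        if transmitting (primary_cells Q m) wp tdma_active p (nat \<lfloor>t / slot_len Q\<rfloor>) then
        primary_tx_power Q m *
        gain Q (dist (transmitter (primary_cells Q m) wp tdma_active (slot_len Q) p t) z) else 0) +
     (\<Sum>c' \<in> grid (secondary_cells Q m). if c' \<noteq> c \<and>
              transmitting (secondary_cells Q m) ws (secondary_may Q m wp) c'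
                (nat \<lfloor>t / secondary_slot_len Q\<rfloor>) then
        secondary_tx_power Q m * gain Q (dist (transmitter (secondary_cells Q m) ws (secondary_may Q m wp) sslot c' t) z)
        else 0))"
    unfolding interference_def secondary_transmitter_def by (subst (1 2) sum.inter_filter[OF fin]) (rule refl)
  show ?thesis
    unfolding eq
    by (intro borel_measurable_add borel_measurable_sum measurable_at_slot
        measurable_at_slot[where R = "\<lambda>n. c' \<noteq> c \<and> transmitting (secondary_cells Q m) ws (secondary_may Q m wp) c' n" for c']
        borel_measurable_times borel_measurable_const measurable_transmitter_gain)
qed

lemma measurable_secondary_rate: "secondary_rate Q m wp ws c z \<in> borel_measurable borel"
proof -
  note [measurable] = measurable_interference
  have [measurable]: "(\<lambda>t. gain Q (dist (secondary_transmitter Q m wp ws c t) z)) \<in> borel_measurable borel"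
    unfolding secondary_transmitter_def by (rule measurable_transmitter_gain)
  show ?thesis unfolding secondary_rate_def[abs_def] by measurable
qed

text \<open>During one packet slot both end points of the link are fixed, so the signal
  \<open>S\<close> is constant and only the interference varies. Replacing it by 0 or by its bound
  \<open>B\<close> leaves a constant rate times the length of the packet slot.\<close>

lemma slot_capacity_bounds:
  fixes m i k v ws wp
  defines "q \<equiv> secondary_cells Q m"
  defines "may \<equiv> secondary_may Q m wp"
  defines "c \<equiv> path q ws i k"
  defines "z \<equiv> receiver q ws may i k v"
  defines "S \<equiv> secondary_tx_power Q m * gain Q (dist (slot_transmitter q ws may c i v) z)"
  assumes "i < num_pairs ws" "k < hops q ws i"
  shows "slot_capacity Q m wp ws i k v \<le> ln (1 + S / noise Q) * (sslot / real (length (packet_slots q ws c)))"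
    and "\<lbrakk>\<And>t. 0 \<le> t \<Longrightarrow> nat \<lfloor>t / sslot\<rfloor> = v \<Longrightarrow> interference Q m wp ws c z t \<le> B\<rbrakk> \<Longrightarrow>
      ln (1 + S / (noise Q + B)) * (sslot / real (length (packet_slots q ws c))) \<le> slot_capacity Q m wp ws i k v"
proof -
  have i: "i \<in> set (packet_slots q ws c)"
    unfolding c_def using assms(6,7) by (rule in_packet_slots)
  let ?a = "packet_time q ws sslot c i v 0" and ?b = "packet_time q ws sslot c i v 1"
  have len: "0 < length (packet_slots q ws c)" using i by (auto simp del: set_packet_slots)
  have ab: "?a \<le> ?b"
    using packet_time_diff[of q ws sslot c i v] sslot_pos
    by (metis diff_ge_0_iff_ge divide_nonneg_nonneg less_imp_le of_nat_0_le_iff)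
  have cap: "slot_capacity Q m wp ws i k v = integral {?a..?b} (secondary_rate Q m wp ws c z)"
    by (simp add: slot_capacity_def Let_def q_def may_def c_def z_def)
  have S0: "0 \<le> S"
    using secondary_pow unfolding S_def by (simp add: secondary_tx_power_def gain_def)
  have rate: "secondary_rate Q m wp ws c z t = ln (1 + S / (noise Q + interference Q m wp ws c z t))"
    and time: "nat \<lfloor>t / sslot\<rfloor> = v" "0 \<le> t" if "?a \<le> t" "t < ?b" for t
    using packet_slot_interval[OF sslot_pos i that]
    by (simp_all add: secondary_rate_def secondary_transmitter_def S_def q_def may_def)
  have hi: "ln (1 + S / (noise Q + I)) \<le> ln (1 + S / noise Q)" "0 \<le> ln (1 + S / (noise Q + I))"
    if "0 \<le> I" for I
  proof -
    have "S / (noise Q + I) \<le> S / noise Q" "0 \<le> S / (noise Q + I)"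
      using S0 that noise by (auto intro!: divide_left_mono mult_pos_pos)
    then show "ln (1 + S / (noise Q + I)) \<le> ln (1 + S / noise Q)" "0 \<le> ln (1 + S / (noise Q + I))"
      by auto
  qed
  have up: "0 \<le> secondary_rate Q m wp ws c z t \<and> secondary_rate Q m wp ws c z t \<le> ln (1 + S / noise Q)"
    if "?a \<le> t" "t < ?b" for t
    unfolding rate[OF that] using hi[OF interference_nonneg] by simp
  from slot_integral_bounds(2)[OF measurable_secondary_rate ab up]
  show "slot_capacity Q m wp ws i k v \<le> ln (1 + S / noise Q) * (sslot / real (length (packet_slots q ws c)))"
    unfolding cap packet_time_diff .
  assume B: "\<And>t. 0 \<le> t \<Longrightarrow> nat \<lfloor>t / sslot\<rfloor> = v \<Longrightarrow> interference Q m wp ws c z t \<le> B"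
  have "ln (1 + S / (noise Q + B)) \<le> secondary_rate Q m wp ws c z t \<and> secondary_rate Q m wp ws c z t \<le> ln (1 + S / noise Q)"
    if t: "?a \<le> t" "t < ?b" for t
  proof
    have I: "0 \<le> interference Q m wp ws c z t" "interference Q m wp ws c z t \<le> B"
      using interference_nonneg B time[OF t] by auto
    have "S / (noise Q + B) \<le> S / (noise Q + interference Q m wp ws c z t)"
      using I noise S0 by (intro divide_left_mono mult_pos_pos) auto
    moreover have "0 \<le> S / (noise Q + B)" using S0 I noise by simp
    ultimately show "ln (1 + S / (noise Q + B)) \<le> secondary_rate Q m wp ws c z t"
      unfolding rate[OF t] by (subst ln_le_cancel_iff) auto
  qed (use up[OF t] in blast)
  from slot_integral_bounds(1)[OF measurable_secondary_rate ab this]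
  show "ln (1 + S / (noise Q + B)) * (sslot / real (length (packet_slots q ws c))) \<le> slot_capacity Q m wp ws i k v"
    unfolding cap packet_time_diff .
qed

lemma received_power_eq:
  assumes "0 < secondary_cells Q m" "0 < d"
  shows "secondary_tx_power Q m * gain Q d = secondary_pow Q * (real (secondary_cells Q m) * d) powr (- path_loss Q)"
proof -
  let ?q = "real (secondary_cells Q m)"
  have "(1 / ?q\<^sup>2) powr (path_loss Q / 2) = (?q powr (- 2)) powr (path_loss Q / 2)"
    using assms(1) by (simp add: powr_minus_divide)
  then have "(1 / ?q\<^sup>2) powr (path_loss Q / 2) = ?q powr (- path_loss Q)"
    by (simp add: powr_powr)
  then show ?thesis
    using assms by (simp add: secondary_tx_power_def secondary_area_def gain_def powr_mult)
qed

section \<open>From slot capacities to throughput\<close>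

lemma liminf_delivered_le:
  assumes "admissible m" "0 < l"
  shows "liminf (\<lambda>t. ereal (delivered_bits Q m wp ws l i t / real t)) \<le> ereal l"
proof -
  interpret periodic_access "secondary_may Q m wp" 625
    by (rule secondary_may_periodic_access[OF assms(1)])
  have "liminf (\<lambda>t. ereal (delivered_bits Q m wp ws l i t / real t)) \<le>
      limsup (\<lambda>t. ereal (delivered_bits Q m wp ws l i t / real t))"
    by (rule Liminf_le_Limsup) simp
  also have "\<dots> \<le> ereal l"
  proof (rule Limsup_bounded, rule eventually_mono[OF eventually_gt_at_top[of 0]])
    fix t :: nat assume "0 < t"
    then show "ereal (delivered_bits Q m wp ws l i t / real t) \<le> ereal l"
      using card_hop_slot_less assms(2)
      by (simp add: delivered_bits_def Let_def pos_divide_le_eq mult_left_mono)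
  qed
  finally show ?thesis .
qed

text \<open>A positive rate requires some packet to succeed on its first hop, so the packet size is
  at most the capacity there. The rate cannot exceed the packet size, as at most one packet departs
  per slot.\<close>

lemma throughput_le_capacity:
  assumes "admissible m" "0 < l" "0 < lam"
    and lam: "ereal lam \<le> liminf (\<lambda>t. ereal (delivered_bits Q m wp ws l i t / real t))"
    and cap: "\<And>v. slot_capacity Q m wp ws i 0 v \<le> C"
  shows "lam \<le> C"
proof -
  interpret periodic_access "secondary_may Q m wp" 625
    by (rule secondary_may_periodic_access[OF assms(1)])
  let ?q = "secondary_cells Q m"
  have "\<exists>j. success Q m wp ws l i 0 (hop_slot ?q ws (secondary_may Q m wp) i j 0)"
  proof (rule ccontr)
    assume "\<not> ?thesis"
    then have none: "{j. R j \<and> (\<forall>k < hops ?q ws i. success Q m wp ws l i k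
        (hop_slot ?q ws (secondary_may Q m wp) i j k))} = {}" for R
      using hops_pos[of ?q ws i] by blast
    have "delivered_bits Q m wp ws l i t = 0" for t
      unfolding delivered_bits_def Let_def none by simp
    then show False using lam assms(3) by (simp add: Liminf_const)
  qed
  then obtain j where j: "success Q m wp ws l i 0 (hop_slot ?q ws (secondary_may Q m wp) i j 0)" ..
  let ?J = "{j'. hop_slot ?q ws (secondary_may Q m wp) i j' 0 = hop_slot ?q ws (secondary_may Q m wp) i j 0}"
  have "0 < card ?J"
    using finite_hop_slot_eq by (subst card_gt_0_iff) blast
  then have "l * 1 \<le> l * real (card ?J)"
    using assms(2) by (intro mult_left_mono) auto
  also have "\<dots> \<le> slot_capacity Q m wp ws i 0 (hop_slot ?q ws (secondary_may Q m wp) i j 0)"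
    using j by (simp only: success_def Let_def)
  also have "\<dots> \<le> C" by (rule cap)
  finally have "l \<le> C" by simp
  moreover have "ereal lam \<le> ereal l"
    using lam liminf_delivered_le[OF assms(1,2)] by (rule order_trans)
  ultimately show ?thesis by simp
qed

text \<open>The number 625 enters twice: a packet slot may have to carry as many accumulated packets
  of its pair, and a source may be allowed to send only once in as many slots.\<close>

lemma throughput_ge:
  assumes "admissible m" "0 < l"
    and success: "\<And>k v. \<lbrakk>k < hops (secondary_cells Q m) ws i; secondary_may Q m wp (path (secondary_cells Q m) ws i k) v\<rbrakk>
      \<Longrightarrow> nodes_in (secondary_cells Q m) ws (path (secondary_cells Q m) ws i k) \<noteq> [] \<and>
        625 * l \<le> slot_capacity Q m wp ws i k v"
  shows "ereal (l / 625) \<le> liminf (\<lambda>t. ereal (delivered_bits Q m wp ws l i t / real t))"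
proof -
  interpret periodic_access "secondary_may Q m wp" 625
    by (rule secondary_may_periodic_access[OF assms(1)])
  let ?q = "secondary_cells Q m"
  let ?h = "hops ?q ws i - 1"
  have suc: "success Q m wp ws l i k (hop_slot ?q ws (secondary_may Q m wp) i j k)" if "k < hops ?q ws i" for k j
  proof -
    let ?v = "hop_slot ?q ws (secondary_may Q m wp) i j k"
    have "l * real (card {j. hop_slot ?q ws (secondary_may Q m wp) i j k = ?v}) \<le> l * 625"
      using card_hop_slot_eq[of ?q ws i k ?v] assms(2) by (intro mult_left_mono) simp_all
    with success[OF that hop_slot_may, of j] show ?thesis
      unfolding success_def Let_def by (simp add: mult.commute del: hop_slot.simps)
  qed
  have lower: "l * (real t / 625 - real ?h - 2) \<le> delivered_bits Q m wp ws l i t" for t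
    using card_hop_slot_ge[of t ?h ?q ws i] suc assms(2)
    by (simp add: delivered_bits_def Let_def)
  have "(\<lambda>t. ereal (l * (1 / 625 - (real ?h + 2) / real t))) \<longlonglongrightarrow> ereal (l * (1 / 625 - 0))"
    by (intro tendsto_intros lim_const_over_n)
  then have "ereal (l / 625) = liminf (\<lambda>t. ereal (l * (1 / 625 - (real ?h + 2) / real t)))"
    using lim_imp_Liminf[OF sequentially_bot] by force
  also have "\<dots> \<le> liminf (\<lambda>t. ereal (delivered_bits Q m wp ws l i t / real t))"
  proof (rule Liminf_mono, rule eventually_mono[OF eventually_gt_at_top[of 0]])
    fix t :: nat assume t: "0 < t"
    have "l * (1 / 625 - (real ?h + 2) / real t) = l * (real t / 625 - real ?h - 2) / real t"
      using t by (simp add: field_simps)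
    also have "\<dots> \<le> delivered_bits Q m wp ws l i t / real t"
      using lower by (intro divide_right_mono) auto
    finally show "ereal (l * (1 / 625 - (real ?h + 2) / real t)) \<le> ereal (delivered_bits Q m wp ws l i t / real t)"
      by simp
  qed
  finally show ?thesis .
qed

text \<open>\<open>rho\<close> is the slot length times the rate of a link of four cell sides, the
  longest possible estimate for adjacent cells, against the maximal interference. It is uniform in
  the density and in the configurations.\<close>

lemma slot_capacity_lower:
  obtains rho where "0 < rho"
    "\<And>m wp ws i k v. \<lbrakk>admissible m; i < num_pairs ws; k < hops (secondary_cells Q m) ws i;
      secondary_may Q m wp (path (secondary_cells Q m) ws i k) v; src ws i \<noteq> dst ws i;
      nodes_in (secondary_cells Q m) ws (path (secondary_cells Q m) ws i k) \<noteq> [];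
      Suc k < hops (secondary_cells Q m) ws i \<Longrightarrow>
        nodes_in (secondary_cells Q m) ws (path (secondary_cells Q m) ws i (Suc k)) \<noteq> []\<rbrakk>
     \<Longrightarrow> rho / real (length (packet_slots (secondary_cells Q m) ws (path (secondary_cells Q m) ws i k)))
       \<le> slot_capacity Q m wp ws i k v"
proof -
  from interference_bounded obtain B where B: "0 \<le> B"
    "\<And>m wp ws c z t. \<lbrakk>admissible m; 0 \<le> t; secondary_may Q m wp c (nat \<lfloor>t / sslot\<rfloor>);
      \<bar>fst (cell_of (secondary_cells Q m) z) - fst c\<bar> \<le> 1;
      \<bar>snd (cell_of (secondary_cells Q m) z) - snd c\<bar> \<le> 1\<rbrakk>
      \<Longrightarrow> interference Q m wp ws c z t \<le> B"
    by blast
  define S0 where "S0 = secondary_pow Q * 4 powr (- path_loss Q)"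
  have S0: "0 < S0" using secondary_pow by (simp add: S0_def)
  show thesis
  proof (rule that[of "ln (1 + S0 / (noise Q + B)) * sslot"])
    show "0 < ln (1 + S0 / (noise Q + B)) * sslot"
      using S0 B(1) noise sslot_pos by (intro mult_pos_pos ln_gt_zero) (auto simp: add_pos_nonneg)
    fix m wp ws i k v
    let ?q = "secondary_cells Q m"
    let ?may = "secondary_may Q m wp"
    let ?c = "path ?q ws i k"
    let ?z = "receiver ?q ws ?may i k v"
    let ?u = "slot_transmitter ?q ws ?may ?c i v"
    assume A: "admissible m" "i < num_pairs ws" "k < hops ?q ws i" "?may ?c v" "src ws i \<noteq> dst ws i"
      "nodes_in ?q ws ?c \<noteq> []"
      "Suc k < hops ?q ws i \<Longrightarrow> nodes_in ?q ws (path ?q ws i (Suc k)) \<noteq> []"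
    note q = admissible_pos(2)[OF A(1)]
    note z = receiver_cell(1,2)[where may = ?may and v = v, OF A(3,7)]
    have d: "0 < dist ?u ?z"
      using slot_transmitter_neq_receiver[OF A(2,3,7,6,5)] by simp
    have "real ?q * dist ?u ?z \<le> 4"
      using z by (intro dist_le_of_cells[OF q]) (simp_all add: cell_of_slot_transmitter[OF A(6)] abs_minus_commute)
    then have "4 powr (- path_loss Q) \<le> (real ?q * dist ?u ?z) powr (- path_loss Q)"
      using q d path_loss by (intro powr_mono2') auto
    then have S: "S0 \<le> secondary_tx_power Q m * gain Q (dist ?u ?z)"
      unfolding received_power_eq[OF q d] S0_def using secondary_pow by (intro mult_left_mono) auto
    have "ln (1 + S0 / (noise Q + B)) \<le> ln (1 + secondary_tx_power Q m * gain Q (dist ?u ?z) / (noise Q + B))"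
      using S S0 B(1) noise by (subst ln_le_cancel_iff) (auto intro!: divide_right_mono add_pos_nonneg)
    then have "ln (1 + S0 / (noise Q + B)) * (sslot / real (length (packet_slots ?q ws ?c))) \<le>
      ln (1 + secondary_tx_power Q m * gain Q (dist ?u ?z) / (noise Q + B)) * (sslot / real (length (packet_slots ?q ws ?c)))"
      using sslot_pos by (intro mult_right_mono) auto
    also have "\<dots> \<le> slot_capacity Q m wp ws i k v"
      using A(4) by (intro slot_capacity_bounds(2)[OF A(2,3)] B(2)[OF A(1)] z) auto
    finally show "ln (1 + S0 / (noise Q + B)) * sslot / real (length (packet_slots ?q ws ?c)) \<le> slot_capacity Q m wp ws i k v"
      by simp
  qed
qed

end

section \<open>Events of high probability\<close>

text \<open>\<open>whp\<close> asks for measurable subsets at every \<open>m\<close>, while the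
  facts about the networks hold only eventually; the empty set serves as default for the other
  \<open>m\<close>.\<close>

lemma whpI:
  assumes "\<And>m. prob_space (M m)" and "\<forall>\<^sub>F m in at_top. E m \<in> sets (M m)"
    and "\<forall>\<^sub>F m in at_top. measure (M m) (space (M m) - E m) \<le> g m" and g: "(g \<longlongrightarrow> 0) at_top"
  shows "whp M E"
  unfolding whp_def
proof (intro exI conjI allI)
  let ?A = "\<lambda>m. if E m \<in> sets (M m) then E m else {}"
  show "?A m \<in> sets (M m)" "?A m \<subseteq> E m" for m by auto
  show "((\<lambda>m. measure (M m) (?A m)) \<longlongrightarrow> 1) at_top"
  proof (rule tendsto_sandwich)
    show "\<forall>\<^sub>F m in at_top. 1 - g m \<le> measure (M m) (?A m)"
      using assms(2,3)
    proof eventually_elim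
      case (elim m)
      then show ?case using prob_space.prob_compl[OF assms(1), of "E m" m] by simp
    qed
    show "\<forall>\<^sub>F m in at_top. measure (M m) (?A m) \<le> 1"
      using prob_space.prob_le_1[OF assms(1)] by simp
    show "((\<lambda>m. 1 - g m) \<longlongrightarrow> 1) at_top"
      using tendsto_diff[OF tendsto_const g, of 1] by simp
  qed simp
qed

text \<open>The larger event need not be measurable. The event that all pairs reach a given rate is
  obtained in this way, from a typical event contained in it.\<close>

lemma whp_mono:
  assumes "whp M E" "\<forall>\<^sub>F m in at_top. E m \<subseteq> F m"
  shows "whp M F"
proof -
  from assms(1) obtain A where A: "\<And>m. A m \<in> sets (M m)" "\<And>m. A m \<subseteq> E m"
    "((\<lambda>m. measure (M m) (A m)) \<longlongrightarrow> 1) at_top"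
    unfolding whp_def by auto
  let ?A = "\<lambda>m. if A m \<subseteq> F m then A m else {}"
  have "\<forall>\<^sub>F m in at_top. measure (M m) (A m) = measure (M m) (?A m)"
    using assms(2) by (rule eventually_mono) (use A(2) in auto)
  with A(3) have "((\<lambda>m. measure (M m) (?A m)) \<longlongrightarrow> 1) at_top"
    using tendsto_cong by fast
  then show ?thesis
    unfolding whp_def using A(1) by (intro exI[of _ ?A]) auto
qed

lemma whp_Int:
  assumes M: "\<And>m. prob_space (M m)" and "whp M E" "whp M F"
  shows "whp M (\<lambda>m. E m \<inter> F m)"
proof -
  from assms(2) obtain A where A: "\<And>m. A m \<in> sets (M m)" "\<And>m. A m \<subseteq> E m"
    "((\<lambda>m. measure (M m) (A m)) \<longlongrightarrow> 1) at_top"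
    unfolding whp_def by auto
  from assms(3) obtain B where B: "\<And>m. B m \<in> sets (M m)" "\<And>m. B m \<subseteq> F m"
    "((\<lambda>m. measure (M m) (B m)) \<longlongrightarrow> 1) at_top"
    unfolding whp_def by auto
  have "whp M (\<lambda>m. A m \<inter> B m)"
  proof (rule whpI[OF M])
    show "((\<lambda>m. (1 - measure (M m) (A m)) + (1 - measure (M m) (B m))) \<longlongrightarrow> 0) at_top"
      using tendsto_add[OF tendsto_diff[OF tendsto_const A(3), of 1] tendsto_diff[OF tendsto_const B(3), of 1]]
      by simp
    show "\<forall>\<^sub>F m in at_top. measure (M m) (space (M m) - A m \<inter> B m) \<le>
        (1 - measure (M m) (A m)) + (1 - measure (M m) (B m))"
    proof (rule always_eventually, rule allI)
      fix m
      interpret prob_space "M m" by (rule M)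
      have "space (M m) - A m \<inter> B m = (space (M m) - A m) \<union> (space (M m) - B m)" by auto
      then show "measure (M m) (space (M m) - A m \<inter> B m) \<le> (1 - measure (M m) (A m)) + (1 - measure (M m) (B m))"
        using measure_Un_le[of "space (M m) - A m" "M m" "space (M m) - B m"] A(1) B(1)
        by (simp add: prob_compl)
    qed
  qed (use A(1) B(1) in auto)
  then show ?thesis by (rule whp_mono, intro always_eventually allI Int_mono A(2) B(2))
qed

lemma whp_AE:
  assumes M: "\<And>m. prob_space (M m)" and AE: "\<And>m. AE x in M m. P m x"
  shows "whp M (\<lambda>m. {x. P m x})"
proof -
  have "\<forall>m. \<exists>N. {x \<in> space (M m). \<not> P m x} \<subseteq> N \<and> N \<in> null_sets (M m)"
    using AE unfolding eventually_ae_filter by blast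
  then obtain N where N: "\<And>m. {x \<in> space (M m). \<not> P m x} \<subseteq> N m" "\<And>m. N m \<in> null_sets (M m)"
    by metis
  have "measure (M m) (space (M m) - N m) = 1" for m
    using prob_space.prob_compl[OF M, of "N m" m] N(2)[of m]
    by (auto simp: null_sets_def measure_def)
  then show ?thesis
    unfolding whp_def using N by (intro exI[of _ "\<lambda>m. space (M m) - N m"]) (auto simp: null_setsD2)
qed

lemma whp_eventually_gt:
  assumes "whp M E" "b < 1"
  shows "\<forall>\<^sub>F m in at_top. \<exists>A \<in> sets (M m). A \<subseteq> E m \<and> b < measure (M m) A"
proof -
  from assms obtain A where A: "\<And>m. A m \<in> sets (M m)" "\<And>m. A m \<subseteq> E m"
    "((\<lambda>m. measure (M m) (A m)) \<longlongrightarrow> 1) at_top"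
    unfolding whp_def by auto
  have "\<forall>\<^sub>F m in at_top. b < measure (M m) (A m)"
    using A(3) assms(2) by (rule order_tendstoD)
  then show ?thesis by (rule eventually_mono) (use A(1,2) in blast)
qed

text \<open>For bounds on numbers such as \<open>lam m\<close>, which do not depend on the
  configuration, one configuration with all the required properties is enough.\<close>

lemma whp_eventually_nonempty:
  assumes "whp M E"
  shows "\<forall>\<^sub>F m in at_top. E m \<noteq> {}"
  by (rule eventually_mono[OF whp_eventually_gt[OF assms, of 0]]) auto

lemma overlay_prob_space: "prob_space (overlay_measure Q m)"
proof -
  interpret N1: prob_space "node_process (primary_density Q m)" by (rule prob_space_node_process)
  interpret N2: prob_space "node_process m" by (rule prob_space_node_process)
  interpret pair_prob_space "node_process (primary_density Q m)" "node_process m" ..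
  show ?thesis unfolding overlay_measure_def by unfold_locales
qed

lemma space_overlay_measure [simp]: "space (overlay_measure Q m) = UNIV"
  by (simp add: overlay_measure_def space_pair_measure)

lemma overlay_measure_Times:
  assumes "A \<in> sets (node_process (primary_density Q m))" "B \<in> sets (node_process m)"
  shows "measure (overlay_measure Q m) (A \<times> B) =
    measure (node_process (primary_density Q m)) A * measure (node_process m) B"
proof -
  interpret S: prob_space "node_process m" by (rule prob_space_node_process)
  show ?thesis
    using assms by (simp add: overlay_measure_def measure_def S.emeasure_pair_measure_Times enn2real_mult)
qed

lemma whp_overlay:
  assumes "whp (\<lambda>m. node_process (primary_density Q m)) E" "whp node_process F"
  shows "whp (overlay_measure Q) (\<lambda>m. E m \<times> F m)"
proof -
  from assms(1) obtain A where A: "\<And>m. A m \<in> sets (node_process (primary_density Q m))" "\<And>m. A m \<subseteq> E m"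
    "((\<lambda>m. measure (node_process (primary_density Q m)) (A m)) \<longlongrightarrow> 1) at_top"
    unfolding whp_def by auto
  from assms(2) obtain B where B: "\<And>m. B m \<in> sets (node_process m)" "\<And>m. B m \<subseteq> F m"
    "((\<lambda>m. measure (node_process m) (B m)) \<longlongrightarrow> 1) at_top"
    unfolding whp_def by auto
  have "A m \<times> B m \<in> sets (overlay_measure Q m)" for m
    unfolding overlay_measure_def using A(1) B(1) by (rule pair_measureI)
  moreover have "((\<lambda>m. measure (overlay_measure Q m) (A m \<times> B m)) \<longlongrightarrow> 1) at_top"
    using tendsto_mult[OF A(3) B(3)] by (simp add: overlay_measure_Times A(1) B(1))
  ultimately show ?thesis
    unfolding whp_def by (intro exI[of _ "\<lambda>m. A m \<times> B m"] conjI allI Sigma_mono A(2) B(2)) auto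
qed

lemma whp_UNIV: "(\<And>m. prob_space (M m)) \<Longrightarrow> whp M (\<lambda>_. UNIV)"
  using whp_AE[of M "\<lambda>_ _. True"] by simp

section \<open>Typical configurations\<close>

lemma whp_positions:
  "whp (\<lambda>m. node_process (d m)) (\<lambda>m. {w. (\<forall>i. src w i \<in> unit_square) \<and> (\<forall>i. dst w i \<in> unit_square) \<and>
     (\<forall>i. src w i \<noteq> dst w i)})"
proof (rule whp_AE[OF prob_space_node_process])
  fix m
  have "AE w in node_process (d m). src w i \<noteq> dst w i" for i
    unfolding src_def dst_def by (rule AE_nodes_distinct) simp
  then have "AE w in node_process (d m). \<forall>i. src w i \<noteq> dst w i"
    by (simp add: AE_all_countable)
  with AE_nodes_in_unit_square[of "d m"]
  show "AE w in node_process (d m). (\<forall>i. src w i \<in> unit_square) \<and> (\<forall>i. dst w i \<in> unit_square) \<and>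
     (\<forall>i. src w i \<noteq> dst w i)"
    by eventually_elim (auto simp: src_def dst_def)
qed

text \<open>The mean is about \<open>d * p / 2\<close>. The threshold \<open>d * p / 8\<close>
  leaves the exponent \<open>1 / 2 - d * p / 8\<close> in the lower tail bound, so it is enough that
  the mean tends to infinity.\<close>

lemma whp_count_pairs_gt:
  assumes d: "\<forall>\<^sub>F m in at_top. 0 < d m" and AB: "\<And>m. A m \<in> sets borel" "\<And>m. B m \<in> sets borel"
    and p: "\<forall>\<^sub>F m in at_top. p m = measure uniform_point (A m) * measure uniform_point (B m)"
    and lim: "filterlim (\<lambda>m. d m * p m) at_top at_top"
  shows "whp (\<lambda>m. node_process (d m)) (\<lambda>m. {w. d m * p m / 8 < real (count_pairs (A m) (B m) w)})"
proof (rule whpI[OF prob_space_node_process])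
  show "\<forall>\<^sub>F m in at_top. {w. d m * p m / 8 < real (count_pairs (A m) (B m) w)} \<in> sets (node_process (d m))"
    by (intro always_eventually allI sets_count_pairs AB)
  show "\<forall>\<^sub>F m in at_top. measure (node_process (d m))
      (space (node_process (d m)) - {w. d m * p m / 8 < real (count_pairs (A m) (B m) w)})
      \<le> exp (1 / 2 - (d m * p m) / 8)"
    using d p
  proof eventually_elim
    case (elim m)
    have "space (node_process (d m)) - {w. d m * p m / 8 < real (count_pairs (A m) (B m) w)} =
      {w. real (count_pairs (A m) (B m) w) \<le> d m * p m / 8}" by auto
    moreover have "d m * p m / 8 + 1 / 2 - d m * p m / 4 = 1 / 2 - d m * p m / 8" by simp
    ultimately show ?case
      using prob_count_pairs_le[OF AB elim, of "d m * p m / 8"] by (simp only:)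
  qed
  have "((\<lambda>x::real. exp (1 / 2 - x / 8)) \<longlongrightarrow> 0) at_top" by real_asymp
  from filterlim_compose[OF this lim]
  show "((\<lambda>m. exp (1 / 2 - d m * p m / 8)) \<longlongrightarrow> 0) at_top" .
qed

lemma prob_cell:
  assumes "0 < q" "c \<in> grid q"
  shows "{z. cell_of q z = c} \<in> sets borel" "measure uniform_point {z. cell_of q z = c} = 1 / (real q)\<^sup>2"
proof -
  obtain x y where c: "c = (x, y)" by (cases c)
  have eq: "{z. cell_of q z = c} =
    {of_int x / real q..<(of_int x + 1) / real q} \<times> {of_int y / real q..<(of_int y + 1) / real q}"
    unfolding c using cell_of_eq_iff[OF assms(1)] by blast
  show "{z. cell_of q z = c} \<in> sets borel" unfolding eq by (rule rectangle_borel)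
  have "0 \<le> x" "0 \<le> y" "real_of_int x + 1 \<le> real q" "real_of_int y + 1 \<le> real q"
    using assms(2) by (auto simp: grid_def c)
  then show "measure uniform_point {z. cell_of q z = c} = 1 / (real q)\<^sup>2"
    unfolding eq using assms(1)
    by (subst prob_rectangle) (auto simp: divide_right_mono power2_eq_square field_simps)
qed

lemma occupied_iff: "nodes_in q w c \<noteq> [] \<longleftrightarrow> \<not> (\<forall>i < fst w. snd w i \<notin> {z. cell_of q z = c})"
  unfolding set_empty[symmetric] set_nodes_in by auto

lemma sets_occupied:
  assumes "0 < q"
  shows "{w. \<forall>c \<in> grid q. nodes_in q w c \<noteq> []} \<in> sets (node_process d)"
proof -
  have "{w. \<forall>c \<in> grid q. nodes_in q w c \<noteq> []} =
    space (node_process d) - (\<Union>c\<in>grid q. {w. \<forall>i < fst w. snd w i \<notin> {z. cell_of q z = c}})"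
    by (auto simp: occupied_iff)
  also have "\<dots> \<in> sets (node_process d)"
    using sets_all_avoid[OF prob_cell(1)[OF assms]]
    by (intro sets.compl_sets sets.finite_UN) (auto simp: grid_def)
  finally show ?thesis .
qed

lemma whp_occupied:
  assumes d: "filterlim d at_top at_top"
    and q: "\<forall>\<^sub>F m in at_top. 0 < q m \<and> ln (d m) * (real (q m))\<^sup>2 \<le> d m"
  shows "whp (\<lambda>m. node_process (d m)) (\<lambda>m. {w. \<forall>c \<in> grid (q m). nodes_in (q m) w c \<noteq> []})"
proof (rule whpI[OF prob_space_node_process])
  show "\<forall>\<^sub>F m in at_top. {w. \<forall>c \<in> grid (q m). nodes_in (q m) w c \<noteq> []} \<in> sets (node_process (d m))"
    using q by (rule eventually_mono) (simp add: sets_occupied)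
  have "\<forall>\<^sub>F m in at_top. 0 < d m" using d by (simp add: filterlim_at_top_dense)
  with q show "\<forall>\<^sub>F m in at_top. measure (node_process (d m))
    (space (node_process (d m)) - {w. \<forall>c \<in> grid (q m). nodes_in (q m) w c \<noteq> []}) \<le>
    (real (q m))\<^sup>2 * exp (- d m / (real (q m))\<^sup>2)"
  proof eventually_elim
    case (elim m)
    let ?V = "\<lambda>c. {w. \<forall>i < fst w. snd w i \<notin> {z. cell_of (q m) z = c}}"
    have fin: "finite (grid (q m))" and card: "card (grid (q m)) = q m * q m"
      by (simp_all add: grid_def)
    have "space (node_process (d m)) - {w. \<forall>c \<in> grid (q m). nodes_in (q m) w c \<noteq> []} = (\<Union>c\<in>grid (q m). ?V c)"
      by (auto simp: occupied_iff)
    also have "measure (node_process (d m)) \<dots> \<le> (\<Sum>c\<in>grid (q m). measure (node_process (d m)) (?V c))"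
      using sets_all_avoid[OF prob_cell(1)] elim by (intro measure_UNION_le fin) auto
    also have "\<dots> = (\<Sum>c\<in>grid (q m). exp (- d m / (real (q m))\<^sup>2))"
    proof (intro sum.cong refl)
      fix c assume "c \<in> grid (q m)"
      with elim(1) have c: "{z. cell_of (q m) z = c} \<in> sets borel"
        "measure uniform_point {z. cell_of (q m) z = c} = 1 / (real (q m))\<^sup>2"
        by (simp_all add: prob_cell)
      from prob_all_avoid[OF elim(2) c(1)]
      show "measure (node_process (d m)) (?V c) = exp (- d m / (real (q m))\<^sup>2)"
        unfolding c(2) by simp
    qed
    finally show ?case by (simp add: card power2_eq_square)
  qed
  show "((\<lambda>m. (real (q m))\<^sup>2 * exp (- d m / (real (q m))\<^sup>2)) \<longlongrightarrow> 0) at_top"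
    using d q by (rule tendsto_empty_cells)
qed

definition row_strip :: "nat \<Rightarrow> nat \<Rightarrow> point set" where
  "row_strip q y = {0..<1} \<times> {real y / real q..<(real y + 1) / real q}"

definition column_strip :: "nat \<Rightarrow> nat \<Rightarrow> point set" where
  "column_strip q x = {real x / real q..<(real x + 1) / real q} \<times> {0..<1}"

lemma prob_strip:
  assumes "0 < q" "y < q"
  shows "measure uniform_point (row_strip q y) = 1 / real q"
    and "measure uniform_point (column_strip q y) = 1 / real q"
proof -
  have "real y + 1 \<le> real q" using assms by simp
  then show "measure uniform_point (row_strip q y) = 1 / real q"
    "measure uniform_point (column_strip q y) = 1 / real q"
    unfolding row_strip_def column_strip_def using assms
    by (subst prob_rectangle; force simp: divide_right_mono field_simps)+
qed

lemma prob_unit_square: "measure uniform_point unit_square = 1"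
  using prob_rectangle[of 0 1 0 1] by simp

definition light_strips :: "nat \<Rightarrow> real \<Rightarrow> config \<Rightarrow> bool" where
  "light_strips q a w \<longleftrightarrow> (\<forall>y < q. real (count_pairs (row_strip q y) unit_square w) < a \<and>
      real (count_pairs unit_square (column_strip q y) w) < a)"

text \<open>A path through a cell has its source in the row or its destination in the column of the cell.\<close>

lemma packet_slots_le:
  assumes "0 < q" "c \<in> grid q" "light_strips q a w"
    and "\<And>i. src w i \<in> unit_square" "\<And>i. dst w i \<in> unit_square"
  shows "real (length (packet_slots q w c)) \<le> 3 * a"
proof -
  obtain x y where c: "c = (int x, int y)" "x < q" "y < q"
    using assms(2) by (cases c) (auto simp: grid_def elim!: nonneg_int_cases)
  have row: "z \<in> row_strip q y" if "snd (cell_of q z) = int y" "z \<in> unit_square" for z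
    using that cell_of_eq_iff[OF assms(1), of z "fst (cell_of q z)" "int y"]
    by (simp add: row_strip_def mem_Times_iff prod_eq_iff)
  have col: "z \<in> column_strip q x" if "fst (cell_of q z) = int x" "z \<in> unit_square" for z
    using that cell_of_eq_iff[OF assms(1), of z "int x" "snd (cell_of q z)"]
    by (simp add: column_strip_def mem_Times_iff prod_eq_iff)
  let ?R = "{i. i < num_pairs w \<and> src w i \<in> row_strip q y \<and> dst w i \<in> unit_square}"
  let ?C = "{i. i < num_pairs w \<and> src w i \<in> unit_square \<and> dst w i \<in> column_strip q x}"
  have o: "originating q w c \<subseteq> ?R"
    using row[OF _ assms(4)] assms(5) by (auto simp: originating_def c(1) simp del: mem_Times_iff)
  have p: "passing q w c \<subseteq> ?R \<union> ?C"
  proof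
    fix i assume "i \<in> passing q w c"
    then obtain k where i: "i < num_pairs w" "path q w i k = c" by (auto simp: passing_def)
    from route_row_or_column[of "cell_of q (src w i)" "cell_of q (dst w i)" k]
    have "snd (cell_of q (src w i)) = int y \<or> fst (cell_of q (dst w i)) = int x"
      using i(2) by (auto simp: path_def c(1))
    then show "i \<in> ?R \<union> ?C"
      using i(1) row[OF _ assms(4)] col[OF _ assms(5)] assms(4,5) by blast
  qed
  have "length (packet_slots q w c) = card (passing q w c) + card (originating q w c)"
    by (simp add: packet_slots_def)
  \<comment> \<open>The row strip is used twice, for passing and for originating paths, and the
    column strip once; hence the factor 3.\<close>
  also have "\<dots> \<le> card (?R \<union> ?C) + card ?R"
    by (intro add_mono card_mono o p) auto
  also have "\<dots> \<le> (card ?R + card ?C) + card ?R"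
    by (intro add_right_mono card_Un_le)
  finally have "real (length (packet_slots q w c)) \<le> real (card ?R) + real (card ?C) + real (card ?R)"
    by linarith
  moreover have "real (card ?R) < a" "real (card ?C) < a"
    using assms(3) c(2,3) by (auto simp: light_strips_def count_pairs_def)
  ultimately show ?thesis by linarith
qed

text \<open>A strip has probability \<open>1 / q\<close>, so the threshold \<open>4 * d / q\<close>
  exceeds the term \<open>2 * d / q\<close> of the upper tail bound by \<open>2 * d / q\<close>,
  which is at least \<open>2 * q\<close>. The union bound over \<open>2 * q\<close> strips then
  tends to 0.\<close>

lemma whp_light_strips:
  assumes q: "filterlim (\<lambda>m. real (q m)) at_top at_top"
    and d: "\<forall>\<^sub>F m in at_top. (real (q m))\<^sup>2 \<le> d m"
  shows "whp (\<lambda>m. node_process (d m)) (\<lambda>m. {w. light_strips (q m) (4 * d m / real (q m)) w})"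
proof (rule whpI[OF prob_space_node_process])
  have strips [simp]: "row_strip q y \<in> sets borel" "column_strip q y \<in> sets borel" for q y
    by (simp_all add: row_strip_def column_strip_def)
  let ?V = "\<lambda>m y. {w. 4 * d m / real (q m) \<le> real (count_pairs (row_strip (q m) y) unit_square w)}"
  let ?W = "\<lambda>m y. {w. 4 * d m / real (q m) \<le> real (count_pairs unit_square (column_strip (q m) y) w)}"
  have sets: "?V m y \<in> sets (node_process (d m))" "?W m y \<in> sets (node_process (d m))" for m y
    by (auto intro!: sets_count_pairs)
  have compl: "space (node_process (d m)) - {w. light_strips (q m) (4 * d m / real (q m)) w} =
      (\<Union>y\<in>{..<q m}. ?V m y \<union> ?W m y)" for m
    by (auto simp: light_strips_def not_less)
  have "{w. light_strips (q m) (4 * d m / real (q m)) w} =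
    space (node_process (d m)) - (\<Union>y\<in>{..<q m}. ?V m y \<union> ?W m y)" for m
    using compl[of m] by auto
  then have "{w. light_strips (q m) (4 * d m / real (q m)) w} \<in> sets (node_process (d m))" for m
    using sets by (simp only:) (intro sets.compl_sets sets.finite_UN sets.Un; simp)
  then show "\<forall>\<^sub>F m in at_top. {w. light_strips (q m) (4 * d m / real (q m)) w} \<in> sets (node_process (d m))"
    by simp
  have "\<forall>\<^sub>F m in at_top. 1 \<le> real (q m)" using q unfolding filterlim_at_top by blast
  with d show "\<forall>\<^sub>F m in at_top. measure (node_process (d m))
      (space (node_process (d m)) - {w. light_strips (q m) (4 * d m / real (q m)) w}) \<le>
      2 * real (q m) * exp (- 2 * real (q m))"
  proof eventually_elim
    case (elim m)
    have q0: "0 < q m" using elim(2) by linarith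
    have d0: "0 < d m" using elim q0 by (smt (verit) of_nat_0_less_iff zero_less_power)
    have dq: "real (q m) \<le> d m / real (q m)"
      using elim q0 by (simp add: pos_le_divide_eq power2_eq_square)
    have bound: "measure (node_process (d m)) (?V m y \<union> ?W m y) \<le> 2 * exp (- 2 * real (q m))" if "y < q m" for y
    proof -
      have e: "exp (2 * d m * (1 / real (q m)) - 4 * d m / real (q m)) \<le> exp (- 2 * real (q m))"
        using dq by simp
      have "measure (node_process (d m)) (?V m y) \<le> exp (2 * d m * (1 / real (q m)) - 4 * d m / real (q m))"
        by (rule prob_count_pairs_ge) (simp_all add: d0 prob_strip[OF q0 that] prob_unit_square)
      moreover have "measure (node_process (d m)) (?W m y) \<le> exp (2 * d m * (1 / real (q m)) - 4 * d m / real (q m))"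
        by (rule prob_count_pairs_ge) (simp_all add: d0 prob_strip[OF q0 that] prob_unit_square)
      ultimately show ?thesis
        using measure_Un_le[OF sets(1)[of m y] sets(2)[of m y]] e by linarith
    qed
    have "measure (node_process (d m)) (\<Union>y\<in>{..<q m}. ?V m y \<union> ?W m y) \<le>
      (\<Sum>y<q m. measure (node_process (d m)) (?V m y \<union> ?W m y))"
      using sets by (intro measure_UNION_le) auto
    also have "\<dots> \<le> (\<Sum>y<q m. 2 * exp (- 2 * real (q m)))"
      using bound by (intro sum_mono) auto
    finally show ?case unfolding compl by (simp add: mult_ac)
  qed
  have "((\<lambda>x::real. 2 * x * exp (- 2 * x)) \<longlongrightarrow> 0) at_top" by real_asymp
  from filterlim_compose[OF this q] show "((\<lambda>m. 2 * real (q m) * exp (- 2 * real (q m))) \<longlongrightarrow> 0) at_top" .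
qed

context overlay_params
begin

abbreviation q :: "real \<Rightarrow> nat" where "q \<equiv> secondary_cells Q"

lemma eventually_admissible: "\<forall>\<^sub>F m in at_top. admissible m"
  using eventually_cells by (simp add: admissible_def)

lemma eventually_secondary_cells_ge: "\<forall>\<^sub>F m in at_top. b \<le> real (q m)"
  using secondary_cells_at_top unfolding filterlim_at_top by blast

lemma eventually_secondary_density: "\<forall>\<^sub>F m in at_top. 0 < q m \<and> ln m * (real (q m))\<^sup>2 \<le> m"
  using eventually_admissible eventually_gt_at_top[of 1]
  by eventually_elim (simp add: admissible_pos secondary_cells_density)

lemma eventually_primary_density:
  "\<forall>\<^sub>F m in at_top. 0 < primary_cells Q m \<and>
     ln (primary_density Q m) * (real (primary_cells Q m))\<^sup>2 \<le> primary_density Q m"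
  using eventually_admissible eventually_gt_at_top[of 1]
  by eventually_elim (simp add: admissible_pos primary_cells_density)

lemma eventually_square_le: "\<forall>\<^sub>F m in at_top. (real (q m))\<^sup>2 \<le> m"
  using eventually_secondary_density eventually_gt_at_top[of "exp 1"]
proof eventually_elim
  case (elim m)
  have "0 < m" using elim(2) by (meson exp_gt_zero less_trans)
  then have "1 \<le> ln m" using elim(2) by (simp add: ln_ge_iff)
  then have "1 * (real (q m))\<^sup>2 \<le> ln m * (real (q m))\<^sup>2" by (intro mult_right_mono) auto
  then show ?case using elim(1) by linarith
qed

lemma whp_secondary_occupied: "whp node_process (\<lambda>m. {w. \<forall>c \<in> grid (q m). nodes_in (q m) w c \<noteq> []})"
  using whp_occupied[where d = "\<lambda>m. m" and q = q] eventually_secondary_density filterlim_ident by blast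

lemma whp_primary_occupied:
  "whp (\<lambda>m. node_process (primary_density Q m))
     (\<lambda>m. {w. \<forall>c \<in> grid (primary_cells Q m). nodes_in (primary_cells Q m) w c \<noteq> []})"
  using primary_density_at_top eventually_primary_density by (rule whp_occupied)

section \<open>Achieved throughput\<close>

lemma achieves_order:
  obtains r where "0 < r" "achieves Q (\<lambda>m. if 0 < m then r * (real (q m) / m) else 0)"
proof -
  from slot_capacity_lower obtain rho where rho: "0 < rho" and cap:
    "\<And>m wp ws i k v. \<lbrakk>admissible m; i < num_pairs ws; k < hops (secondary_cells Q m) ws i;
      secondary_may Q m wp (path (secondary_cells Q m) ws i k) v; src ws i \<noteq> dst ws i;
      nodes_in (secondary_cells Q m) ws (path (secondary_cells Q m) ws i k) \<noteq> [];
      Suc k < hops (secondary_cells Q m) ws i \<Longrightarrow>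
        nodes_in (secondary_cells Q m) ws (path (secondary_cells Q m) ws i (Suc k)) \<noteq> []\<rbrakk>
     \<Longrightarrow> rho / real (length (packet_slots (secondary_cells Q m) ws (path (secondary_cells Q m) ws i k)))
       \<le> slot_capacity Q m wp ws i k v"
    by blast
  \<comment> \<open>A cell has at most \<open>12 * m / q\<close> packet slots, 3 times the strip
    bound. With \<open>l = 625 * lam\<close>, the requirement that \<open>625 * l\<close> fits into
    a slot becomes an equality for this \<open>r\<close>, as 7500 is 12 times 625.\<close>
  define r where "r = rho / 7500 / 625"
  define lam where "lam m = (if 0 < m then r * (real (q m) / m) else 0)" for m
  \<comment> \<open>The packet size has to be positive for every \<open>m\<close>, even where
    \<open>lam\<close> vanishes.\<close>
  define l where "l m = (if 0 < lam m then 625 * lam m else 1)" for m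
  have r: "0 < r" using rho by (simp add: r_def)
  have ls: "whp node_process (\<lambda>m. {w. light_strips (q m) (4 * m / real (q m)) w})"
    using whp_light_strips[where d = "\<lambda>m. m" and q = q] secondary_cells_at_top eventually_square_le by blast
  let ?E = "\<lambda>m. {w. (\<forall>i. src w i \<in> unit_square) \<and> (\<forall>i. dst w i \<in> unit_square) \<and> (\<forall>i. src w i \<noteq> dst w i)}
      \<inter> ({w. \<forall>c \<in> grid (q m). nodes_in (q m) w c \<noteq> []} \<inter> {w. light_strips (q m) (4 * m / real (q m)) w})"
  have "whp node_process ?E"
    using whp_positions[where d = "\<lambda>m. m"] whp_secondary_occupied ls
    by (intro whp_Int prob_space_node_process)
  from whp_overlay[OF whp_UNIV[OF prob_space_node_process] this]
  have typical: "whp (overlay_measure Q) (\<lambda>m. UNIV \<times> ?E m)" .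
  have "whp (overlay_measure Q)
    (\<lambda>m. {(wp, ws). \<forall>i < num_pairs ws.
        ereal (lam m) \<le> liminf (\<lambda>t. ereal (delivered_bits Q m wp ws (l m) i t / real t))})"
    using typical
  proof (rule whp_mono)
    show "\<forall>\<^sub>F m in at_top. UNIV \<times> ?E m \<subseteq> {(wp, ws). \<forall>i < num_pairs ws.
        ereal (lam m) \<le> liminf (\<lambda>t. ereal (delivered_bits Q m wp ws (l m) i t / real t))}"
      using eventually_admissible eventually_gt_at_top[of 0]
    proof eventually_elim
      case (elim m)
      note q0 = admissible_pos(2)[OF elim(1)]
      have lam0: "0 < lam m" using r elim(2) q0 by (simp add: lam_def)
      then have l: "l m = 625 * lam m" "0 < l m" by (simp_all add: l_def)
      show ?case
      proof clarify
        fix wp ws i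
        assume w: "\<forall>i. src ws i \<in> unit_square" "\<forall>i. dst ws i \<in> unit_square" "\<forall>i. src ws i \<noteq> dst ws i"
          "\<forall>c \<in> grid (q m). nodes_in (q m) ws c \<noteq> []"
          and light: "light_strips (q m) (4 * m / real (q m)) ws" and i: "i < num_pairs ws"
        have "ereal (l m / 625) \<le> liminf (\<lambda>t. ereal (delivered_bits Q m wp ws (l m) i t / real t))"
        proof (rule throughput_ge[OF elim(1) l(2)], intro conjI)
          fix k v assume k: "k < hops (q m) ws i" and may: "secondary_may Q m wp (path (q m) ws i k) v"
          let ?c = "path (q m) ws i k"
          have grid: "path (q m) ws i k' \<in> grid (q m)" if "k' < hops (q m) ws i" for k'
            using q0 w that by (intro path_in_grid) auto
          show occ: "nodes_in (q m) ws ?c \<noteq> []" using w(4) grid[OF k] by blast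
          have len: "real (length (packet_slots (q m) ws ?c)) \<le> 3 * (4 * m / real (q m))"
            using w by (intro packet_slots_le[OF q0 grid[OF k] light]) auto
          have pos: "0 < length (packet_slots (q m) ws ?c)"
            using in_packet_slots[OF i k] by (auto simp del: set_packet_slots)
          have "625 * l m = rho / (3 * (4 * m / real (q m)))"
            using elim(2) q0 by (simp add: l(1) lam_def r_def)
          also have "\<dots> \<le> rho / real (length (packet_slots (q m) ws ?c))"
            using len pos rho elim(2) q0 by (intro divide_left_mono mult_pos_pos divide_pos_pos) auto
          also have "\<dots> \<le> slot_capacity Q m wp ws i k v"
            using w grid by (intro cap[OF elim(1) i k may _ occ]) auto
          finally show "625 * l m \<le> slot_capacity Q m wp ws i k v" .
        qed
        then show "ereal (lam m) \<le> liminf (\<lambda>t. ereal (delivered_bits Q m wp ws (l m) i t / real t))"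
          by (simp add: l(1))
      qed
    qed
  qed
  moreover have "0 \<le> lam m" "0 < l m" for m
    using r by (auto simp: lam_def l_def)
  ultimately have "achieves Q lam"
    unfolding achieves_def by blast
  then show ?thesis using r that unfolding lam_def by blast
qed

section \<open>Upper bound on the throughput\<close>

definition left_strip :: "nat \<Rightarrow> point set" where
  "left_strip k = {0..<1/3} \<times> {0..<1 / real k}"

definition right_third :: "point set" where
  "right_third = {2/3..<1} \<times> {0..<1}"

text \<open>The left half of the cell \<open>(k div 2, 0)\<close>, the same cell whose load is
  bounded below.\<close>

definition left_half_cell :: "nat \<Rightarrow> point set" where
  "left_half_cell k = {real (k div 2) / real k..<(real (k div 2) + 1 / 2) / real k} \<times> {0..<1 / real k}"

lemma sets_regions [simp]:
  "left_strip k \<in> sets borel" "right_third \<in> sets borel" "left_half_cell k \<in> sets borel"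
  by (simp_all add: left_strip_def right_third_def left_half_cell_def)

text \<open>The bound 6 is the solution of \<open>2 * k / 3 \<ge> k / 2 + 1\<close>: the right third
  starts at least one whole cell beyond the left edge of the middle column.\<close>

lemma right_third_column:
  assumes "6 \<le> k" "z \<in> right_third"
  shows "int (k div 2) < fst (cell_of k z)"
proof -
  have "real k * (2 / 3) \<le> real k * fst z"
    using assms(2) by (intro mult_left_mono) (auto simp: right_third_def)
  moreover have "real (k div 2) \<le> real k / 2" by simp
  moreover have "6 \<le> real k" using assms(1) by simp
  ultimately have "real (k div 2) + 1 \<le> real k * fst z" by linarith
  then show ?thesis unfolding cell_of_def fst_conv by linarith
qed

lemma left_strip_cell:
  assumes "6 \<le> k" "z \<in> left_strip k"
  shows "fst (cell_of k z) < int (k div 2)" "snd (cell_of k z) = 0"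
proof -
  have k: "0 < real k" "6 \<le> real k" using assms(1) by simp_all
  have "real k * fst z < real k * (1 / 3)"
    using assms(2) k by (intro mult_strict_left_mono) (auto simp: left_strip_def)
  moreover have "real k \<le> 2 * real (k div 2) + 1"
    using of_nat_le_iff[of k "2 * (k div 2) + 1", where 'a = real] by simp
  ultimately have "real k * fst z < real (k div 2)" using k by argo
  then show "fst (cell_of k z) < int (k div 2)" unfolding cell_of_def fst_conv by linarith
  show "snd (cell_of k z) = 0"
    using assms(2) k by (auto simp: cell_of_def left_strip_def floor_eq_iff pos_less_divide_eq mult.commute)
qed

lemma left_half_cell_cell:
  assumes "0 < k" "z \<in> left_half_cell k"
  shows "cell_of k z = (int (k div 2), 0)" "real k * fst z < real (k div 2) + 1 / 2"
proof -
  have k: "0 < real k" using assms(1) by simp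
  have z: "real (k div 2) \<le> real k * fst z" "real k * fst z < real (k div 2) + 1 / 2"
    "0 \<le> real k * snd z" "real k * snd z < 1"
    using assms(2) k unfolding left_half_cell_def
    by (simp_all add: mem_Times_iff pos_divide_le_eq pos_less_divide_eq mult.commute)
  then show "real k * fst z < real (k div 2) + 1 / 2" by simp
  show "cell_of k z = (int (k div 2), 0)"
    using z by (simp add: cell_of_def floor_eq_iff)
qed

text \<open>All horizontal paths from the left third to the right third of the lowest row pass through its
  middle cell.\<close>

lemma count_pairs_le_packet_slots:
  assumes "6 \<le> k"
  shows "count_pairs (left_strip k) right_third w \<le> length (packet_slots k w (int (k div 2), 0))"
proof -
  let ?c = "(int (k div 2), 0) :: cell"
  have "{i. i < num_pairs w \<and> src w i \<in> left_strip k \<and> dst w i \<in> right_third} \<subseteq> passing k w ?c"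
  proof clarify
    fix i assume i: "i < num_pairs w" "src w i \<in> left_strip k" "dst w i \<in> right_third"
    obtain a b where s: "cell_of k (src w i) = (a, b)" by (cases "cell_of k (src w i)")
    obtain a' b' where d: "cell_of k (dst w i) = (a', b')" by (cases "cell_of k (dst w i)")
    have a: "a < int (k div 2)" "b = 0" "int (k div 2) < a'"
      using left_strip_cell[OF assms i(2)] right_third_column[OF assms i(3)] by (simp_all add: s d)
    define h where "h = nat (int (k div 2) - a)"
    have h: "0 < h" "int h = int (k div 2) - a" using a by (simp_all add: h_def)
    have "int h < a' - a" using a h by linarith
    then have "h < hops k w i" "path k w i h = ?c"
      using a h by (auto simp: hops_def path_def s d)
    then show "i \<in> passing k w ?c" using i h by (auto simp: passing_def)
  qed
  then have "count_pairs (left_strip k) right_third w \<le> card (passing k w ?c)"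
    unfolding count_pairs_def by (intro card_mono) auto
  also have "\<dots> \<le> card (set (packet_slots k w ?c))" by (intro card_mono) auto
  also have "\<dots> \<le> length (packet_slots k w ?c)" by (rule card_length)
  finally show ?thesis .
qed

text \<open>A source in the left half of its cell is at least half a cell away from every possible receiver
  in the next cell to the right, so its rate is bounded.\<close>

lemma left_half_capacity:
  assumes "admissible m" "6 \<le> q m" "i < num_pairs ws" "src ws i \<in> left_half_cell (q m)" "dst ws i \<in> right_third"
    and "Suc 0 < hops (q m) ws i \<Longrightarrow> nodes_in (q m) ws (path (q m) ws i (Suc 0)) \<noteq> []"
  shows "slot_capacity Q m wp ws i 0 v \<le> ln (1 + secondary_pow Q * 2 powr path_loss Q / noise Q) *
    (sslot / real (length (packet_slots (q m) ws (int (q m div 2), 0))))"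
proof -
  let ?c = "(int (q m div 2), 0) :: cell"
  let ?z = "receiver (q m) ws (secondary_may Q m wp) i 0 v"
  note q0 = admissible_pos(2)[OF assms(1)]
  note s = left_half_cell_cell[OF q0 assms(4)]
  obtain a' b' where d: "cell_of (q m) (dst ws i) = (a', b')" by (cases "cell_of (q m) (dst ws i)")
  have a': "int (q m div 2) < a'" using right_third_column[OF assms(2,5)] d by simp
  have "cell_of (q m) ?z = path (q m) ws i (Suc 0)"
    using a' by (intro cell_of_receiver assms(6)) (simp add: s(1) d)
  also have "\<dots> = (int (q m div 2) + 1, 0)" using a' by (simp add: path_def s(1) d)
  finally have "real (q m div 2) + 1 \<le> real (q m) * fst ?z"
    unfolding cell_of_def by (simp add: floor_eq_iff)
  then have "1 / 2 \<le> real (q m) * fst ?z - real (q m) * fst (src ws i)" using s(2) by linarith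
  also have "\<dots> = real (q m) * (fst ?z - fst (src ws i))" by (simp add: right_diff_distrib)
  also have "\<dots> \<le> real (q m) * dist (src ws i) ?z"
    using dist_component_le(1)[of "src ws i" ?z] by (intro mult_left_mono) auto
  finally have far: "1 / 2 \<le> real (q m) * dist (src ws i) ?z" .
  have d0: "0 < dist (src ws i) ?z"
  proof (rule ccontr)
    assume "\<not> ?thesis"
    then have "dist (src ws i) ?z = 0" by simp
    then show False using far by simp
  qed
  have tx: "slot_transmitter (q m) ws (secondary_may Q m wp) (path (q m) ws i 0) i v = src ws i"
    using assms(3) by (simp add: slot_transmitter_def originating_def path_0)
  have "(real (q m) * dist (src ws i) ?z) powr (- path_loss Q) \<le> (1 / 2) powr (- path_loss Q)"
    using far path_loss by (intro powr_mono2') auto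
  also have "\<dots> = 2 powr path_loss Q" by (simp add: powr_divide powr_minus_divide)
  finally have S: "secondary_tx_power Q m * gain Q (dist (src ws i) ?z) \<le> secondary_pow Q * 2 powr path_loss Q"
    unfolding received_power_eq[OF q0 d0] using secondary_pow by (intro mult_left_mono) auto
  have S0: "0 \<le> secondary_tx_power Q m * gain Q (dist (src ws i) ?z)"
    using secondary_pow by (simp add: secondary_tx_power_def gain_def)
  have "slot_capacity Q m wp ws i 0 v \<le> ln (1 + secondary_tx_power Q m * gain Q (dist (src ws i) ?z) / noise Q) *
    (sslot / real (length (packet_slots (q m) ws ?c)))"
    using slot_capacity_bounds(1)[OF assms(3) hops_pos, of m wp v] unfolding tx by (simp add: path_0 s(1))
  also have "\<dots> \<le> ln (1 + secondary_pow Q * 2 powr path_loss Q / noise Q) *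
    (sslot / real (length (packet_slots (q m) ws ?c)))"
  proof (rule mult_right_mono)
    have "secondary_tx_power Q m * gain Q (dist (src ws i) ?z) / noise Q \<le> secondary_pow Q * 2 powr path_loss Q / noise Q"
      using S noise by (intro divide_right_mono) auto
    moreover have "0 \<le> secondary_tx_power Q m * gain Q (dist (src ws i) ?z) / noise Q"
      using S0 noise by simp
    ultimately show "ln (1 + secondary_tx_power Q m * gain Q (dist (src ws i) ?z) / noise Q) \<le>
        ln (1 + secondary_pow Q * 2 powr path_loss Q / noise Q)"
      by (subst ln_le_cancel_iff) auto
  qed (use sslot_pos in auto)
  finally show ?thesis .
qed

text \<open>One pair with a bounded first-hop capacity limits the common rate. The constants are
  probabilities: \<open>1 / (9 * q)\<close> is a third of the lowest row times the right third,
  \<open>1 / (6 * q^2)\<close> half a cell times the right third; the factor 8 of the tail bound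
  makes 9 into 72.\<close>

lemma achieves_bigo:
  assumes "achieves Q lam"
  shows "lam \<in> O(\<lambda>m. real (q m) / m)"
proof -
  define R where "R = ln (1 + secondary_pow Q * 2 powr path_loss Q / noise Q)"
  have R: "0 \<le> R" using secondary_pow noise by (simp add: R_def)
  from assms obtain l where lam: "\<And>m. 0 \<le> lam m" and l: "\<And>m. 0 < l m" and
    W: "whp (overlay_measure Q) (\<lambda>m. {(wp, ws). \<forall>i < num_pairs ws.
        ereal (lam m) \<le> liminf (\<lambda>t. ereal (delivered_bits Q m wp ws (l m) i t / real t))})"
    (is "whp _ ?W")
    unfolding achieves_def by blast
  have m0: "\<forall>\<^sub>F m::real in at_top. 0 < m" by (rule eventually_gt_at_top)
  have ge6: "\<forall>\<^sub>F m in at_top. 6 \<le> real (q m)" by (rule eventually_secondary_cells_ge)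
  have heavy: "whp node_process (\<lambda>m. {w. m * (1 / (9 * real (q m))) / 8 <
      real (count_pairs (left_strip (q m)) right_third w)})"
  proof (rule whp_count_pairs_gt[OF m0])
    show "\<forall>\<^sub>F m in at_top. 1 / (9 * real (q m)) =
        measure uniform_point (left_strip (q m)) * measure uniform_point right_third"
      using ge6 by eventually_elim (simp add: left_strip_def right_third_def prob_rectangle)
    show "filterlim (\<lambda>m. m * (1 / (9 * real (q m)))) at_top at_top"
    proof (rule filterlim_at_top_mono)
      show "filterlim (\<lambda>m. real (q m) / 9) at_top at_top"
        by (rule filterlim_compose[OF _ secondary_cells_at_top]) real_asymp
      show "\<forall>\<^sub>F m in at_top. real (q m) / 9 \<le> m * (1 / (9 * real (q m)))"
        using eventually_square_le ge6
        by eventually_elim (simp add: pos_le_divide_eq power2_eq_square)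
    qed
  qed simp_all
  have good: "whp node_process (\<lambda>m. {w. m * (1 / (6 * (real (q m))\<^sup>2)) / 8 <
      real (count_pairs (left_half_cell (q m)) right_third w)})"
  proof (rule whp_count_pairs_gt[OF m0])
    show "\<forall>\<^sub>F m in at_top. 1 / (6 * (real (q m))\<^sup>2) =
        measure uniform_point (left_half_cell (q m)) * measure uniform_point right_third"
      using ge6
    proof eventually_elim
      case (elim m)
      have "real (q m div 2) \<le> real (q m) / 2" by simp
      then have "(real (q m div 2) + 1 / 2) / real (q m) \<le> 1" using elim by (simp add: divide_le_eq_1)
      then have "measure uniform_point (left_half_cell (q m)) =
          ((real (q m div 2) + 1 / 2) / real (q m) - real (q m div 2) / real (q m)) * (1 / real (q m) - 0)"
        unfolding left_half_cell_def using elim by (intro prob_rectangle) (auto intro: divide_right_mono)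
      also have "\<dots> = 1 / (2 * (real (q m))\<^sup>2)"
        using elim by (simp add: field_simps power2_eq_square)
      finally show ?case by (simp add: right_third_def prob_rectangle)
    qed
    show "filterlim (\<lambda>m. m * (1 / (6 * (real (q m))\<^sup>2))) at_top at_top"
    proof (rule filterlim_at_top_mono)
      \<comment> \<open>The half cell needs only one suitable source. Its mean number of suitable
        pairs may grow as slowly as a logarithm, but it does tend to infinity because of
        \<open>ln m * q^2 \<le> m\<close>.\<close>
      show "filterlim (\<lambda>m::real. ln m / 6) at_top at_top" by real_asymp
      show "\<forall>\<^sub>F m in at_top. ln m / 6 \<le> m * (1 / (6 * (real (q m))\<^sup>2))"
        using eventually_secondary_density
        by eventually_elim (simp add: pos_le_divide_eq)
    qed
  qed simp_all
  let ?E = "\<lambda>m. {w. \<forall>c \<in> grid (q m). nodes_in (q m) w c \<noteq> []} \<inter>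
    ({w. (\<forall>i. src w i \<in> unit_square) \<and> (\<forall>i. dst w i \<in> unit_square) \<and> (\<forall>i. src w i \<noteq> dst w i)} \<inter>
    ({w. m * (1 / (9 * real (q m))) / 8 < real (count_pairs (left_strip (q m)) right_third w)} \<inter>
    {w. m * (1 / (6 * (real (q m))\<^sup>2)) / 8 < real (count_pairs (left_half_cell (q m)) right_third w)}))"
  have "whp node_process ?E"
    using whp_secondary_occupied whp_positions[where d = "\<lambda>m. m"] heavy good
    by (intro whp_Int prob_space_node_process)
  from whp_Int[OF overlay_prob_space W whp_overlay[OF whp_UNIV[OF prob_space_node_process] this]]
  have "\<forall>\<^sub>F m in at_top. ?W m \<inter> UNIV \<times> ?E m \<noteq> {}"
    by (rule whp_eventually_nonempty)
  then have "\<forall>\<^sub>F m in at_top. norm (lam m) \<le> (72 * R * sslot) * norm (real (q m) / m)"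
    using eventually_admissible m0 ge6
  proof eventually_elim
    case (elim m)
    note q0 = admissible_pos(2)[OF elim(2)]
    from elim(1) obtain wp ws where
      thr: "\<And>i. i < num_pairs ws \<Longrightarrow> ereal (lam m) \<le> liminf (\<lambda>t. ereal (delivered_bits Q m wp ws (l m) i t / real t))"
      and occ: "\<forall>c \<in> grid (q m). nodes_in (q m) ws c \<noteq> []"
      and pos: "\<forall>i. src ws i \<in> unit_square" "\<forall>i. dst ws i \<in> unit_square"
      and hv: "m * (1 / (9 * real (q m))) / 8 < real (count_pairs (left_strip (q m)) right_third ws)"
      and gd: "m * (1 / (6 * (real (q m))\<^sup>2)) / 8 < real (count_pairs (left_half_cell (q m)) right_third ws)"
      by auto
    have "0 \<le> m * (1 / (6 * (real (q m))\<^sup>2)) / 8" using elim(3) by simp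
    with gd have "count_pairs (left_half_cell (q m)) right_third ws \<noteq> 0" by linarith
    then obtain i where i: "i < num_pairs ws" "src ws i \<in> left_half_cell (q m)" "dst ws i \<in> right_third"
      unfolding count_pairs_def by (metis (mono_tags, lifting) card.empty Collect_empty_eq)
    let ?len = "real (length (packet_slots (q m) ws (int (q m div 2), 0)))"
    have six: "6 \<le> q m" using elim(4) by linarith
    have len: "m / (72 * real (q m)) \<le> ?len"
    proof -
      have "m / (72 * real (q m)) = m * (1 / (9 * real (q m))) / 8" by simp
      moreover have "real (count_pairs (left_strip (q m)) right_third ws) \<le> ?len"
        unfolding of_nat_le_iff by (rule count_pairs_le_packet_slots[OF six])
      ultimately show ?thesis using hv by linarith
    qed
    have "lam m \<le> 72 * R * sslot * (real (q m) / m)"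
    proof (cases "lam m = 0")
      case True
      then show ?thesis using R sslot_pos elim(3) by simp
    next
      case False
      have "lam m \<le> R * (sslot / ?len)"
      proof (rule throughput_le_capacity[OF elim(2) l _ thr[OF i(1)]])
        show "0 < lam m" using lam[of m] False by simp
        have "nodes_in (q m) ws (path (q m) ws i (Suc 0)) \<noteq> []" if "Suc 0 < hops (q m) ws i"
          using occ path_in_grid[OF q0 _ _ that] pos by blast
        from left_half_capacity[OF elim(2) six i this]
        show "slot_capacity Q m wp ws i 0 v \<le> R * (sslot / ?len)" for v
          unfolding R_def by simp
      qed
      also have "\<dots> \<le> R * (sslot / (m / (72 * real (q m))))"
      proof -
        have "0 < m / (72 * real (q m))" using elim(3) q0 by simp
        with len sslot_pos R show ?thesis
          by (intro mult_left_mono divide_left_mono mult_pos_pos) auto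
      qed
      finally show ?thesis by (simp add: mult_ac)
    qed
    then show ?case using lam[of m] elim(3) by simp
  qed
  then show ?thesis by (rule bigoI)
qed


section \<open>Delay\<close>

definition left_third :: "point set" where
  "left_third = {0..<1/3} \<times> {0..<1}"

lemma sets_left_third [simp]: "left_third \<in> sets borel"
  by (simp add: left_third_def)

lemma long_hops:
  assumes "src w i \<in> left_third" "dst w i \<in> right_third"
  shows "real k / 3 - 1 \<le> real (hops k w i)"
proof -
  obtain a b where s: "cell_of k (src w i) = (a, b)" by (cases "cell_of k (src w i)")
  obtain a' b' where d: "cell_of k (dst w i) = (a', b')" by (cases "cell_of k (dst w i)")
  have "real k * fst (src w i) \<le> real k * (1 / 3)" "real k * (2 / 3) \<le> real k * fst (dst w i)"
    using assms by (intro mult_left_mono; auto simp: left_third_def right_third_def)+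
  moreover have "of_int a \<le> real k * fst (src w i)" "real k * fst (dst w i) < of_int a' + 1"
    using s d unfolding cell_of_def prod.inject by linarith+
  ultimately have "real k / 3 - 1 \<le> of_int (a' - a)" by simp
  also have "\<dots> \<le> real (cell_dist (a, b) (a', b'))" by simp
  also have "\<dots> \<le> real (hops k w i)" by (simp add: hops_def s d)
  finally show ?thesis .
qed

definition mean_delay :: "real \<Rightarrow> config \<Rightarrow> config \<Rightarrow> ennreal" where
  "mean_delay m wp ws = (\<Sum>i < num_pairs ws.
     e2ennreal (pair_delay (q m) ws (secondary_may Q m wp) sslot i)) / of_nat (num_pairs ws)"

text \<open>At most \<open>2 * q\<close> hops of at most 625 slots each. The bound holds for every
  configuration with nodes in the unit square, not just for typical ones, as the expectation
  requires.\<close>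

lemma mean_delay_le:
  assumes "admissible m" "\<forall>i. snd ws i \<in> unit_square"
  shows "mean_delay m wp ws \<le> ennreal (1250 * sslot * real (q m))"
proof -
  interpret periodic_access "secondary_may Q m wp" 625
    by (rule secondary_may_periodic_access[OF assms(1)])
  let ?C = "1250 * sslot * real (q m)"
  have one: "e2ennreal (pair_delay (q m) ws (secondary_may Q m wp) sslot i) \<le> ennreal ?C"
    if "i < num_pairs ws" for i
  proof -
    have "hops (q m) ws i \<le> 2 * q m"
      using assms(2) by (intro hops_le admissible_pos(2)[OF assms(1)]) (simp_all add: src_def dst_def)
    then have "real (hops (q m) ws i) \<le> 2 * real (q m)" by linarith
    then have "sslot * (real (hops (q m) ws i) * 625) \<le> sslot * (2 * real (q m) * 625)"
      using sslot_pos by (intro mult_left_mono mult_right_mono) auto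
    then have "pair_delay (q m) ws (secondary_may Q m wp) sslot i \<le> ereal ?C"
      using pair_delay_bounds(2)[OF that, of sslot "q m"] sslot_pos
      by (auto elim!: order_trans simp: mult_ac)
    then show ?thesis using e2ennreal_mono by fastforce
  qed
  show ?thesis
  \<comment> \<open>Without pairs the average is \<open>0 / 0\<close>, which is 0 in
    \<open>ennreal\<close>.\<close>
  proof (cases "num_pairs ws = 0")
    case False
    have "(\<Sum>i < num_pairs ws. e2ennreal (pair_delay (q m) ws (secondary_may Q m wp) sslot i)) \<le>
        (\<Sum>i < num_pairs ws. ennreal ?C)"
      using one by (intro sum_mono) auto
    also have "\<dots> = ennreal (real (num_pairs ws) * ?C)"
      using sslot_pos by (simp add: ennreal_of_nat_eq_real_of_nat flip: ennreal_mult)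
    finally have "mean_delay m wp ws \<le> ennreal (real (num_pairs ws) * ?C) / of_nat (num_pairs ws)"
      unfolding mean_delay_def by (rule divide_right_mono_ennreal)
    also have "\<dots> = ennreal ?C"
      using False sslot_pos by (simp add: ennreal_of_nat_eq_real_of_nat divide_ennreal)
    finally show ?thesis .
  qed (simp add: mean_delay_def)
qed

text \<open>A fraction of at least \<open>1 / (4 * 72)\<close> of the pairs crosses the middle
  third. For \<open>q \<ge> 18\<close> these have
  \<open>hops - 2 \<ge> q / 3 - 3 \<ge> q / 6\<close>, and 1728 is the product of 4, 72 and
  6.\<close>

lemma mean_delay_ge:
  assumes "admissible m" "0 < m" "18 \<le> real (q m)" "real (num_pairs ws) \<le> 4 * m"
    and many: "m / 72 \<le> real (count_pairs left_third right_third ws)"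
  shows "ennreal (sslot / 1728 * real (q m)) \<le> mean_delay m wp ws"
proof -
  interpret periodic_access "secondary_may Q m wp" 625
    by (rule secondary_may_periodic_access[OF assms(1)])
  define Z where "Z = {i. i < num_pairs ws \<and> src ws i \<in> left_third \<and> dst ws i \<in> right_third}"
  have Z: "Z \<subseteq> {..<num_pairs ws}" "finite Z" by (auto simp: Z_def)
  have cZ: "m / 72 \<le> real (card Z)" using many by (simp add: count_pairs_def Z_def)
  have n0: "0 < real (num_pairs ws)"
    using cZ card_mono[OF _ Z(1)] assms(2) by (auto simp: Z_def intro: gr0I)
  let ?D = "sslot * real (q m) / 6"
  have D0: "0 \<le> ?D" using sslot_pos by simp
  have one: "ennreal ?D \<le> e2ennreal (pair_delay (q m) ws (secondary_may Q m wp) sslot i)" if "i \<in> Z" for i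
  proof -
    have i: "i < num_pairs ws" "src ws i \<in> left_third" "dst ws i \<in> right_third"
      using that by (auto simp: Z_def)
    have "real (q m) / 6 \<le> real (hops (q m) ws i) - 2"
      using long_hops[OF i(2,3), of "q m"] assms(3) by linarith
    then have "sslot * (real (q m) / 6) \<le> sslot * (real (hops (q m) ws i) - 2)"
      using sslot_pos by (intro mult_left_mono) auto
    then have "ereal ?D \<le> pair_delay (q m) ws (secondary_may Q m wp) sslot i"
      using pair_delay_bounds(1)[OF i(1), of sslot "q m"] sslot_pos by (auto intro: order_trans[rotated])
    then show ?thesis using e2ennreal_mono by fastforce
  qed
  have "ennreal (real (card Z) * ?D) = (\<Sum>i\<in>Z. ennreal ?D)"
    using D0 by (simp add: ennreal_of_nat_eq_real_of_nat flip: ennreal_mult)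
  also have "\<dots> \<le> (\<Sum>i\<in>Z. e2ennreal (pair_delay (q m) ws (secondary_may Q m wp) sslot i))"
    using one by (intro sum_mono) auto
  also have "\<dots> \<le> (\<Sum>i < num_pairs ws. e2ennreal (pair_delay (q m) ws (secondary_may Q m wp) sslot i))"
    using Z(1) by (intro sum_mono2) auto
  finally have le: "ennreal (real (card Z) * ?D) / of_nat (num_pairs ws) \<le> mean_delay m wp ws"
    unfolding mean_delay_def by (rule divide_right_mono_ennreal)
  have "sslot / 1728 * real (q m) = (m / 72) * ?D / (4 * m)"
    using assms(2) by simp
  also have "\<dots> \<le> real (card Z) * ?D / real (num_pairs ws)"
    using cZ n0 D0 assms(2,4) by (intro frac_le mult_right_mono) auto
  finally have "ennreal (sslot / 1728 * real (q m)) \<le> ennreal (real (card Z) * ?D / real (num_pairs ws))"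
    by (rule ennreal_leI)
  also have "\<dots> = ennreal (real (card Z) * ?D) / of_nat (num_pairs ws)"
    using n0 D0 by (simp add: ennreal_of_nat_eq_real_of_nat divide_ennreal)
  finally show ?thesis using le by (rule order_trans)
qed

text \<open>Almost surely all nodes lie in the unit square, so all pairs are counted by
  \<open>count_pairs\<close> for the full square and its upper tail bound applies.\<close>

lemma whp_num_pairs_le: "whp node_process (\<lambda>m. {w. real (num_pairs w) \<le> 4 * m})"
proof -
  have "whp node_process (\<lambda>m. {w. real (count_pairs unit_square unit_square w) < 4 * m})"
  proof (rule whpI[OF prob_space_node_process])
    show "\<forall>\<^sub>F m in at_top. {w. real (count_pairs unit_square unit_square w) < 4 * m} \<in> sets (node_process m)"
      by (intro always_eventually allI sets_count_pairs) simp_all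
    show "\<forall>\<^sub>F m in at_top. measure (node_process m)
        (space (node_process m) - {w. real (count_pairs unit_square unit_square w) < 4 * m}) \<le> exp (- 2 * m)"
      using eventually_gt_at_top[of 0]
    proof eventually_elim
      case (elim m)
      have "space (node_process m) - {w. real (count_pairs unit_square unit_square w) < 4 * m} =
        {w. 4 * m \<le> real (count_pairs unit_square unit_square w)}" by auto
      then show ?case
        using prob_count_pairs_ge[where A = unit_square and B = unit_square and d = m and p = 1 and a = "4 * m"] elim
        by (simp add: prob_unit_square)
    qed
    show "((\<lambda>m::real. exp (- 2 * m)) \<longlongrightarrow> 0) at_top" by real_asymp
  qed
  from whp_Int[OF prob_space_node_process whp_positions[where d = "\<lambda>m. m"] this]
  show ?thesis
  proof (rule whp_mono, intro always_eventually allI)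
    fix m
    show "{w. (\<forall>i. src w i \<in> unit_square) \<and> (\<forall>i. dst w i \<in> unit_square) \<and> (\<forall>i. src w i \<noteq> dst w i)} \<inter>
       {w. real (count_pairs unit_square unit_square w) < 4 * m} \<subseteq> {w. real (num_pairs w) \<le> 4 * m}"
    proof clarify
      fix N X
      assume "\<forall>i. src (N, X) i \<in> unit_square" "\<forall>i. dst (N, X) i \<in> unit_square"
        and less: "real (count_pairs unit_square unit_square (N, X)) < 4 * m"
      then have "count_pairs unit_square unit_square (N, X) = card {i. i < num_pairs (N, X)}"
        unfolding count_pairs_def by (intro arg_cong[of _ _ card]) blast
      with less show "real (num_pairs (N, X)) \<le> 4 * m" by simp
    qed
  qed
qed

lemma all_cells_occupied_eq: "all_cells_occupied Q m =
  {w. \<forall>c \<in> grid (primary_cells Q m). nodes_in (primary_cells Q m) w c \<noteq> []} \<times>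
  {w. \<forall>c \<in> grid (q m). nodes_in (q m) w c \<noteq> []}"
  by (auto simp: all_cells_occupied_def)

lemma sets_all_cells_occupied:
  assumes "admissible m"
  shows "all_cells_occupied Q m \<in> sets (overlay_measure Q m)"
  unfolding all_cells_occupied_eq overlay_measure_def
  using admissible_pos[OF assms] by (intro pair_measureI sets_occupied)

lemma secondary_delay_eq: "secondary_delay Q m = enn2real
  (\<integral>\<^sup>+ (wp, ws). mean_delay m wp ws \<partial>uniform_measure (overlay_measure Q m) (all_cells_occupied Q m))"
  by (simp add: secondary_delay_def mean_delay_def)

text \<open>The upper bound is almost sure. The lower bound is used only on a measurable set
  \<open>A\<close> of probability above 1/2 inside the conditioning event; conditioning can only
  increase the probability of \<open>A\<close>, and the factor 2 turns 1728 into 3456.\<close>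

lemma secondary_delay_bigtheta: "secondary_delay Q \<in> \<Theta>(\<lambda>m. real (q m))"
proof (rule bigthetaI')
  show "0 < sslot / 3456" "0 < 1250 * sslot" using sslot_pos by simp_all
  have many: "whp node_process (\<lambda>m. {w. m * (1 / 9) / 8 < real (count_pairs left_third right_third w)})"
  proof (rule whp_count_pairs_gt)
    show "\<forall>\<^sub>F m in at_top. 1 / 9 = measure uniform_point left_third * measure uniform_point right_third"
      by (simp add: left_third_def right_third_def prob_rectangle)
    show "filterlim (\<lambda>m::real. m * (1 / 9)) at_top at_top" by real_asymp
  qed (simp_all add: eventually_gt_at_top)
  let ?G = "\<lambda>m. {w. real (num_pairs w) \<le> 4 * m} \<inter> {w. m * (1 / 9) / 8 < real (count_pairs left_third right_third w)}"
  have "whp (overlay_measure Q) (\<lambda>m. all_cells_occupied Q m \<inter> UNIV \<times> ?G m)"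
    unfolding all_cells_occupied_eq
    by (intro whp_Int whp_overlay overlay_prob_space prob_space_node_process whp_UNIV
        whp_primary_occupied whp_secondary_occupied whp_num_pairs_le many)
  from whp_eventually_gt[OF this, of "1 / 2"]
  have "\<forall>\<^sub>F m in at_top. \<exists>A \<in> sets (overlay_measure Q m).
      A \<subseteq> all_cells_occupied Q m \<inter> UNIV \<times> ?G m \<and> 1 / 2 < measure (overlay_measure Q m) A"
    by simp
  then show "\<forall>\<^sub>F m in at_top. sslot / 3456 * norm (real (q m)) \<le> norm (secondary_delay Q m) \<and>
      norm (secondary_delay Q m) \<le> 1250 * sslot * norm (real (q m))"
    using eventually_admissible eventually_gt_at_top[of 0] eventually_secondary_cells_ge[of 18]
  proof eventually_elim
    case (elim m)
    let ?M = "overlay_measure Q m" and ?O = "all_cells_occupied Q m"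
    interpret M: prob_space ?M by (rule overlay_prob_space)
    from elim(1) obtain A where A: "A \<in> sets ?M" "A \<subseteq> ?O" "A \<subseteq> UNIV \<times> ?G m" "1 / 2 < M.prob A"
      by blast
    note O = sets_all_cells_occupied[OF elim(2)]
    have "M.prob A \<le> M.prob ?O" using A(2) O by (rule M.finite_measure_mono)
    then have PO: "1 / 2 < M.prob ?O" using A(4) by linarith
    have O0: "emeasure ?M ?O \<noteq> 0" "emeasure ?M ?O \<noteq> \<infinity>"
      using PO by (auto simp: M.emeasure_eq_measure)
    let ?U = "uniform_measure ?M ?O"
    interpret U: prob_space ?U by (rule prob_space_uniform_measure[OF O0])
    let ?I = "\<integral>\<^sup>+ (wp, ws). mean_delay m wp ws \<partial>?U"
    have "AE w in ?M. \<forall>i. snd (snd w) i \<in> unit_square"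
      unfolding overlay_measure_def
      by (rule AE_pair_snd[OF prob_space_imp_sigma_finite[OF prob_space_node_process] AE_nodes_in_unit_square])
    then have "AE w in ?U. \<forall>i. snd (snd w) i \<in> unit_square"
      by (intro AE_uniform_measureI[OF O]) (auto elim: eventually_mono)
    then have "AE w in ?U. (case w of (wp, ws) \<Rightarrow> mean_delay m wp ws) \<le> ennreal (1250 * sslot * real (q m))"
      by (rule eventually_mono) (auto simp: mean_delay_le[OF elim(2)])
    then have "?I \<le> (\<integral>\<^sup>+ w. ennreal (1250 * sslot * real (q m)) \<partial>?U)"
      by (rule nn_integral_mono_AE)
    then have upper: "?I \<le> ennreal (1250 * sslot * real (q m))"
      using U.emeasure_space_1 by simp
    have "ennreal (1 / 2) \<le> emeasure ?M A"
      unfolding M.emeasure_eq_measure using A(4) by (intro ennreal_leI) simp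
    also have "\<dots> \<le> emeasure ?M A / emeasure ?M ?O"
    proof -
      have "M.prob A * M.prob ?O \<le> M.prob A * 1" by (intro mult_left_mono M.prob_le_1) simp
      then have "M.prob A \<le> M.prob A / M.prob ?O" using PO by (simp add: pos_le_divide_eq)
      then show ?thesis using PO by (simp add: M.emeasure_eq_measure divide_ennreal)
    qed
    also have "\<dots> = emeasure ?U A"
      using A(1,2) O by (simp add: emeasure_uniform_measure Int_absorb1)
    finally have UA: "ennreal (1 / 2) \<le> emeasure ?U A" .
    have "ennreal (sslot / 3456 * real (q m)) = ennreal (sslot / 1728 * real (q m)) * ennreal (1 / 2)"
      using sslot_pos by (subst ennreal_mult[symmetric]) simp_all
    also have "\<dots> \<le> ennreal (sslot / 1728 * real (q m)) * emeasure ?U A"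
      using UA by (rule mult_left_mono) simp
    also have "\<dots> = (\<integral>\<^sup>+ w. ennreal (sslot / 1728 * real (q m)) * indicator A w \<partial>?U)"
      using A(1) by (simp add: nn_integral_cmult_indicator)
    also have "\<dots> \<le> ?I"
    proof (rule nn_integral_mono)
      fix w
      show "ennreal (sslot / 1728 * real (q m)) * indicator A w \<le> (case w of (wp, ws) \<Rightarrow> mean_delay m wp ws)"
      proof (cases "w \<in> A")
        case True
        obtain wp ws where w: "w = (wp, ws)" by (cases w)
        then have "ws \<in> ?G m" using A(3) True by blast
        then have "ennreal (sslot / 1728 * real (q m)) \<le> mean_delay m wp ws"
          by (intro mean_delay_ge elim) auto
        then show ?thesis using True w by simp
      qed simp
    qed
    finally have lower: "ennreal (sslot / 3456 * real (q m)) \<le> ?I" .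
    have "sslot / 3456 * real (q m) \<le> enn2real ?I" "enn2real ?I \<le> 1250 * sslot * real (q m)"
    proof -
      \<comment> \<open>Finiteness has to come first, because \<open>enn2real\<close> maps infinity
        to 0.\<close>
      have "?I < \<top>" using upper by (rule le_less_trans) simp
      then show "sslot / 3456 * real (q m) \<le> enn2real ?I"
        using enn2real_mono[OF lower] sslot_pos by simp
      show "enn2real ?I \<le> 1250 * sslot * real (q m)"
        using enn2real_mono[OF upper] sslot_pos by simp
    qed
    then show ?case by (simp add: secondary_delay_eq)
  qed
qed

text \<open>The lower bound is the maximality in \<open>secondary_throughput\<close> applied to the
  explicit achieved rate, which therefore has to be defined and nonnegative for all
  \<open>m\<close>.\<close>

lemma throughput_bigtheta:
  assumes "secondary_throughput Q lam"
  shows "lam \<in> \<Theta>(\<lambda>m. real (q m) / m)"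
proof (rule bigthetaI)
  show "lam \<in> O(\<lambda>m. real (q m) / m)"
    using assms by (intro achieves_bigo) (simp add: secondary_throughput_def)
  from achieves_order obtain r where r: "0 < r" "achieves Q (\<lambda>m. if 0 < m then r * (real (q m) / m) else 0)"
    by blast
  then have "(\<lambda>m. if 0 < m then r * (real (q m) / m) else 0) \<in> O(lam)"
    using assms by (simp add: secondary_throughput_def)
  moreover have "\<forall>\<^sub>F m in at_top. (if 0 < m then r * (real (q m) / m) else 0) = r * (real (q m) / m)"
    using eventually_gt_at_top[of 0] by eventually_elim simp
  ultimately have "(\<lambda>m. r * (real (q m) / m)) \<in> O(lam)"
    using landau_o.big.in_cong by fast
  then have "(\<lambda>m. real (q m) / m) \<in> O(lam)"
    by (subst (asm) landau_o.big.cmult_in_iff) (use r(1) in auto)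
  then show "lam \<in> \<Omega>(\<lambda>m. real (q m) / m)"
    by (simp add: bigomega_iff_bigo)
qed

lemma delay_throughput_tradeoff:
  assumes "secondary_throughput Q lam"
  shows "secondary_delay Q \<in> \<Theta>(\<lambda>m. m * lam m)"
proof -
  have "(\<lambda>m. m * lam m) \<in> \<Theta>(\<lambda>m. m * (real (q m) / m))"
    by (intro landau_theta.mult throughput_bigtheta[OF assms]) simp
  also have "\<forall>\<^sub>F m in at_top. m * (real (q m) / m) = real (q m)"
    using eventually_gt_at_top[of 0] by eventually_elim simp
  then have "\<Theta>(\<lambda>m. m * (real (q m) / m)) = \<Theta>(\<lambda>m. real (q m))"
    by (rule landau_theta.cong)
  finally have "(\<lambda>m. real (q m)) \<in> \<Theta>(\<lambda>m. m * lam m)"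
    by (simp add: bigtheta_sym)
  with secondary_delay_bigtheta show ?thesis
    by (rule landau_theta.trans)
qed

end

theorem theorem6:
  fixes Q :: overlay and lam :: "real \<Rightarrow> real"
  assumes "path_loss Q > 2" and "noise Q > 0" and "density_exp Q > 1"
    and "primary_pow Q > 0" and "secondary_pow Q > 0" and "slot_len Q > 0"
    and "\<And>n. cell_factor Q n \<ge> 1"
    and "\<forall>\<^sub>F n in at_top. cell_factor Q n * ln n / n \<le> 1 / 25"
    and "secondary_throughput Q lam"
    and "lam \<in> O(\<lambda>m. 1 / sqrt (m * ln m))"
  shows "secondary_delay Q \<in> \<Theta>(\<lambda>m. m * lam m)"
proof -
  interpret overlay_params Q using assms by unfold_locales
  show ?thesis using assms(9) by (rule delay_throughput_tradeoff)
qed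

end
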